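(* Let $\mathbf{k}$ be a field, $S=\mathbf{k}[x_1,\dots,x_n]$, and let $M$ be a finitely generated graded $S$-module with a $2$-linear minimal free resolution and $\beta_{0,0}(M)=m$. Let $\omega(M)=[\beta_{1,2}(M),\beta_{2,3}(M),\dots,\beta_{n,n+1}(M)]\in\mathbb{Z}^n$ and let $\Omega$ be the $n\times n$ matrix with $(i,j)$-entry $j\binom{i+1}{j+1}$. Then $\Omega$ is invertible, the vector $c=\omega(M)\Omega^{-1}$ lies in $\mathbb{Q}_{\ge 0}^n$, $\sum_{l=1}^n c_l=m$, and $\beta(M)=c_1\pi^1+\cdots+c_n\pi^n$.
   Context: $\beta_{i,j}(M)=\dim_{\mathbf{k}}\operatorname{Tor}_i^S(M,\mathbf{k})_j$ are the graded Betti numbers and $\beta(M)$ is the array of them. $M$ has a $2$-linear minimal free resolution if $\beta_{0,j}(M)=0$ for $j\neq 0$ and, for every $i\ge1$, $\beta_{i,j}(M)=0$ for $j\neq i+1$. For $l\in[n]$, $\pi^l$ is the pure diagram of the degree sequence $(0,2,3,\dots,l+1)$: $\pi^l_{0,0}=1$, $\pi^l_{i,i+1}=i\binom{l+1}{i+1}$ for $1\le i\le l$, and all other entries are $0$ (equivalently $\pi^l_{i,d_i}=\prod_{k\neq 0,i}|(d_k-d_0)/(d_k-d_i)|$ with $d=(0,2,\dots,l+1)$). Equality of diagrams is entrywise.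
   Formalization: The claims that the c_l sum to m and that β(M) agrees with the sum of the c_l π^l at entry (0,0) are made only when some nonzero polynomial annihilates M; they fail otherwise, e.g. for M = S, where ω = 0 but m = 1. All other claims are unconditional. *)

theory Defs
  imports
    "HOL-Library.Poly_Mapping"
    "Jordan_Normal_Form.Gauss_Jordan_Elimination"
    "Jordan_Normal_Form.VS_Connect"
begin

text \<open>
  The polynomial ring \<open>S\<close> over \<open>'k\<close> with one variable for each element of the finite type \<open>'v\<close>:
  finitely supported coefficient functions on exponent vectors, with convolution product.
\<close>

type_synonym ('v, 'k) mpoly = "('v \<Rightarrow>\<^sub>0 nat) \<Rightarrow>\<^sub>0 'k"

text \<open>\<open>homogeneous d\<close> is the component \<open>S\<^sub>d\<close>; it is \<open>{0}\<close> for negative \<open>d\<close>.\<close>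

definition homogeneous :: "int \<Rightarrow> ('v::finite, 'k::field) mpoly set" where
  "homogeneous d =
     {p. \<forall>e \<in> Poly_Mapping.keys p. int (\<Sum>x\<in>UNIV. Poly_Mapping.lookup e x) = d}"

locale graded_module = Modules.module scale
  for scale :: "('v::finite, 'k::field) mpoly \<Rightarrow> 'm::ab_group_add \<Rightarrow> 'm" +
  fixes G :: "int \<Rightarrow> 'm set"
  assumes component_zero: "0 \<in> G d"
    and component_diff: "x \<in> G d \<Longrightarrow> y \<in> G d \<Longrightarrow> x - y \<in> G d"
    and component_scale: "p \<in> homogeneous d \<Longrightarrow> x \<in> G e \<Longrightarrow> scale p x \<in> G (d + e)"
    and direct_sum:
      "\<exists>!y. (\<forall>d. y d \<in> G d) \<and> finite {d. y d \<noteq> 0} \<and> x = (\<Sum>d | y d \<noteq> 0. y d)"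

text \<open>
  A complex of graded free modules of finite rank with an augmentation to \<open>'m\<close>, in coordinates.
  With \<open>r = fr_rank F\<close>, the \<open>i\<close>-th module is \<open>S\<^bsup>r i\<^esup>\<close>, whose \<open>k\<close>-th basis element (\<open>k < r i\<close>) has
  degree \<open>fr_deg F i k\<close>, that is, the direct sum of the twists \<open>S(- fr_deg F i k)\<close>.
  The matrix \<open>fr_diff F i\<close> (of size \<open>r i\<close> by \<open>r (i + 1)\<close>) is the differential from the module with
  index \<open>i + 1\<close> to the one with index \<open>i\<close>, and \<open>fr_aug F k\<close> is the image in \<open>'m\<close> of the \<open>k\<close>-th basis
  element of the module with index \<open>0\<close>.
\<close>

record (overloaded) ('v, 'k, 'm) free_complex =
  fr_rank :: "nat \<Rightarrow> nat"
  fr_deg :: "nat \<Rightarrow> nat \<Rightarrow> int"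
  fr_diff :: "nat \<Rightarrow> ('v, 'k) mpoly mat"
  fr_aug :: "nat \<Rightarrow> 'm"

definition augmentation ::
  "(('v::finite, 'k::field) mpoly \<Rightarrow> 'm::ab_group_add \<Rightarrow> 'm) \<Rightarrow> ('v, 'k, 'm) free_complex
    \<Rightarrow> ('v, 'k) mpoly vec \<Rightarrow> 'm" where
  "augmentation scale F v = (\<Sum>k<fr_rank F 0. scale (v $ k) (fr_aug F k))"

text \<open>
  Graded free resolutions (not necessarily minimal): all maps are homogeneous of degree \<open>0\<close> and the
  augmented complex is exact. Exactness includes that consecutive maps compose to zero.
\<close>

locale graded_free_resolution = graded_module scale G
  for scale :: "('v::finite, 'k::field) mpoly \<Rightarrow> 'm::ab_group_add \<Rightarrow> 'm"
    and G :: "int \<Rightarrow> 'm set" +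
  fixes F :: "('v, 'k, 'm) free_complex"
  assumes diff_carrier: "fr_diff F i \<in> carrier_mat (fr_rank F i) (fr_rank F (i + 1))"
    and diff_homogeneous:
      "k < fr_rank F i \<Longrightarrow> l < fr_rank F (i + 1) \<Longrightarrow>
        fr_diff F i $$ (k, l) \<in> homogeneous (fr_deg F (i + 1) l - fr_deg F i k)"
    and aug_homogeneous: "k < fr_rank F 0 \<Longrightarrow> fr_aug F k \<in> G (fr_deg F 0 k)"
    and aug_surj: "augmentation scale F ` carrier_vec (fr_rank F 0) = UNIV"
    and exact_0:
      "{v \<in> carrier_vec (fr_rank F 0). augmentation scale F v = 0} =
        (*\<^sub>v) (fr_diff F 0) ` carrier_vec (fr_rank F 1)"
    and exact_Suc:
      "{v \<in> carrier_vec (fr_rank F (i + 1)). fr_diff F i *\<^sub>v v = 0\<^sub>v (fr_rank F i)} =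
        (*\<^sub>v) (fr_diff F (i + 1)) ` carrier_vec (fr_rank F (i + 2))"

text \<open>
  The complex \<open>F \<otimes>\<^sub>S k\<close>, where \<open>k = S/(x\<^sub>1,\<dots>,x\<^sub>n)\<close>: its \<open>i\<close>-th term is \<open>k\<^bsup>r i\<^esup>\<close>, and since the
  residue map of \<open>S\<close> onto \<open>k\<close> takes a polynomial to its constant coefficient, its differentials
  are the matrices of constant coefficients.
\<close>

definition residue_diff ::
  "('v::finite, 'k::field, 'm) free_complex \<Rightarrow> nat \<Rightarrow> 'k mat" where
  "residue_diff F i = map_mat (\<lambda>p. Poly_Mapping.lookup p 0) (fr_diff F i)"

definition residue_component ::
  "('v::finite, 'k::field, 'm) free_complex \<Rightarrow> nat \<Rightarrow> int \<Rightarrow> 'k vec set" where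
  "residue_component F i j =
     {v \<in> carrier_vec (fr_rank F i). \<forall>k<fr_rank F i. v $ k \<noteq> 0 \<longrightarrow> fr_deg F i k = j}"

definition tor_cycles ::
  "('v::finite, 'k::field, 'm) free_complex \<Rightarrow> nat \<Rightarrow> int \<Rightarrow> 'k vec set" where
  "tor_cycles F i j =
     {v \<in> residue_component F i j.
        i \<noteq> 0 \<longrightarrow> residue_diff F (i - 1) *\<^sub>v v = 0\<^sub>v (fr_rank F (i - 1))}"

definition tor_boundaries ::
  "('v::finite, 'k::field, 'm) free_complex \<Rightarrow> nat \<Rightarrow> int \<Rightarrow> 'k vec set" where
  "tor_boundaries F i j = (*\<^sub>v) (residue_diff F i) ` residue_component F (i + 1) j"

definition subspace_dim :: "nat \<Rightarrow> 'k::field vec set \<Rightarrow> nat" where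
  "subspace_dim r W = vectorspace.dim class_ring (module_vec TYPE('k) r\<lparr>carrier := W\<rparr>)"

text \<open>
  \<open>\<beta>\<^sub>i\<^sub>,\<^sub>j = dim\<^sub>k Tor\<^sub>i\<^sup>S(M,k)\<^sub>j\<close>, the dimension of the quotient of cycles by boundaries in degree \<open>j\<close>,
  for \<open>F\<close> a graded free resolution of \<open>M\<close>. The boundaries are contained in the cycles, so the
  subtraction does not truncate.
\<close>

definition betti ::
  "('v::finite, 'k::field, 'm) free_complex \<Rightarrow> nat \<Rightarrow> int \<Rightarrow> nat" where
  "betti F i j =
     subspace_dim (fr_rank F i) (tor_cycles F i j)
     - subspace_dim (fr_rank F i) (tor_boundaries F i j)"

definition two_linear :: "(nat \<Rightarrow> int \<Rightarrow> nat) \<Rightarrow> bool" where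
  "two_linear \<beta> \<longleftrightarrow>
     (\<forall>j. j \<noteq> 0 \<longrightarrow> \<beta> 0 j = 0) \<and> (\<forall>i\<ge>1. \<forall>j. j \<noteq> int i + 1 \<longrightarrow> \<beta> i j = 0)"

definition pure_diagram :: "nat \<Rightarrow> nat \<Rightarrow> int \<Rightarrow> rat" where
  "pure_diagram l i j =
     (if i = 0 \<and> j = 0 then 1
      else if 1 \<le> i \<and> i \<le> l \<and> j = int i + 1 then of_nat (i * ((l + 1) choose (i + 1)))
      else 0)"

text \<open>Vectors and matrices of the library are indexed from \<open>0\<close>, hence the shifts by one.\<close>

definition omega_vec :: "nat \<Rightarrow> (nat \<Rightarrow> int \<Rightarrow> nat) \<Rightarrow> rat vec" where
  "omega_vec n \<beta> = vec n (\<lambda>i. of_nat (\<beta> (i + 1) (int i + 2)))"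

definition Omega_mat :: "nat \<Rightarrow> rat mat" where
  "Omega_mat n = mat n n (\<lambda>(i, j). of_nat ((j + 1) * ((i + 2) choose (j + 2))))"

text \<open>The row vector \<open>\<omega> \<Omega>\<^sup>-\<^sup>1\<close>; the value of \<open>mat_inverse\<close> is not \<open>None\<close> for invertible matrices.\<close>

definition diagram_coeffs :: "nat \<Rightarrow> (nat \<Rightarrow> int \<Rightarrow> nat) \<Rightarrow> rat vec" where
  "diagram_coeffs n \<beta> = row (mat_of_row (omega_vec n \<beta>) * the (mat_inverse (Omega_mat n))) 0"

text \<open>
  For a finitely generated module over the domain \<open>S\<close> the following says that \<open>M\<close> is a torsion
  module, i.e. has rank \<open>0\<close>. The alternating sum of the Betti numbers of \<open>M\<close> is its rank, whereas
  the alternating sum of the entries of \<open>pure_diagram l\<close> is \<open>0\<close> for all \<open>l \<ge> 1\<close>. So only a module with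
  this property can have a Betti diagram that is a combination of these pure diagrams; for example,
  \<open>M = S\<close> has \<open>\<omega> = 0\<close> but \<open>\<beta>\<^sub>0\<^sub>,\<^sub>0 = 1\<close>.
\<close>

definition nonzero_annihilator ::
  "(('v::finite, 'k::field) mpoly \<Rightarrow> 'm::ab_group_add \<Rightarrow> 'm) \<Rightarrow> bool" where
  "nonzero_annihilator scale \<longleftrightarrow> (\<exists>p. p \<noteq> 0 \<and> (\<forall>x. scale p x = 0))"

end

theory Submission
  imports Defs "HOL-Library.Function_Algebras" "HOL-Library.Product_Plus" "HOL-Library.Countable_Set"
    "HOL-Computational_Algebra.Formal_Laurent_Series" "HOL-Computational_Algebra.Polynomial_FPS"
begin

text \<open>
  The Betti numbers of \<open>M\<close> are the dimensions of the Koszul homology of \<open>M\<close>. Hence \<open>M\<close> is generated in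
  degree \<open>0\<close>, has no linear syzygies, and has no Koszul homology \<open>H\<^sub>p(M)\<^sub>j\<close> with \<open>j \<ge> p + 2\<close>. If the
  Hilbert series \<open>H\<close> is written as \<open>H(t) (1 - t)\<^sup>n = m - (\<Sum>l<n. b\<^sub>l t\<^sup>2 (1 - t)\<^sup>l)\<close>, the Euler
  characteristic gives \<open>\<beta>\<^sub>i\<^sub>,\<^sub>i\<^sub>+\<^sub>1 = (\<Sum>l<n. b\<^sub>l (l choose (i - 1)))\<close>, and the coefficients of the theorem are
  \<open>b\<^sub>l\<^sub>-\<^sub>1 / l - b\<^sub>l / (l + 1)\<close> with \<open>b\<^sub>n = 0\<close>; their sum is \<open>b\<^sub>0\<close>. So one needs \<open>b\<^sub>l \<ge> 0\<close> and
  \<open>(l + 1) b\<^sub>l\<^sub>+\<^sub>1 \<le> (l + 2) b\<^sub>l\<close>.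

  The number \<open>b\<^sub>l\<close> is the dimension of the socle, in degree \<open>1\<close>, of the quotient of \<open>M\<close> by \<open>n - l - 1\<close>
  general linear forms \<open>y\<^sub>s = (\<Sum>i. s\<^sup>i x\<^sub>i)\<close>. Regularity forces the socle to vanish in degrees at
  least \<open>2\<close>, and from this it follows that only finitely many \<open>s\<close> give a zero divisor in a given degree; after
  extension of scalars to the uncountable field \<open>k((t))\<close> suitable \<open>s\<close> exist. The inequality between
  consecutive \<open>b\<^sub>l\<close> holds because the subspaces \<open>y\<^sub>s M\<^sub>0 \<inter> socle\<close>, for \<open>l + 2\<close> different \<open>s\<close>, are
  independent, so one of them is small. Finally, a torsion module satisfies
  \<open>H = m (1 - t\<^sup>D) / (1 - t)\<^sup>n - f\<close> for some \<open>f\<close> with nonnegative coefficients, and the pole at \<open>t = 1\<close>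
  gives \<open>b\<^sub>0 \<ge> m\<close>.
\<close>

text \<open>Quotients are never formed: \<open>G/N\<close> is handled by chains of \<open>G\<close>
  taken modulo \<open>N\<close>, and two homologies are compared by a linear relation between their
  cycles whose fibres over zero are the boundaries. This takes the place of long exact sequences.

  The coefficients come from a factorization of \<open>Omega\<close>: its rows are the partial sums
  of the rows \<open>(l + 1) (l choose j)\<close>, while the Betti numbers combine
  \<open>l choose j\<close> with weights \<open>b l\<close>. Undoing the partial sums turns
  \<open>b l / (l + 1)\<close> into consecutive differences, so nonnegativity means that this
  sequence decreases. The factor arises as follows: a socle of dimension \<open>b (l + 1)\<close>
  contains \<open>l + 2\<close> independent subspaces, so one of them has dimension at most
  \<open>b (l + 1) / (l + 2)\<close>, and dividing by its linear form loses no more than that.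

  Zero divisors are controlled one degree at a time, so the bad parameters form a countable union of
  finite sets, which a finite or countable field might not escape. The bound
  \<open>b 0 \<le> m\<close> holds without torsion: after \<open>n - 1\<close> sections the Hilbert
  function is \<open>m\<close> in degree 1 and \<open>m - b 0\<close> in degree 2.\<close>

unbundle no fps_syntax

section \<open>Dimensions of subspaces\<close>

locale vspace = vector_space scale
  for scale :: "'f::field \<Rightarrow> 'b::ab_group_add \<Rightarrow> 'b"
begin

text \<open>The ambient spaces (polynomials, function spaces) are infinite-dimensional, so
  finiteness is attached to the subspace; an infinite-dimensional subspace would have the default
  \<open>dim\<close> 0.\<close>

definition fin_subspace :: "'b set \<Rightarrow> bool" where
  "fin_subspace V \<longleftrightarrow> subspace V \<and> (\<exists>B. finite B \<and> V \<subseteq> span B)"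

lemma fin_subspaceD: "fin_subspace V \<Longrightarrow> subspace V"
  by (simp add: fin_subspace_def)

lemma fin_subspace_span: "finite B \<Longrightarrow> fin_subspace (span B)"
  by (auto simp: fin_subspace_def)

lemma fin_subspace_mono: "fin_subspace V \<Longrightarrow> subspace W \<Longrightarrow> W \<subseteq> V \<Longrightarrow> fin_subspace W"
  by (meson fin_subspace_def order_trans)

lemma independent_in_fin_subspace:
  assumes "fin_subspace V" "B \<subseteq> V" "independent B"
  shows "finite B"
  using assms independent_span_bound unfolding fin_subspace_def by (meson order_trans)

lemma fin_subspace_extend:
  assumes "fin_subspace V" "B \<subseteq> V" "independent B"
  obtains C where "B \<subseteq> C" "C \<subseteq> V" "finite C" "independent C" "span C = V" "card C = dim V"
proof -
  obtain C where C: "B \<subseteq> C" "C \<subseteq> V" "independent C" "V \<subseteq> span C"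
    using maximal_independent_subset_extend[OF assms(2,3)] by blast
  moreover have "span C = V"
    using C assms(1) span_subspace fin_subspaceD by blast
  ultimately show ?thesis
    using that independent_in_fin_subspace[OF assms(1)] dim_unique by metis
qed

lemma fin_subspace_basis:
  assumes "fin_subspace V"
  obtains C where "C \<subseteq> V" "finite C" "independent C" "span C = V" "card C = dim V"
  by (rule fin_subspace_extend[OF assms empty_subsetI independent_empty]) (rule that)

lemma dim_mono_fin:
  assumes "fin_subspace V" "subspace W" "W \<subseteq> V"
  shows "dim W \<le> dim V"
proof -
  obtain C where "C \<subseteq> W" "independent C" "card C = dim W"
    using fin_subspace_basis[OF fin_subspace_mono[OF assms]] by metis
  then obtain D where "C \<subseteq> D" "finite D" "card D = dim V"
    using fin_subspace_extend[OF assms(1), of C] assms(3) by (metis subset_trans)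
  then show ?thesis
    using \<open>card C = dim W\<close> card_mono by metis
qed

lemma dim_eq_fin:
  assumes "fin_subspace V" "subspace W" "W \<subseteq> V" "dim V \<le> dim W"
  shows "W = V"
proof -
  obtain C where C: "C \<subseteq> W" "independent C" "card C = dim W" "span C = W"
    using fin_subspace_basis[OF fin_subspace_mono[OF assms(1-3)]] by metis
  then obtain D where D: "C \<subseteq> D" "finite D" "card D = dim V" "span D = V"
    using fin_subspace_extend[OF assms(1), of C] assms(3) by (metis subset_trans)
  then have "C = D"
    using C assms(4) by (intro card_seteq) auto
  then show ?thesis using C D by simp
qed

text \<open>The two expansions of \<open>x\<close> glue to one vanishing combination over
  \<open>C\<close>, with coefficients \<open>u\<close> on \<open>A\<close> and \<open>- w\<close>
  off it.\<close>

lemma span_disjoint: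
  assumes "independent C" "finite C" "A \<subseteq> C" "x \<in> span A" "x \<in> span (C - A)"
  shows "x = 0"
proof -
  have fin: "finite A" "finite (C - A)" using assms finite_subset by auto
  obtain u where u: "x = (\<Sum>a\<in>A. scale (u a) a)"
    using assms(4) span_finite[OF fin(1)] by auto
  obtain w where w: "x = (\<Sum>a\<in>C-A. scale (w a) a)"
    using assms(5) span_finite[OF fin(2)] by auto
  define q where "q a = (if a \<in> A then u a else - w a)" for a
  have "(\<Sum>a\<in>C. scale (q a) a) = (\<Sum>a\<in>A. scale (q a) a) + (\<Sum>a\<in>C-A. scale (q a) a)"
    by (metis add.commute assms(2,3) sum.subset_diff)
  also have "(\<Sum>a\<in>A. scale (q a) a) = x" unfolding u by (intro sum.cong) (auto simp: q_def)
  also have "(\<Sum>a\<in>C-A. scale (q a) a) = - x"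
    unfolding w sum_negf[symmetric] by (intro sum.cong) (auto simp: q_def)
  finally have "(\<Sum>a\<in>C. scale (q a) a) = 0" by simp
  then have "q a = 0" if "a \<in> C" for a
    using independentD[OF assms(1,2) order_refl] that by blast
  then have "u a = 0" if "a \<in> A" for a
    using that assms(3) by (metis q_def subsetD)
  then show ?thesis unfolding u by simp
qed

lemma dim_zero_space [simp]: "dim {0} = 0"
  using dim_unique[of "{}" "{0}" 0, OF _ _ independent_empty] by simp

lemma fin_subspace_zero [simp]: "fin_subspace {0}"
  using fin_subspace_span[of "{}"] by simp

end

locale vspace_pair = vs1: vspace s1 + vs2: vspace s2
  for s1 :: "'f::field \<Rightarrow> 'b::ab_group_add \<Rightarrow> 'b" and s2 :: "'f \<Rightarrow> 'c::ab_group_add \<Rightarrow> 'c"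

text \<open>A basis \<open>B\<close> of the kernel is extended to a basis \<open>C\<close> of
  \<open>V\<close>. The span of \<open>C - B\<close> meets the kernel only in zero, so the images of
  \<open>C - B\<close> form a basis of the image of \<open>V\<close>.\<close>

lemma (in vspace_pair) rank_nullity:
  assumes "Vector_Spaces.linear s1 s2 f" "vs1.fin_subspace V"
  shows "vs1.dim V = vs1.dim {v \<in> V. f v = 0} + vs2.dim (f ` V)"
proof -
  interpret f: Vector_Spaces.linear s1 s2 f by fact
  let ?K = "{v \<in> V. f v = 0}"
  have sV: "vs1.subspace V" using assms vs1.fin_subspaceD by blast
  have sK: "vs1.subspace ?K"
    using sV by (auto simp: vs1.subspace_def f.add f.scale)
  obtain B where B: "B \<subseteq> ?K" "finite B" "vs1.independent B" "vs1.span B = ?K" "card B = vs1.dim ?K"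
    using vs1.fin_subspace_basis[OF vs1.fin_subspace_mono[OF assms(2) sK]] by (metis (no_types, lifting) mem_Collect_eq subsetI)
  obtain C where C: "B \<subseteq> C" "C \<subseteq> V" "finite C" "vs1.independent C" "vs1.span C = V" "card C = vs1.dim V"
    using vs1.fin_subspace_extend[OF assms(2) _ B(3)] B(1) by (metis (no_types, lifting) mem_Collect_eq subset_iff)
  have "inj_on f (vs1.span (C - B))"
    unfolding f.inj_on_iff_eq_0[OF vs1.subspace_span]
  proof (intro ballI impI)
    fix x assume x: "x \<in> vs1.span (C - B)" "f x = 0"
    then have "x \<in> V" using vs1.span_mono[of "C - B" C] C(5) by auto
    then have "x \<in> vs1.span B" using B(4) x(2) by simp
    then show "x = 0" using vs1.span_disjoint[OF C(4,3,1)] x(1) by blast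
  qed
  then have ind: "vs2.independent (f ` (C - B))"
    using f.independent_injective_image vs1.independent_mono[OF C(4)] by (metis Diff_subset)
  have inj: "inj_on f (C - B)"
    using \<open>inj_on f (vs1.span (C - B))\<close> inj_on_subset vs1.span_superset by blast
  have "f ` V \<subseteq> vs2.span (f ` (C - B))"
  proof -
    have "f ` C \<subseteq> vs2.span (f ` (C - B))"
    proof
      fix y assume "y \<in> f ` C"
      then obtain c where c: "c \<in> C" "y = f c" by auto
      show "y \<in> vs2.span (f ` (C - B))"
      proof (cases "c \<in> B")
        case True
        then have "f c = 0" using B(1) by blast
        then show ?thesis using c vs2.span_zero by simp
      qed (use c in \<open>auto intro: vs2.span_base\<close>)
    qed
    then have "vs2.span (f ` C) \<subseteq> vs2.span (f ` (C - B))"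
      by (simp add: vs2.span_minimal)
    then show ?thesis using f.span_image[of C] C(5) by simp
  qed
  then have "vs2.dim (f ` V) = card (f ` (C - B))"
    using ind C(2) vs2.dim_unique[of "f ` (C - B)" "f ` V"] by blast
  also have "\<dots> = card C - card B"
    using inj C B by (simp add: card_image card_Diff_subset)
  finally show ?thesis
    using B(5) C(6) card_mono[OF C(3,1)] by simp
qed

lemma (in vspace_pair) fin_subspace_image:
  assumes "Vector_Spaces.linear s1 s2 f" "vs1.fin_subspace V"
  shows "vs2.fin_subspace (f ` V)"
proof -
  interpret f: Vector_Spaces.linear s1 s2 f by fact
  obtain B where "finite B" "V \<subseteq> vs1.span B" using assms by (auto simp: vs1.fin_subspace_def)
  then have "f ` V \<subseteq> vs2.span (f ` B)" using f.span_image[of B] by auto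
  then show ?thesis
    using \<open>finite B\<close> assms f.subspace_image[OF vs1.fin_subspaceD] vs2.fin_subspace_def by blast
qed

lemma (in vspace_pair) dim_image_inj:
  assumes "Vector_Spaces.linear s1 s2 f" "vs1.fin_subspace V" "\<And>v. v \<in> V \<Longrightarrow> f v = 0 \<Longrightarrow> v = 0"
  shows "vs2.dim (f ` V) = vs1.dim V"
proof -
  interpret f: Vector_Spaces.linear s1 s2 f by fact
  have "{v \<in> V. f v = 0} = {0}"
    using assms(3) vs1.subspace_0[OF vs1.fin_subspaceD[OF assms(2)]] by auto
  then show ?thesis using rank_nullity[OF assms(1,2)] by simp
qed

section \<open>Direct sums, function spaces and linear correspondences\<close>

abbreviation prod_scale :: "('f \<Rightarrow> 'a \<Rightarrow> 'a) \<Rightarrow> ('f \<Rightarrow> 'b \<Rightarrow> 'b) \<Rightarrow> 'f \<Rightarrow> 'a \<times> 'b \<Rightarrow> 'a \<times> 'b" where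
  "prod_scale s t c z \<equiv> (s c (fst z), t c (snd z))"

definition fun_scale :: "('f \<Rightarrow> 'a \<Rightarrow> 'a) \<Rightarrow> 'f \<Rightarrow> ('x \<Rightarrow> 'a) \<Rightarrow> 'x \<Rightarrow> 'a" where
  "fun_scale s c f = (\<lambda>x. s c (f x))"

lemma vspace_prod:
  assumes "vspace s" "vspace t"
  shows "vspace (prod_scale s t)"
proof -
  interpret s: vspace s by fact
  interpret t: vspace t by fact
  show ?thesis
    by unfold_locales
      (auto simp: prod_eq_iff s.scale_right_distrib t.scale_right_distrib
        s.scale_left_distrib t.scale_left_distrib)
qed

lemma vspace_fun:
  assumes "vspace s"
  shows "vspace (fun_scale s)"
proof -
  interpret s: vspace s by fact
  show ?thesis
    by unfold_locales
      (auto simp: fun_scale_def fun_eq_iff s.scale_right_distrib s.scale_left_distrib)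
qed

lemma fin_subspace_times:
  assumes "vspace s" "vspace t"
    "vspace.fin_subspace s V" "vspace.fin_subspace t W"
  shows "vspace.fin_subspace (prod_scale s t) (V \<times> W)"
proof -
  interpret s: vspace s by fact
  interpret t: vspace t by fact
  interpret p: vspace "prod_scale s t" by (rule vspace_prod) fact+
  have sub: "p.subspace (V \<times> W)"
    using s.fin_subspaceD[OF assms(3)] t.fin_subspaceD[OF assms(4)]
    by (auto simp: p.subspace_def s.subspace_def t.subspace_def zero_prod_def)
  obtain B C where B: "finite B" "V \<subseteq> s.span B" and C: "finite C" "W \<subseteq> t.span C"
    using assms(3,4) by (auto simp: s.fin_subspace_def t.fin_subspace_def)
  let ?D = "(\<lambda>b. (b, 0)) ` B \<union> (\<lambda>c. (0, c)) ` C"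
  have 1: "(v, 0) \<in> p.span ?D" if "v \<in> s.span B" for v
    using that
  proof (induction rule: s.span_induct_alt)
    case base then show ?case using p.span_zero by (simp add: zero_prod_def)
  next
    case (step c x y)
    have "(x, 0) \<in> p.span ?D" by (rule p.span_base) (use step in auto)
    from p.span_add[OF p.span_scale[OF this, of c] step(2)] show ?case by simp
  qed
  have 2: "(0, w) \<in> p.span ?D" if "w \<in> t.span C" for w
    using that
  proof (induction rule: t.span_induct_alt)
    case base then show ?case using p.span_zero by (simp add: zero_prod_def)
  next
    case (step c x y)
    have "(0, x) \<in> p.span ?D" by (rule p.span_base) (use step in auto)
    from p.span_add[OF p.span_scale[OF this, of c] step(2)] show ?case by simp
  qed
  have "V \<times> W \<subseteq> p.span ?D"
  proof
    fix z assume "z \<in> V \<times> W"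
    then have "(fst z, 0) \<in> p.span ?D" "(0, snd z) \<in> p.span ?D" using 1 2 B C by auto
    then have "(fst z, 0) + (0, snd z) \<in> p.span ?D" by (rule p.span_add)
    then show "z \<in> p.span ?D" by simp
  qed
  moreover have "finite ?D" using B C by auto
  ultimately show ?thesis using sub p.fin_subspace_def by blast
qed

text \<open>Rank-nullity for the two projections of \<open>R\<close> computes \<open>dim R\<close>
  twice: the kernel of \<open>fst\<close> is the fibre over 0 in \<open>V\<close>, the kernel of
  \<open>snd\<close> the fibre over 0 in \<open>W\<close>.\<close>

lemma dim_correspondence:
  assumes "vspace s" "vspace t"
    and V: "vspace.fin_subspace s V" and W: "vspace.fin_subspace t W"
    and R: "module.subspace (prod_scale s t) R" "R \<subseteq> V \<times> W"
    and tot: "\<And>v. v \<in> V \<Longrightarrow> \<exists>w. (v, w) \<in> R" "\<And>w. w \<in> W \<Longrightarrow> \<exists>v. (v, w) \<in> R"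
  shows "vector_space.dim s V + vector_space.dim t {w. (0, w) \<in> R}
    = vector_space.dim t W + vector_space.dim s {v. (v, 0) \<in> R}"
proof -
  interpret s: vspace s by fact
  interpret t: vspace t by fact
  interpret p: vspace "prod_scale s t" by (rule vspace_prod) fact+
  interpret ps: vspace_pair "prod_scale s t" s ..
  interpret pt: vspace_pair "prod_scale s t" t ..
  interpret sp: vspace_pair s "prod_scale s t" ..
  interpret tp: vspace_pair t "prod_scale s t" ..
  have fR: "p.fin_subspace R"
    using p.fin_subspace_mono[OF fin_subspace_times[OF assms(1-4)] R] .
  have l1: "Vector_Spaces.linear (prod_scale s t) s fst"
    by unfold_locales auto
  have l2: "Vector_Spaces.linear (prod_scale s t) t snd"
    by unfold_locales auto
  have l3: "Vector_Spaces.linear s (prod_scale s t) (\<lambda>v. (v, 0))"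
    by unfold_locales auto
  have l4: "Vector_Spaces.linear t (prod_scale s t) (\<lambda>v. (0, v))"
    by unfold_locales auto
  let ?A = "{w. (0, w) \<in> R}" and ?B = "{v. (v, 0) \<in> R}"
  have R0: "0 \<in> R" and Radd: "\<And>x y. x \<in> R \<Longrightarrow> y \<in> R \<Longrightarrow> x + y \<in> R"
    and Rsc: "\<And>c x. x \<in> R \<Longrightarrow> prod_scale s t c x \<in> R"
    using R(1) unfolding p.subspace_def by auto
  have "t.subspace ?A"
    using R0 Radd[of "(0, _)" "(0, _)"] Rsc[of "(0, _)"] unfolding t.subspace_def
    by (force simp: zero_prod_def)
  then have fA: "t.fin_subspace ?A" using t.fin_subspace_mono[OF W] R(2) by auto
  have "s.subspace ?B"
    using R0 Radd[of "(_, 0)" "(_, 0)"] Rsc[of "(_, 0)"] unfolding s.subspace_def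
    by (force simp: zero_prod_def)
  then have fB: "s.fin_subspace ?B" using s.fin_subspace_mono[OF V] R(2) by auto
  have "p.dim R = p.dim {z \<in> R. fst z = 0} + s.dim (fst ` R)"
    by (rule ps.rank_nullity[OF l1 fR])
  moreover have "fst ` R = V" using R(2) tot(1) by force
  moreover have "{z \<in> R. fst z = 0} = (\<lambda>v. (0, v)) ` ?A" by force
  moreover have "p.dim ((\<lambda>v. (0, v)) ` ?A) = t.dim ?A"
    by (rule tp.dim_image_inj[OF l4 fA]) (simp add: zero_prod_def)
  moreover have "p.dim R = p.dim {z \<in> R. snd z = 0} + t.dim (snd ` R)"
    by (rule pt.rank_nullity[OF l2 fR])
  moreover have "snd ` R = W" using R(2) tot(2) by force
  moreover have "{z \<in> R. snd z = 0} = (\<lambda>v. (v, 0)) ` ?B" by force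
  moreover have "p.dim ((\<lambda>v. (v, 0)) ` ?B) = s.dim ?B"
    by (rule sp.dim_image_inj[OF l3 fB]) (simp add: zero_prod_def)
  ultimately show ?thesis by simp
qed

text \<open>Linear relations between cycles that match boundaries induce isomorphisms in homology.\<close>

lemma subquotient_dim_eq:
  assumes vs: "vspace s" "vspace t"
    and Z1: "vspace.fin_subspace s Z1" and Z2: "vspace.fin_subspace t Z2"
    and B1: "module.subspace s B1" "B1 \<subseteq> Z1" and B2: "module.subspace t B2" "B2 \<subseteq> Z2"
    and R0: "R 0 0"
    and Radd: "\<And>z v z' v'. R z v \<Longrightarrow> R z' v' \<Longrightarrow> R (z + z') (v + v')"
    and Rsc: "\<And>c z v. R z v \<Longrightarrow> R (s c z) (t c v)"
    and tot: "\<And>z. z \<in> Z1 \<Longrightarrow> \<exists>v\<in>Z2. R z v" "\<And>v. v \<in> Z2 \<Longrightarrow> \<exists>z\<in>Z1. R z v"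
    and bd: "\<And>z v. z \<in> Z1 \<Longrightarrow> v \<in> Z2 \<Longrightarrow> R z v \<Longrightarrow> z \<in> B1 \<longleftrightarrow> v \<in> B2"
  shows "int (vector_space.dim s Z1) - int (vector_space.dim s B1)
    = int (vector_space.dim t Z2) - int (vector_space.dim t B2)"
proof -
  interpret s: vspace s by fact
  interpret t: vspace t by fact
  interpret p: vspace "prod_scale s t" by (rule vspace_prod) fact+
  note S1 = s.fin_subspaceD[OF Z1] and S2 = t.fin_subspaceD[OF Z2]
  \<comment> \<open>The relation \<open>R\<close> saturated by boundaries on both sides. By
    \<open>bd\<close> its fibres over zero are exactly \<open>B2\<close> and \<open>B1\<close>,
    which is the form \<open>dim_correspondence\<close> needs.\<close>
  define Q where "Q = {(z, v). \<exists>z'\<in>Z1. \<exists>v'\<in>Z2. R z' v' \<and> z - z' \<in> B1 \<and> v - v' \<in> B2}"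
  have QI: "(z, v) \<in> Q" if "z' \<in> Z1" "v' \<in> Z2" "R z' v'" "z - z' \<in> B1" "v - v' \<in> B2" for z v z' v'
    using that by (auto simp: Q_def)
  have "p.subspace Q"
    unfolding p.subspace_def
  proof (intro conjI ballI allI)
    show "0 \<in> Q" unfolding zero_prod_def
      by (rule QI[of 0 0]) (use S1 S2 R0 B1 B2 s.subspace_0 t.subspace_0 in auto)
  next
    fix x y assume "x \<in> Q" "y \<in> Q"
    then obtain z v z' v' w u w' u' where
      x: "x = (z, v)" "z' \<in> Z1" "v' \<in> Z2" "R z' v'" "z - z' \<in> B1" "v - v' \<in> B2" and
      y: "y = (w, u)" "w' \<in> Z1" "u' \<in> Z2" "R w' u'" "w - w' \<in> B1" "u - u' \<in> B2"
      unfolding Q_def by auto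
    have "(z + w, v + u) \<in> Q"
    proof (rule QI[of "z' + w'" "v' + u'"])
      show "z + w - (z' + w') \<in> B1"
        using s.subspace_add[OF B1(1) x(5) y(5)] by (simp add: algebra_simps)
      show "v + u - (v' + u') \<in> B2"
        using t.subspace_add[OF B2(1) x(6) y(6)] by (simp add: algebra_simps)
    qed (use x y S1 S2 Radd s.subspace_add t.subspace_add in auto)
    then show "x + y \<in> Q" using x y by simp
  next
    fix c x assume "x \<in> Q"
    then obtain z v z' v' where
      x: "x = (z, v)" "z' \<in> Z1" "v' \<in> Z2" "R z' v'" "z - z' \<in> B1" "v - v' \<in> B2"
      unfolding Q_def by auto
    have "(s c z, t c v) \<in> Q"
    proof (rule QI[of "s c z'" "t c v'"])
      show "s c z - s c z' \<in> B1"
        using s.subspace_scale[OF B1(1) x(5)] by (simp add: s.scale_right_diff_distrib)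
      show "t c v - t c v' \<in> B2"
        using t.subspace_scale[OF B2(1) x(6)] by (simp add: t.scale_right_diff_distrib)
    qed (use x S1 S2 Rsc s.subspace_scale t.subspace_scale in auto)
    then show "prod_scale s t c x \<in> Q" using x by simp
  qed
  moreover have "Q \<subseteq> Z1 \<times> Z2"
  proof
    fix x assume "x \<in> Q"
    then obtain z v z' v' where
      x: "x = (z, v)" "z' \<in> Z1" "v' \<in> Z2" "R z' v'" "z - z' \<in> B1" "v - v' \<in> B2"
      unfolding Q_def by auto
    then have "(z - z') + z' \<in> Z1" "(v - v') + v' \<in> Z2"
      using B1 B2 S1 S2 s.subspace_add t.subspace_add by blast+
    then show "x \<in> Z1 \<times> Z2" using x by simp
  qed
  moreover have RQ: "(z, v) \<in> Q" if "z \<in> Z1" "v \<in> Z2" "R z v" for z v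
    by (rule QI[OF that]) (use B1 B2 s.subspace_0 t.subspace_0 in auto)
  moreover have "{w. (0, w) \<in> Q} = B2"
  proof
    show "B2 \<subseteq> {w. (0, w) \<in> Q}"
      by (auto intro!: QI[of 0 0] simp: R0 s.subspace_0[OF S1] t.subspace_0[OF S2] s.subspace_0[OF B1(1)])
    show "{w. (0, w) \<in> Q} \<subseteq> B2"
    proof
      fix w assume "w \<in> {w. (0, w) \<in> Q}"
      then obtain z' v' where x: "z' \<in> Z1" "v' \<in> Z2" "R z' v'" "0 - z' \<in> B1" "w - v' \<in> B2"
        unfolding Q_def by auto
      then have "z' \<in> B1" using s.subspace_neg[OF B1(1) x(4)] by simp
      then have "v' \<in> B2" using bd x by blast
      then have "(w - v') + v' \<in> B2" using x(5) t.subspace_add[OF B2(1)] by blast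
      then show "w \<in> B2" by simp
    qed
  qed
  moreover have "{z. (z, 0) \<in> Q} = B1"
  proof
    show "B1 \<subseteq> {z. (z, 0) \<in> Q}"
      by (auto intro!: QI[of 0 0] simp: R0 s.subspace_0[OF S1] t.subspace_0[OF S2] t.subspace_0[OF B2(1)])
    show "{z. (z, 0) \<in> Q} \<subseteq> B1"
    proof
      fix w assume "w \<in> {z. (z, 0) \<in> Q}"
      then obtain z' v' where x: "z' \<in> Z1" "v' \<in> Z2" "R z' v'" "w - z' \<in> B1" "0 - v' \<in> B2"
        unfolding Q_def by auto
      then have "v' \<in> B2" using t.subspace_neg[OF B2(1) x(5)] by simp
      then have "z' \<in> B1" using bd x by blast
      then have "(w - z') + z' \<in> B1" using x(4) s.subspace_add[OF B1(1)] by blast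
      then show "w \<in> B1" by simp
    qed
  qed
  ultimately have "s.dim Z1 + t.dim B2 = t.dim Z2 + s.dim B1"
    using dim_correspondence[OF vs Z1 Z2, of Q] tot by metis
  then show ?thesis by linarith
qed

section \<open>Koszul homology of commuting operators\<close>

text \<open>A \<open>p\<close>-chain of the Koszul complex is a family indexed by the \<open>p\<close>-element subsets of \<open>{..<n}\<close>.\<close>

definition chains :: "nat \<Rightarrow> nat \<Rightarrow> 'a::zero set \<Rightarrow> (nat set \<Rightarrow> 'a) set" where
  "chains n p H = {f. \<forall>T. if T \<subseteq> {..<n} \<and> card T = p then f T \<in> H else f T = 0}"

text \<open>The sign of moving the \<open>i\<close>-th basis vector to its place in the ordered
  exterior product over \<open>T\<close>.\<close>

definition ksign :: "nat \<Rightarrow> nat set \<Rightarrow> 'a::ab_group_add \<Rightarrow> 'a" where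
  "ksign i T x = (if even (card {j \<in> T. j < i}) then x else - x)"

text \<open>The Koszul differential read off at its target: the coefficient at \<open>T\<close>
  collects one term from each set that becomes \<open>T\<close> when one element is removed.\<close>

definition kd :: "(nat \<Rightarrow> 'a::ab_group_add \<Rightarrow> 'a) \<Rightarrow> nat \<Rightarrow> (nat set \<Rightarrow> 'a) \<Rightarrow> nat set \<Rightarrow> 'a" where
  "kd X n f T = (\<Sum>i\<in>{..<n} - T. ksign i T (X i (f (insert i T))))"

lemma chainsI:
  "(\<And>T. T \<subseteq> {..<n} \<Longrightarrow> card T = p \<Longrightarrow> f T \<in> H) \<Longrightarrow>
   (\<And>T. \<not> (T \<subseteq> {..<n} \<and> card T = p) \<Longrightarrow> f T = 0) \<Longrightarrow> f \<in> chains n p H"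
  by (auto simp: chains_def)

lemma chainsD: "f \<in> chains n p H \<Longrightarrow> T \<subseteq> {..<n} \<Longrightarrow> card T = p \<Longrightarrow> f T \<in> H"
  by (auto simp: chains_def split: if_splits)

lemma chains_outside: "f \<in> chains n p H \<Longrightarrow> \<not> (T \<subseteq> {..<n} \<and> card T = p) \<Longrightarrow> f T = 0"
  unfolding chains_def by (drule CollectD, drule spec[of _ T]) simp

lemma chains_in: "f \<in> chains n p H \<Longrightarrow> 0 \<in> H \<Longrightarrow> f T \<in> H"
  by (metis chainsD chains_outside)

lemma chains_mono: "f \<in> chains n p H \<Longrightarrow> H \<subseteq> H' \<Longrightarrow> f \<in> chains n p H'"
  by (rule chainsI) (blast intro: chainsD, rule chains_outside)

lemma chains_cong_in: "f \<in> chains n p H \<Longrightarrow> (\<And>T. f T \<in> H') \<Longrightarrow> f \<in> chains n p H'"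
  by (rule chainsI) (blast, rule chains_outside)

lemma chains_zero: "0 \<in> H \<Longrightarrow> 0 \<in> chains n p H"
  by (rule chainsI) auto

lemma chains_trivial: "f \<in> chains n p {0} \<Longrightarrow> f = 0"
  using chains_in[of f n p "{0}"] by (auto simp: fun_eq_iff)

lemma chains_above:
  assumes "n < p" "f \<in> chains n p H"
  shows "f = 0"
proof
  fix T
  have "T \<subseteq> {..<n} \<longrightarrow> card T \<le> n"
    using card_mono[of "{..<n}" T] by simp
  then show "f T = 0 T" using chains_outside[OF assms(2), of T] assms(1) by (auto simp del: not_less)
qed

lemma chains_map:
  "f \<in> chains n p H \<Longrightarrow> (\<And>x. x \<in> H \<Longrightarrow> \<phi> x \<in> H') \<Longrightarrow> \<phi> 0 = 0 \<Longrightarrow> (\<lambda>T. \<phi> (f T)) \<in> chains n p H'"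
  by (rule chainsI) (simp_all add: chainsD chains_outside)

lemma chains_lift:
  assumes "f \<in> chains n p H" "\<And>x. x \<in> H \<Longrightarrow> \<exists>y\<in>H'. \<phi> y = x" "\<phi> 0 = 0"
  shows "\<exists>g\<in>chains n p H'. (\<lambda>T. \<phi> (g T)) = f"
proof -
  define g where "g T = (if T \<subseteq> {..<n} \<and> card T = p then SOME y. y \<in> H' \<and> \<phi> y = f T else 0)" for T
  have g: "g T \<in> H' \<and> \<phi> (g T) = f T" if "T \<subseteq> {..<n}" "card T = p" for T
  proof -
    have "\<exists>y. y \<in> H' \<and> \<phi> y = f T" using assms(2) chainsD[OF assms(1) that] by blast
    then have "(SOME y. y \<in> H' \<and> \<phi> y = f T) \<in> H' \<and> \<phi> (SOME y. y \<in> H' \<and> \<phi> y = f T) = f T"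
      by (rule someI_ex)
    then show ?thesis using that by (simp add: g_def)
  qed
  show ?thesis
  proof (intro bexI ext)
    fix T show "\<phi> (g T) = f T"
      using g chains_outside[OF assms(1)] assms(3) by (cases "T \<subseteq> {..<n} \<and> card T = p") (auto simp: g_def)
    show "g \<in> chains n p H'" by (rule chainsI) (use g in \<open>auto simp: g_def\<close>)
  qed
qed

lemma ksign_simps [simp]:
  "ksign i T 0 = 0"
  "ksign i T (x + y) = ksign i T x + ksign i T y"
  "ksign i T (x - y) = ksign i T x - ksign i T y"
  "ksign i T (- x) = - ksign i T x"
  by (auto simp: ksign_def)

lemma ksign_in: "x \<in> H \<Longrightarrow> - x \<in> H \<Longrightarrow> ksign i T x \<in> H"
  by (auto simp: ksign_def)

lemma ksign_map: "\<phi> (- x) = - \<phi> x \<Longrightarrow> \<phi> (ksign i T x) = ksign i T (\<phi> x)"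
  by (auto simp: ksign_def)

lemma kd_chain_zero:
  assumes "f \<in> chains n 0 H" "\<And>i. X i 0 = 0"
  shows "kd X n f = 0"
proof
  fix T
  have "f (insert i T) = 0" for i
    by (rule chains_outside[OF assms(1)]) (use finite_subset[of "insert i T" "{..<n}"] in \<open>auto simp: card_gt_0_iff\<close>)
  then show "kd X n f T = 0 T" by (simp add: kd_def assms(2))
qed

lemma kd_chains:
  assumes f: "f \<in> chains n p H" and X: "\<And>i x. i < n \<Longrightarrow> x \<in> H \<Longrightarrow> X i x \<in> H'" "\<And>i. X i 0 = 0"
    and H': "0 \<in> H'" "\<And>x y. x \<in> H' \<Longrightarrow> y \<in> H' \<Longrightarrow> x + y \<in> H'" "\<And>x. x \<in> H' \<Longrightarrow> - x \<in> H'"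
  shows "kd X n f \<in> chains n (p - 1) H'"
proof (cases "p = 0")
  case True
  then show ?thesis using kd_chain_zero[of f n H X] f X(2) chains_zero[OF H'(1)] by simp
next
  case False
  show ?thesis
  proof (rule chainsI)
    fix T assume T: "T \<subseteq> {..<n}" "card T = p - 1"
    have "finite T" using T(1) finite_subset by blast
    have *: "ksign i T (X i (f (insert i T))) \<in> H'" if "i \<in> {..<n} - T" for i
    proof (intro ksign_in H'(3))
      have "f (insert i T) \<in> H"
        using T that False \<open>finite T\<close> by (intro chainsD[OF f]) auto
      then show "X i (f (insert i T)) \<in> H'" "X i (f (insert i T)) \<in> H'" using X that by auto
    qed
    have "(\<Sum>i\<in>I. ksign i T (X i (f (insert i T)))) \<in> H'" if "finite I" "I \<subseteq> {..<n} - T" for I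
      using that by (induction rule: finite_induct) (auto intro: H' *)
    then show "kd X n f T \<in> H'" unfolding kd_def by simp
  next
    fix T assume T: "\<not> (T \<subseteq> {..<n} \<and> card T = p - 1)"
    have "f (insert i T) = 0" if "i \<in> {..<n} - T" for i
    proof (rule chains_outside[OF f])
      show "\<not> (insert i T \<subseteq> {..<n} \<and> card (insert i T) = p)"
        using T that False finite_subset[of T "{..<n}"] by (auto simp: card_insert_if)
    qed
    then show "kd X n f T = 0" by (simp add: kd_def X(2))
  qed
qed

lemma kd_map:
  assumes "\<And>x y. \<phi> (x + y) = \<phi> x + \<phi> y" "\<And>x. \<phi> (- x) = - \<phi> x" "\<phi> 0 = 0"
    "\<And>i T. i < n \<Longrightarrow> X' i (\<phi> (f T)) = \<phi> (X i (f T))"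
  shows "kd X' n (\<lambda>T. \<phi> (f T)) = (\<lambda>T. \<phi> (kd X n f T))"
proof
  fix T
  have s: "\<phi> (\<Sum>i\<in>A. h i) = (\<Sum>i\<in>A. \<phi> (h i))" for h and A :: "nat set"
    by (induction A rule: infinite_finite_induct) (auto simp: assms)
  show "kd X' n (\<lambda>T. \<phi> (f T)) T = \<phi> (kd X n f T)"
    unfolding kd_def s
    by (intro sum.cong) (auto simp: assms(4) ksign_map[where \<phi> = \<phi>, OF assms(2)])
qed

text \<open>The terms for \<open>(i, j)\<close> and \<open>(j, i)\<close> cancel: for
  \<open>i < j\<close>, inserting \<open>i\<close> first adds one element below \<open>j\<close>,
  while inserting \<open>j\<close> first adds none below \<open>i\<close>, so the signs are
  opposite.\<close>

lemma kd_kd: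
  assumes add: "\<And>i x y. X i (x + y) = X i x + X i y" and comm: "\<And>i j x. X i (X j x) = X j (X i x)"
  shows "kd X n (kd X n f) = 0"
proof
  fix T
  have zero: "X i 0 = 0" for i using add[of i 0 0] by simp
  have neg: "X i (- x) = - X i x" for i x using add[of i x "- x"] zero by (simp add: eq_neg_iff_add_eq_0 add.commute)
  have s: "X i (\<Sum>j\<in>A. h j) = (\<Sum>j\<in>A. X i (h j))" for h and A :: "nat set" and i
    by (induction A rule: infinite_finite_induct) (auto simp: add zero)
  have ks: "ksign i T (\<Sum>j\<in>A. h j) = (\<Sum>j\<in>A. ksign i T (h j :: 'a))" for h and A :: "nat set" and i
    by (auto simp: ksign_def sum_negf)
  define t where "t i j = ksign i T (X i (ksign j (insert i T) (X j (f (insert j (insert i T))))))" for i j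
  let ?A = "{..<n} - T"
  define P where "P = {(i, j) \<in> ?A \<times> ?A. i < j}"
  define P' where "P' = {(i, j) \<in> ?A \<times> ?A. j < i}"
  have fin: "finite P" "finite P'"
    by (rule finite_subset[of _ "?A \<times> ?A"]; auto simp: P_def P'_def)+
  have "kd X n (kd X n f) T = (\<Sum>i\<in>?A. \<Sum>j\<in>{..<n} - insert i T. t i j)"
    unfolding kd_def s ks t_def ..
  also have "\<dots> = (\<Sum>(i, j)\<in>(SIGMA i:?A. {..<n} - insert i T). t i j)"
    by (rule sum.Sigma) auto
  also have "(SIGMA i:?A. {..<n} - insert i T) = P \<union> P'"
    unfolding P_def P'_def by auto
  also have "(\<Sum>(i, j)\<in>P \<union> P'. t i j) = (\<Sum>(i, j)\<in>P. t i j) + (\<Sum>(i, j)\<in>P'. t i j)"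
    by (rule sum.union_disjoint) (use fin in \<open>auto simp: P_def P'_def\<close>)
  also have "(\<Sum>(i, j)\<in>P'. t i j) = (\<Sum>(i, j)\<in>P. t j i)"
    by (rule sum.reindex_bij_witness[of _ prod.swap prod.swap]) (auto simp: P_def P'_def)
  also have "(\<Sum>(i, j)\<in>P. t i j) + (\<Sum>(i, j)\<in>P. t j i) = (\<Sum>(i, j)\<in>P. t i j + t j i)"
    by (simp add: sum.distrib[symmetric] case_prod_beta)
  also have "\<dots> = 0"
  proof (rule sum.neutral, clarify)
    fix i j assume "(i, j) \<in> P"
    then have ij: "i < j" "i \<notin> T" "j \<notin> T" by (auto simp: P_def)
    have "{l \<in> insert i T. l < j} = insert i {l \<in> T. l < j}" using ij by auto
    then have 1: "card {l \<in> insert i T. l < j} = Suc (card {l \<in> T. l < j})" using ij by simp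
    have 2: "{l \<in> insert j T. l < i} = {l \<in> T. l < i}" using ij by auto
    show "t i j + t j i = 0"
      unfolding t_def ksign_def 1 2 insert_commute[of i j T]
      by (auto simp: neg comm[of j i])
  qed
  finally show "kd X n (kd X n f) T = 0 T" by simp
qed

text \<open>Serves at once for Koszul chains, for free modules in coordinates and for the extension
  of scalars.\<close>

definition fun_on :: "'x set \<Rightarrow> 'a::zero set \<Rightarrow> ('x \<Rightarrow> 'a) set" where
  "fun_on I H = {f. \<forall>x. if x \<in> I then f x \<in> H else f x = 0}"

lemma fun_onI: "(\<And>x. x \<in> I \<Longrightarrow> f x \<in> H) \<Longrightarrow> (\<And>x. x \<notin> I \<Longrightarrow> f x = 0) \<Longrightarrow> f \<in> fun_on I H"
  by (simp add: fun_on_def)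

lemma fun_on_in: "f \<in> fun_on I H \<Longrightarrow> x \<in> I \<Longrightarrow> f x \<in> H"
  unfolding fun_on_def by (drule CollectD, drule spec[of _ x]) simp

lemma fun_on_out: "f \<in> fun_on I H \<Longrightarrow> x \<notin> I \<Longrightarrow> f x = 0"
  unfolding fun_on_def by (drule CollectD, drule spec[of _ x]) simp

lemma chains_eq_fun_on: "chains n p H = fun_on {T. T \<subseteq> {..<n} \<and> card T = p} H"
  by (simp add: chains_def fun_on_def)

lemma (in vspace) fun_on_subspace:
  fixes I :: "'x set"
  assumes "subspace H"
  shows "module.subspace (fun_scale scale) (fun_on I H)"
proof -
  interpret fs: vspace "fun_scale scale :: 'f \<Rightarrow> ('x \<Rightarrow> 'b) \<Rightarrow> 'x \<Rightarrow> 'b"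
    by (rule vspace_fun) unfold_locales
  show ?thesis
    unfolding fs.subspace_def
  proof (intro conjI ballI allI)
    show "0 \<in> fun_on I H" by (rule fun_onI) (simp_all add: subspace_0 assms)
    fix x y assume x: "x \<in> fun_on I H"
    show "fun_scale scale c x \<in> fun_on I H" for c
      by (rule fun_onI) (simp_all add: fun_scale_def fun_on_in[OF x] fun_on_out[OF x] subspace_scale assms)
    assume y: "y \<in> fun_on I H"
    show "x + y \<in> fun_on I H"
      by (rule fun_onI) (simp_all add: fun_on_in[OF x] fun_on_out[OF x] fun_on_in[OF y] fun_on_out[OF y]
          subspace_add assms)
  qed
qed

text \<open>A graded module over the polynomial ring, seen only through its commuting variable
  operators and its finite-dimensional components. Instances are the module itself, the terms of its
  resolution, the polynomial ring and the extension to Laurent series.\<close>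

locale gops = vspace scale
  for scale :: "'f::field \<Rightarrow> 'a::ab_group_add \<Rightarrow> 'a" +
  fixes X :: "nat \<Rightarrow> 'a \<Rightarrow> 'a" and n :: nat and G :: "int \<Rightarrow> 'a set"
  assumes X_linear: "Vector_Spaces.linear scale scale (X i)"
    and X_comm: "X i (X j x) = X j (X i x)"
    and G_fin: "fin_subspace (G d)"
    and X_G: "i < n \<Longrightarrow> x \<in> G d \<Longrightarrow> X i x \<in> G (d + 1)"
begin

sublocale fs: vspace "fun_scale scale :: 'f \<Rightarrow> ('x \<Rightarrow> 'a) \<Rightarrow> 'x \<Rightarrow> 'a"
  by (rule vspace_fun) unfold_locales

lemma X_simps [simp]:
  "X i 0 = 0" "X i (x + y) = X i x + X i y" "X i (x - y) = X i x - X i y" "X i (- x) = - X i x"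
  "X i (scale c x) = scale c (X i x)" "X i (sum h A) = (\<Sum>a\<in>A. X i (h a))"
proof -
  interpret Vector_Spaces.linear scale scale "X i" by (rule X_linear)
  show "X i 0 = 0" "X i (x + y) = X i x + X i y" "X i (x - y) = X i x - X i y" "X i (- x) = - X i x"
    "X i (scale c x) = scale c (X i x)" "X i (sum h A) = (\<Sum>a\<in>A. X i (h a))"
    by (simp_all add: zero add diff neg scale sum)
qed

lemma G_sub: "subspace (G d)" using G_fin fin_subspaceD by blast

lemma G_simps [simp]:
  "0 \<in> G d" "x \<in> G d \<Longrightarrow> y \<in> G d \<Longrightarrow> x + y \<in> G d" "x \<in> G d \<Longrightarrow> y \<in> G d \<Longrightarrow> x - y \<in> G d"
  "x \<in> G d \<Longrightarrow> - x \<in> G d" "x \<in> G d \<Longrightarrow> scale c x \<in> G d" "(\<And>a. a \<in> A \<Longrightarrow> h a \<in> G d) \<Longrightarrow> sum h A \<in> G d"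
  by (simp_all add: G_sub subspace_0 subspace_add subspace_diff subspace_neg subspace_scale subspace_sum)

lemma ksign_scale: "ksign i T (scale c x) = scale c (ksign i T x)"
  by (simp add: ksign_def)

lemma kd_simps [simp]:
  "kd X n (f + g) = kd X n f + kd X n g"
  "kd X n (fun_scale scale c f) = fun_scale scale c (kd X n f)"
  "kd X n (f - g) = kd X n f - kd X n g"
  "kd X n 0 = 0"
  by (simp_all add: fun_eq_iff kd_def fun_scale_def sum.distrib sum_subtractf ksign_scale scale_sum_right)

lemma kd_linear: "Vector_Spaces.linear (fun_scale scale) (fun_scale scale) (kd X n)"
  by unfold_locales simp_all

lemma dd [simp]: "kd X n (kd X n f) = 0"
  by (rule kd_kd) (auto simp: X_comm)

lemma chains_subspace: "subspace H \<Longrightarrow> fs.subspace (chains n p H)"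
  unfolding chains_eq_fun_on by (rule fun_on_subspace)

end

lemma (in vspace) fun_on_fin_subspace:
  fixes I :: "'x set"
  assumes I: "finite I" and H: "fin_subspace H"
  shows "vspace.fin_subspace (fun_scale scale) (fun_on I H)"
proof -
  interpret fs: vspace "fun_scale scale :: 'f \<Rightarrow> ('x \<Rightarrow> 'b) \<Rightarrow> 'x \<Rightarrow> 'b"
    by (rule vspace_fun) unfold_locales
  note sH = fin_subspaceD[OF H]
  obtain B where B: "finite B" "H \<subseteq> span B" using H by (auto simp: fin_subspace_def)
  define u :: "'x \<Rightarrow> 'b \<Rightarrow> 'x \<Rightarrow> 'b" where "u a h x = (if x = a then h else 0)" for a h x
  define D where "D = (\<lambda>(a, b). u a b) ` (I \<times> B)"
  have u: "u a h \<in> fs.span D" if "a \<in> I" "h \<in> span B" for a h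
    using that(2)
  proof (induction rule: span_induct_alt)
    case base
    have "u a 0 = 0" by (simp add: u_def fun_eq_iff)
    then show ?case using fs.span_zero[of D] by metis
  next
    case (step c x y)
    have "u a x \<in> fs.span D" by (rule fs.span_base) (use step that in \<open>auto simp: D_def\<close>)
    from fs.span_add[OF fs.span_scale[OF this, of c] step(2)]
    have "fun_scale scale c (u a x) + u a y \<in> fs.span D" .
    moreover have "fun_scale scale c (u a x) + u a y = u a (scale c x + y)"
      by (simp add: u_def fun_eq_iff fun_scale_def)
    ultimately show ?case by simp
  qed
  have "fun_on I H \<subseteq> fs.span D"
  proof
    fix f assume f: "f \<in> fun_on I H"
    have sumu: "(\<Sum>a\<in>J. u a (f a)) x = (if x \<in> J then f x else 0)" if "finite J" for x J
      using that by (induction J rule: finite_induct) (auto simp: u_def)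
    have "f = (\<Sum>a\<in>I. u a (f a))"
      using fun_on_out[OF f] by (intro ext) (simp add: sumu[OF I])
    also have "\<dots> \<in> fs.span D"
      by (intro fs.span_sum u) (use fun_on_in[OF f] B in auto)
    finally show "f \<in> fs.span D" .
  qed
  moreover have "fs.subspace (fun_on I H)" by (rule fun_on_subspace[OF sH])
  moreover have "finite D" using I B by (simp add: D_def)
  ultimately show ?thesis using fs.fin_subspace_def by blast
qed

text \<open>Induction on \<open>I\<close>: evaluation at the new point maps onto \<open>H\<close>,
  with the functions on the old set as kernel.\<close>

lemma (in vspace) dim_fun_on:
  fixes I :: "'x set"
  assumes I: "finite I" and H: "fin_subspace H"
  shows "vector_space.dim (fun_scale scale) (fun_on I H) = card I * dim H"
proof -
  interpret fs: vspace "fun_scale scale :: 'f \<Rightarrow> ('x \<Rightarrow> 'b) \<Rightarrow> 'x \<Rightarrow> 'b"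
    by (rule vspace_fun) unfold_locales
  interpret fp: vspace_pair "fun_scale scale :: 'f \<Rightarrow> ('x \<Rightarrow> 'b) \<Rightarrow> 'x \<Rightarrow> 'b" scale ..
  note sH = fin_subspaceD[OF H]
  show ?thesis
    using I
  proof (induction I rule: finite_induct)
    case empty
    have "fun_on {} H = {0 :: 'x \<Rightarrow> 'b}"
    proof (intro Set.set_eqI iffI)
      fix f :: "'x \<Rightarrow> 'b" assume "f \<in> fun_on {} H"
      then have "f x = 0" for x using fun_on_out by (metis empty_iff)
      then show "f \<in> {0}" by (simp add: fun_eq_iff)
    qed (auto intro: fun_onI)
    then show ?case by simp
  next
    case (insert a I)
    have lin: "Vector_Spaces.linear (fun_scale scale) scale (\<lambda>f. f a)"
      by unfold_locales (simp_all add: fun_scale_def)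
    have fin: "finite (insert a I)" using insert(1) by simp
    have "fs.dim (fun_on (insert a I) H)
      = fs.dim {v \<in> fun_on (insert a I) H. v a = 0} + dim ((\<lambda>f. f a) ` fun_on (insert a I) H)"
      by (rule fp.rank_nullity[OF lin fun_on_fin_subspace[OF fin H]])
    also have "{v \<in> fun_on (insert a I) H. v a = 0} = fun_on I H"
    proof (intro Set.set_eqI iffI)
      fix f assume f: "f \<in> {v \<in> fun_on (insert a I) H. v a = 0}"
      then have f: "f \<in> fun_on (insert a I) H" and "f a = 0" by auto
      show "f \<in> fun_on I H"
      proof (rule fun_onI)
        show "f x \<in> H" if "x \<in> I" for x using fun_on_in[OF f, of x] that by simp
        show "f x = 0" if "x \<notin> I" for x
          using fun_on_out[OF f, of x] that \<open>f a = 0\<close> by (cases "x = a") simp_all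
      qed
    next
      fix f assume f: "f \<in> fun_on I H"
      have "f a = 0" using fun_on_out[OF f insert(2)] .
      moreover have "f \<in> fun_on (insert a I) H"
      proof (rule fun_onI)
        show "f x \<in> H" if "x \<in> insert a I" for x
          using fun_on_in[OF f, of x] that \<open>f a = 0\<close> subspace_0[OF sH] by (cases "x = a") simp_all
        show "f x = 0" if "x \<notin> insert a I" for x
          using fun_on_out[OF f, of x] that by simp
      qed
      ultimately show "f \<in> {v \<in> fun_on (insert a I) H. v a = 0}" by simp
    qed
    also have "(\<lambda>f. f a) ` fun_on (insert a I) H = H"
    proof
      show "H \<subseteq> (\<lambda>f. f a) ` fun_on (insert a I) H"
      proof
        fix h assume "h \<in> H"
        then have "(\<lambda>x. if x = a then h else 0) \<in> fun_on (insert a I) H"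
          using subspace_0[OF sH] by (intro fun_onI) simp_all
        then show "h \<in> (\<lambda>f. f a) ` fun_on (insert a I) H" by (rule rev_image_eqI) simp
      qed
      show "(\<lambda>f. f a) ` fun_on (insert a I) H \<subseteq> H"
        using fun_on_in[of _ "insert a I" H a] by auto
    qed
    finally show ?case using insert by simp
  qed
qed

lemma card_chain_index: "card {T. T \<subseteq> {..<n} \<and> card T = p} = n choose p"
  using n_subsets[of "{..<n}" p] by simp

lemma finite_chain_index: "finite {T. T \<subseteq> {..<n :: nat} \<and> card T = p}"
  by (rule finite_subset[of _ "Pow {..<n}"]) auto

lemma (in vspace) chains_fin: "fin_subspace H \<Longrightarrow> vspace.fin_subspace (fun_scale scale) (chains n p H)"
  unfolding chains_eq_fun_on by (rule fun_on_fin_subspace[OF finite_chain_index])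

lemma (in vspace) dim_chains:
  "fin_subspace H \<Longrightarrow> vector_space.dim (fun_scale scale) (chains n p H) = (n choose p) * dim H"
  by (simp only: chains_eq_fun_on dim_fun_on[OF finite_chain_index] card_chain_index)

section \<open>Koszul homology of graded quotients\<close>

context gops
begin

definition gsub :: "(int \<Rightarrow> 'a set) \<Rightarrow> bool" where
  "gsub N \<longleftrightarrow> (\<forall>d. subspace (N d) \<and> N d \<subseteq> G d) \<and> (\<forall>d i x. i < n \<longrightarrow> x \<in> N d \<longrightarrow> X i x \<in> N (d + 1))"

text \<open>
  The Koszul homology of the quotient \<open>G/N\<close>, with cycles and boundaries represented by chains of
  \<open>G\<close>. For \<open>p = 0\<close> the truncated \<open>p - 1\<close> is harmless, since the differential is zero there.
\<close>

definition cyc :: "(int \<Rightarrow> 'a set) \<Rightarrow> nat \<Rightarrow> int \<Rightarrow> (nat set \<Rightarrow> 'a) set" where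
  "cyc N p j = {f \<in> chains n p (G (j - int p)). kd X n f \<in> chains n (p - 1) (N (j - int p + 1))}"

definition bnd :: "(int \<Rightarrow> 'a set) \<Rightarrow> nat \<Rightarrow> int \<Rightarrow> (nat set \<Rightarrow> 'a) set" where
  "bnd N p j = {f \<in> chains n p (G (j - int p)).
     \<exists>g\<in>chains n (p + 1) (G (j - int p - 1)). f - kd X n g \<in> chains n p (N (j - int p))}"

definition kh :: "(int \<Rightarrow> 'a set) \<Rightarrow> nat \<Rightarrow> int \<Rightarrow> int" where
  "kh N p j = int (vector_space.dim (fun_scale scale) (cyc N p j))
    - int (vector_space.dim (fun_scale scale) (bnd N p j))"

lemma kd_in_chains:
  assumes "f \<in> chains n p H" "subspace H'" "\<And>i x. i < n \<Longrightarrow> x \<in> H \<Longrightarrow> X i x \<in> H'"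
  shows "kd X n f \<in> chains n (p - 1) H'"
  by (rule kd_chains[OF assms(1)]) (simp_all add: assms subspace_0 subspace_add subspace_neg)

lemma kd_in_G: "f \<in> chains n p (G e) \<Longrightarrow> kd X n f \<in> chains n (p - 1) (G (e + 1))"
  by (rule kd_in_chains) (auto simp: G_sub X_G)

lemma kd_in_N: "gsub N \<Longrightarrow> f \<in> chains n p (N e) \<Longrightarrow> kd X n f \<in> chains n (p - 1) (N (e + 1))"
  by (rule kd_in_chains) (auto simp: gsub_def)

lemma gsub_zero: "gsub (\<lambda>_. {0})"
  by (auto simp: gsub_def)

lemma gsub_subspace: "gsub N \<Longrightarrow> subspace (N e)"
  by (simp add: gsub_def)

lemma bndI:
  "f \<in> chains n p (G (j - int p)) \<Longrightarrow> g \<in> chains n (p + 1) (G (j - int p - 1)) \<Longrightarrow>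
   f - kd X n g \<in> chains n p (N (j - int p)) \<Longrightarrow> f \<in> bnd N p j"
  by (auto simp: bnd_def)

lemma bndE:
  assumes "f \<in> bnd N p j"
  obtains g where "f \<in> chains n p (G (j - int p))" "g \<in> chains n (p + 1) (G (j - int p - 1))"
    "f - kd X n g \<in> chains n p (N (j - int p))"
  using assms by (auto simp: bnd_def)

lemma cyc_fin:
  assumes "gsub N"
  shows "fs.fin_subspace (cyc N p j)"
proof (rule fs.fin_subspace_mono[OF chains_fin[OF G_fin]])
  note s1 = chains_subspace[OF G_sub] and s2 = chains_subspace[OF gsub_subspace[OF assms]]
  show "fs.subspace (cyc N p j)"
    unfolding fs.subspace_def cyc_def
    by (simp add: fs.subspace_0[OF s1] fs.subspace_0[OF s2] fs.subspace_add[OF s1] fs.subspace_add[OF s2]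
      fs.subspace_scale[OF s1] fs.subspace_scale[OF s2])
  show "cyc N p j \<subseteq> chains n p (G (j - int p))" by (auto simp: cyc_def)
qed

lemma bnd_subspace:
  assumes "gsub N"
  shows "fs.subspace (bnd N p j)"
proof -
  note s1 = chains_subspace[OF G_sub] and s2 = chains_subspace[OF gsub_subspace[OF assms]]
  show ?thesis
    unfolding fs.subspace_def
  proof (intro conjI ballI allI)
    show "0 \<in> bnd N p j"
      by (rule bndI[where g = 0]) (simp_all add: fs.subspace_0[OF s1] fs.subspace_0[OF s2])
  next
    fix x y assume "x \<in> bnd N p j" "y \<in> bnd N p j"
    then obtain g h where x: "x \<in> chains n p (G (j - int p))" "g \<in> chains n (p + 1) (G (j - int p - 1))"
        "x - kd X n g \<in> chains n p (N (j - int p))"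
      and y: "y \<in> chains n p (G (j - int p))" "h \<in> chains n (p + 1) (G (j - int p - 1))"
        "y - kd X n h \<in> chains n p (N (j - int p))"
      by (elim bndE) blast
    have e: "x + y - kd X n (g + h) = (x - kd X n g) + (y - kd X n h)" by (simp add: algebra_simps)
    show "x + y \<in> bnd N p j"
      by (rule bndI[where g = "g + h"], rule fs.subspace_add[OF s1 x(1) y(1)],
          rule fs.subspace_add[OF s1 x(2) y(2)], unfold e, rule fs.subspace_add[OF s2 x(3) y(3)])
  next
    fix c x assume "x \<in> bnd N p j"
    then obtain g where x: "x \<in> chains n p (G (j - int p))" "g \<in> chains n (p + 1) (G (j - int p - 1))"
        "x - kd X n g \<in> chains n p (N (j - int p))"
      by (elim bndE)
    have e: "fun_scale scale c x - kd X n (fun_scale scale c g) = fun_scale scale c (x - kd X n g)"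
      by (simp add: fs.scale_right_diff_distrib)
    show "fun_scale scale c x \<in> bnd N p j"
      by (rule bndI[where g = "fun_scale scale c g"], rule fs.subspace_scale[OF s1 x(1)],
          rule fs.subspace_scale[OF s1 x(2)], unfold e, rule fs.subspace_scale[OF s2 x(3)])
  qed
qed

lemma bnd_cyc:
  assumes "gsub N"
  shows "bnd N p j \<subseteq> cyc N p j"
proof
  fix f assume "f \<in> bnd N p j"
  then obtain g where f: "f \<in> chains n p (G (j - int p))" "f - kd X n g \<in> chains n p (N (j - int p))"
    by (auto simp: bnd_def)
  have "kd X n (f - kd X n g) = kd X n f" by (simp only: kd_simps dd diff_zero)
  moreover have "kd X n (f - kd X n g) \<in> chains n (p - 1) (N (j - int p + 1))"
    by (rule kd_in_N[OF assms f(2)])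
  ultimately show "f \<in> cyc N p j" using f(1) by (simp add: cyc_def)
qed

lemma kh_zero_iff:
  assumes "gsub N"
  shows "kh N p j = 0 \<longleftrightarrow> cyc N p j \<subseteq> bnd N p j"
  unfolding kh_def
proof
  assume "int (fs.dim (cyc N p j)) - int (fs.dim (bnd N p j)) = 0"
  then have "bnd N p j = cyc N p j"
    by (intro fs.dim_eq_fin[OF cyc_fin[OF assms] bnd_subspace[OF assms] bnd_cyc[OF assms]]) simp
  then show "cyc N p j \<subseteq> bnd N p j" by simp
next
  assume "cyc N p j \<subseteq> bnd N p j"
  then have "bnd N p j = cyc N p j" using bnd_cyc[OF assms, of p j] by simp
  then show "int (fs.dim (cyc N p j)) - int (fs.dim (bnd N p j)) = 0" by simp
qed

lemma euler_characteristic: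
  "(\<Sum>p\<le>n. (-1) ^ p * kh (\<lambda>_. {0}) p j) = (\<Sum>p\<le>n. (-1) ^ p * int ((n choose p) * dim (G (j - int p))))"
proof -
  interpret fp: vspace_pair "fun_scale scale :: 'f \<Rightarrow> (nat set \<Rightarrow> 'a) \<Rightarrow> nat set \<Rightarrow> 'a" "fun_scale scale :: 'f \<Rightarrow> (nat set \<Rightarrow> 'a) \<Rightarrow> nat set \<Rightarrow> 'a" ..
  \<comment> \<open>The rank of the differential leaving the \<open>p\<close>-chains. It enters the
    homology in degrees \<open>p\<close> and \<open>p - 1\<close>, hence the alternating sum twice
    with opposite signs.\<close>
  define \<rho> where "\<rho> p = int (fs.dim (kd X n ` chains n p (G (j - int p))))" for p
  have kh: "kh (\<lambda>_. {0}) p j = int ((n choose p) * dim (G (j - int p))) - \<rho> p - \<rho> (Suc p)" for p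
  proof -
    have "cyc (\<lambda>_. {0}) p j = {f \<in> chains n p (G (j - int p)). kd X n f = 0}"
      unfolding cyc_def using chains_zero[of "{0}" n "p - 1"] by (auto dest: chains_trivial)
    moreover have "bnd (\<lambda>_. {0}) p j = kd X n ` chains n (Suc p) (G (j - int (Suc p)))" (is "?L = ?R")
    proof -
      have e: "j - int (Suc p) = j - int p - 1" by simp
      have "kd X n g \<in> chains n p (G (j - int p))" if "g \<in> chains n (Suc p) (G (j - int p - 1))" for g
        using kd_in_G[OF that] by simp
      then have "?R \<subseteq> ?L"
        unfolding bnd_def e using chains_zero[of "{0}" n p] by force
      moreover have "?L \<subseteq> ?R"
        unfolding bnd_def e by (auto dest!: chains_trivial)
      ultimately show ?thesis by blast
    qed
    moreover have "fs.dim (chains n p (G (j - int p))) = fs.dim {f \<in> chains n p (G (j - int p)). kd X n f = 0}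
        + fs.dim (kd X n ` chains n p (G (j - int p)))"
      by (rule fp.rank_nullity[OF kd_linear chains_fin[OF G_fin]])
    ultimately show ?thesis
      unfolding kh_def \<rho>_def dim_chains[OF G_fin] by simp
  qed
  have tele: "(\<Sum>p\<le>k. (-1) ^ p * (\<rho> p + \<rho> (Suc p))) = \<rho> 0 + (-1) ^ k * \<rho> (Suc k)" for k
    by (induction k) (auto simp: algebra_simps)
  have "kd X n ` chains n 0 (G (j - int 0)) \<subseteq> {0}"
    using kd_chain_zero[of _ n "G (j - int 0)" X] by auto
  then have r0: "\<rho> 0 = 0"
    unfolding \<rho>_def using fs.dim_le_card[of "kd X n ` chains n 0 (G (j - int 0))" "{}"] by simp
  have "kd X n ` chains n (Suc n) (G (j - int (Suc n))) \<subseteq> {0}"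
    using chains_above[of n "Suc n" _ "G (j - int (Suc n))"] by (auto dest!: chains_above[rotated])
  then have rn: "\<rho> (Suc n) = 0"
    unfolding \<rho>_def using fs.dim_le_card[of "kd X n ` chains n (Suc n) (G (j - int (Suc n)))" "{}"] by simp
  have "(\<Sum>p\<le>n. (-1) ^ p * kh (\<lambda>_. {0}) p j)
    = (\<Sum>p\<le>n. (-1) ^ p * int ((n choose p) * dim (G (j - int p)))) - (\<Sum>p\<le>n. (-1) ^ p * (\<rho> p + \<rho> (Suc p)))"
    unfolding kh sum_subtractf[symmetric] by (intro sum.cong) (auto simp: algebra_simps)
  then show ?thesis unfolding tele r0 rn by simp
qed

end

section \<open>General hyperplane sections\<close>

text \<open>Gaussian elimination: equation \<open>j\<close> is solved for the unknown at a pivot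
  \<open>k\<close> and substituted into the remaining equations.\<close>

lemma underdetermined_system:
  fixes a :: "'i \<Rightarrow> 'j \<Rightarrow> 'f::field"
  assumes "finite J" "finite I" "card J < card I"
  shows "\<exists>c. (\<exists>i\<in>I. c i \<noteq> 0) \<and> (\<forall>j\<in>J. (\<Sum>i\<in>I. c i * a i j) = 0)"
  using assms
proof (induction J arbitrary: I a rule: finite_induct)
  case empty
  then have "I \<noteq> {}" by auto
  then show ?case by (intro exI[of _ "\<lambda>_. 1"]) auto
next
  case (insert j J)
  show ?case
  proof (cases "\<forall>i\<in>I. a i j = 0")
    case True
    have "card J < card I" using insert by simp
    from insert.IH[OF insert.prems(1) this, of a] True show ?thesis by auto
  next
    case False
    then obtain k where k: "k \<in> I" "a k j \<noteq> 0" by blast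
    define I' where "I' = I - {k}"
    have I': "finite I'" "k \<notin> I'" "I = insert k I'" using insert k by (auto simp: I'_def)
    have "card J < card I'" using insert I' by simp
    from insert.IH[OF I'(1) this, of "\<lambda>i l. a i l - a i j / a k j * a k l"] obtain c where
      c: "\<exists>i\<in>I'. c i \<noteq> 0" "\<And>l. l \<in> J \<Longrightarrow> (\<Sum>i\<in>I'. c i * (a i l - a i j / a k j * a k l)) = 0"
      by blast
    define c' where "c' i = (if i = k then - (\<Sum>i\<in>I'. c i * (a i j / a k j)) else c i)" for i
    have c'sum: "(\<Sum>i\<in>I. c' i * a i l) = (\<Sum>i\<in>I'. c i * (a i l - a i j / a k j * a k l))" for l
    proof -
      have "(\<Sum>i\<in>I'. c' i * a i l) = (\<Sum>i\<in>I'. c i * a i l)"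
        using I'(2) by (intro sum.cong) (auto simp: c'_def)
      then have "(\<Sum>i\<in>I. c' i * a i l) = - (\<Sum>i\<in>I'. c i * (a i j / a k j)) * a k l + (\<Sum>i\<in>I'. c i * a i l)"
        using I' by (simp add: c'_def)
      also have "\<dots> = (\<Sum>i\<in>I'. c i * (a i l - a i j / a k j * a k l))"
        by (simp add: sum_distrib_right right_diff_distrib sum_subtractf mult.assoc)
      finally show ?thesis .
    qed
    have "(\<Sum>i\<in>I. c' i * a i l) = 0" if "l \<in> insert j J" for l
    proof (cases "l = j")
      case True
      have "c i * (a i l - a i j / a k j * a k l) = 0" for i using k(2) True by simp
      then show ?thesis unfolding c'sum by (simp only: sum.neutral_const)
    next
      case False then show ?thesis unfolding c'sum using c(2) that by blast
    qed
    moreover have "\<exists>i\<in>I. c' i \<noteq> 0" using c(1) I' by (auto simp: c'_def)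
    ultimately show ?thesis by blast
  qed
qed

context vspace
begin

text \<open>In coordinates the \<open>k\<close> vector equations are \<open>k * dim V\<close> scalar
  equations, fewer than the unknowns \<open>c i\<close>.\<close>

lemma dependent_families:
  assumes V: "fin_subspace V" and I: "finite I" "k * dim V < card I"
    and w: "\<And>i l. i \<in> I \<Longrightarrow> l < k \<Longrightarrow> w i l \<in> V"
  shows "\<exists>c. (\<exists>i\<in>I. c i \<noteq> 0) \<and> (\<forall>l<k. (\<Sum>i\<in>I. scale (c i) (w i l)) = 0)"
proof -
  obtain B where B: "B \<subseteq> V" "finite B" "independent B" "span B = V" "card B = dim V"
    using fin_subspace_basis[OF V] .
  have "card ({..<k} \<times> B) < card I" "finite ({..<k} \<times> B)" using B I by simp_all
  from underdetermined_system[OF this(2) I(1) this(1), of "\<lambda>i j. representation B (w i (fst j)) (snd j)"]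
  obtain c where c: "\<exists>i\<in>I. c i \<noteq> 0"
    "\<And>j. j \<in> {..<k} \<times> B \<Longrightarrow> (\<Sum>i\<in>I. c i * representation B (w i (fst j)) (snd j)) = 0"
    by blast
  have "(\<Sum>i\<in>I. scale (c i) (w i l)) = 0" if l: "l < k" for l
  proof -
    have "w i l = (\<Sum>b\<in>B. scale (representation B (w i l) b) b)" if "i \<in> I" for i
      using sum_representation_eq[OF B(3) _ B(2) order_refl] w[OF that l] B(4) by simp
    then have "(\<Sum>i\<in>I. scale (c i) (w i l)) = (\<Sum>i\<in>I. \<Sum>b\<in>B. scale (c i * representation B (w i l) b) b)"
      by (intro sum.cong) (auto simp: scale_sum_right[symmetric] scale_scale[symmetric] simp del: scale_scale)
    also have "\<dots> = (\<Sum>b\<in>B. \<Sum>i\<in>I. scale (c i * representation B (w i l) b) b)"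
      by (rule sum.swap)
    also have "\<dots> = (\<Sum>b\<in>B. scale (\<Sum>i\<in>I. c i * representation B (w i l) b) b)"
      by (simp add: scale_sum_left)
    also have "\<dots> = 0" using c(2)[of "(l, _)"] l by (intro sum.neutral) auto
    finally show ?thesis .
  qed
  then show ?thesis using c by blast
qed

text \<open>Lagrange interpolation modulo \<open>N\<close>: combining the relations with the
  coefficients of a polynomial of degree below \<open>k\<close> that vanishes on \<open>S\<close>
  except at \<open>s\<close> isolates a nonzero multiple of \<open>w s\<close>.\<close>

lemma vandermonde:
  assumes S: "finite S" "card S \<le> k" and N: "subspace N"
    and z: "\<And>i. i < k \<Longrightarrow> (\<Sum>s\<in>S. scale (s ^ i) (w s)) \<in> N" and s: "s \<in> S"
  shows "w s \<in> N"
proof -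
  define p where "p = (\<Prod>t\<in>S - {s}. [:- t, 1:])"
  have deg: "degree p < k"
  proof -
    have "degree p \<le> sum (degree \<circ> (\<lambda>t. [:- t, 1:])) (S - {s})"
      unfolding p_def by (rule degree_prod_sum_le) (use S in auto)
    also have "\<dots> = card (S - {s})" by simp
    also have "\<dots> < k" using card_Diff1_less[OF S(1) s] S(2) by linarith
    finally show ?thesis .
  qed
  have "(\<Sum>t\<in>S. scale (poly p t) (w t)) = (\<Sum>t\<in>S. \<Sum>i\<le>degree p. scale (coeff p i) (scale (t ^ i) (w t)))"
    by (simp add: poly_altdef scale_sum_left)
  also have "\<dots> = (\<Sum>i\<le>degree p. scale (coeff p i) (\<Sum>t\<in>S. scale (t ^ i) (w t)))"
    by (subst sum.swap) (simp add: scale_sum_right)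
  also have "\<dots> \<in> N"
    by (intro subspace_sum[OF N] subspace_scale[OF N] z) (use deg in auto)
  finally have 1: "(\<Sum>t\<in>S. scale (poly p t) (w t)) \<in> N" .
  have "poly p t = 0" if "t \<in> S - {s}" for t
    unfolding p_def poly_prod using that S by (intro prod_zero) auto
  then have "(\<Sum>t\<in>S - {s}. scale (poly p t) (w t)) = 0" by (intro sum.neutral) simp
  then have "(\<Sum>t\<in>S. scale (poly p t) (w t)) = scale (poly p s) (w s)"
    using S s by (simp add: sum.remove)
  moreover have "poly p s \<noteq> 0"
    unfolding p_def poly_prod using S by (auto simp: prod_zero_iff)
  ultimately show ?thesis
    using subspace_scale[OF N 1, of "inverse (poly p s)"] by simp
qed

end

text \<open>The relation \<open>v - f u \<in> A\<close> is a correspondence between the sum and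
  \<open>U\<close>; its fibre over \<open>u = 0\<close> is \<open>A\<close>, and its fibre over
  \<open>v = 0\<close> consists of the \<open>u\<close> with \<open>f u \<in> A\<close>.\<close>

lemma (in vspace_pair) dim_sum_image:
  assumes f: "Vector_Spaces.linear s1 s2 f" and A: "vs2.fin_subspace A" and U: "vs1.fin_subspace U"
  shows "vs2.fin_subspace {a + f u | a u. a \<in> A \<and> u \<in> U}"
    and "vs2.dim {a + f u | a u. a \<in> A \<and> u \<in> U} + vs1.dim {u \<in> U. f u \<in> A} = vs2.dim A + vs1.dim U"
proof -
  interpret f: Vector_Spaces.linear s1 s2 f by fact
  note sA = vs2.fin_subspaceD[OF A] and sU = vs1.fin_subspaceD[OF U]
  have fU: "vs2.fin_subspace (f ` U)" by (rule fin_subspace_image[OF f U])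
  let ?V = "{a + f u | a u. a \<in> A \<and> u \<in> U}"
  have V: "?V = {x + y | x y. x \<in> A \<and> y \<in> f ` U}" by blast
  have sV: "vs2.subspace ?V"
    unfolding V by (rule vs2.subspace_sums[OF sA vs2.fin_subspaceD[OF fU]])
  obtain B C where B: "finite B" "A \<subseteq> vs2.span B" and C: "finite C" "f ` U \<subseteq> vs2.span C"
    using A fU by (auto simp: vs2.fin_subspace_def)
  have "?V \<subseteq> vs2.span (B \<union> C)"
    using B(2) C(2) vs2.span_mono[of B "B \<union> C"] vs2.span_mono[of C "B \<union> C"]
    by (auto intro!: vs2.span_add)
  with B C sV show fV: "vs2.fin_subspace ?V"
    unfolding vs2.fin_subspace_def by (meson finite_UnI)
  interpret p: vspace "prod_scale s2 s1" by (rule vspace_prod) unfold_locales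
  define R where "R = {(v, u). u \<in> U \<and> v - f u \<in> A}"
  have "p.subspace R"
    unfolding p.subspace_def
  proof (intro conjI ballI allI)
    show "0 \<in> R" by (simp add: R_def zero_prod_def vs1.subspace_0[OF sU] vs2.subspace_0[OF sA] f.zero)
    fix x y assume x: "x \<in> R"
    show "prod_scale s2 s1 c x \<in> R" for c
      using x vs2.subspace_scale[OF sA, of "fst x - f (snd x)" c]
      by (auto simp: R_def vs1.subspace_scale[OF sU] f.scale vs2.scale_right_diff_distrib)
    assume y: "y \<in> R"
    show "x + y \<in> R"
      using x y vs2.subspace_add[OF sA, of "fst x - f (snd x)" "fst y - f (snd y)"]
      by (auto simp: R_def vs1.subspace_add[OF sU] f.add algebra_simps)
  qed
  moreover have "R \<subseteq> ?V \<times> U"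
  proof
    fix x assume "x \<in> R"
    then obtain v u where x: "x = (v, u)" "u \<in> U" "v - f u \<in> A" by (auto simp: R_def)
    then have "v = (v - f u) + f u" by simp
    then show "x \<in> ?V \<times> U" using x by blast
  qed
  moreover have "\<exists>u. (v, u) \<in> R" if "v \<in> ?V" for v
    using that by (force simp: R_def)
  moreover have "\<exists>v. (v, u) \<in> R" if "u \<in> U" for u
    by (rule exI[of _ "f u"]) (simp add: R_def that vs2.subspace_0[OF sA])
  ultimately have "vs2.dim ?V + vs1.dim {u. (0, u) \<in> R} = vs1.dim U + vs2.dim {v. (v, 0) \<in> R}"
    by (rule dim_correspondence[OF vs2.vspace_axioms vs1.vspace_axioms fV U])
  moreover have "- x \<in> A \<longleftrightarrow> x \<in> A" for x
    using vs2.subspace_neg[OF sA, of x] vs2.subspace_neg[OF sA, of "- x"] by auto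
  then have "{u. (0, u) \<in> R} = {u \<in> U. f u \<in> A}" by (simp add: R_def)
  moreover have "{v. (v, 0) \<in> R} = A"
    by (auto simp: R_def f.zero vs1.subspace_0[OF sU])
  ultimately show "vs2.dim ?V + vs1.dim {u \<in> U. f u \<in> A} = vs2.dim A + vs1.dim U" by simp
qed

section \<open>Linear forms, regularity and their zero divisors\<close>

context gops
begin

text \<open>By Vandermonde, any \<open>n\<close> of these linear forms are linearly independent.\<close>

definition Y :: "'f \<Rightarrow> 'a \<Rightarrow> 'a" where
  "Y s z = (\<Sum>i<n. scale (s ^ i) (X i z))"

lemma Y_linear: "Vector_Spaces.linear scale scale (Y s)"
  by unfold_locales (simp_all add: Y_def sum.distrib scale_right_distrib scale_sum_right mult.commute)

lemma Y_simps [simp]: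
  "Y s 0 = 0" "Y s (x + y) = Y s x + Y s y" "Y s (x - y) = Y s x - Y s y" "Y s (- x) = - Y s x"
  "Y s (scale c x) = scale c (Y s x)" "Y s (sum h A) = (\<Sum>a\<in>A. Y s (h a))"
proof -
  interpret Vector_Spaces.linear scale scale "Y s" by (rule Y_linear)
  show "Y s 0 = 0" "Y s (x + y) = Y s x + Y s y" "Y s (x - y) = Y s x - Y s y" "Y s (- x) = - Y s x"
    "Y s (scale c x) = scale c (Y s x)" "Y s (sum h A) = (\<Sum>a\<in>A. Y s (h a))"
    by (simp_all add: zero add diff neg scale sum)
qed

lemma Y_X: "X i (Y s z) = Y s (X i z)"
  by (simp add: Y_def X_comm[of i])

lemma Y_G: "z \<in> G e \<Longrightarrow> Y s z \<in> G (e + 1)"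
  unfolding Y_def by (rule G_simps(6), rule G_simps(5), rule X_G) auto

lemma gsub_simps:
  assumes "gsub N"
  shows "0 \<in> N e" "x \<in> N e \<Longrightarrow> y \<in> N e \<Longrightarrow> x + y \<in> N e" "x \<in> N e \<Longrightarrow> y \<in> N e \<Longrightarrow> x - y \<in> N e"
    "x \<in> N e \<Longrightarrow> - x \<in> N e" "x \<in> N e \<Longrightarrow> scale c x \<in> N e"
    "(\<And>a. a \<in> A \<Longrightarrow> h a \<in> N e) \<Longrightarrow> sum h A \<in> N e" "i < n \<Longrightarrow> x \<in> N e \<Longrightarrow> X i x \<in> N (e + 1)"
    "x \<in> N e \<Longrightarrow> x \<in> G e" "x \<in> N e \<Longrightarrow> Y s x \<in> N (e + 1)"
proof -
  note sub = gsub_subspace[OF assms]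
  show "0 \<in> N e" "x \<in> N e \<Longrightarrow> y \<in> N e \<Longrightarrow> x + y \<in> N e" "x \<in> N e \<Longrightarrow> y \<in> N e \<Longrightarrow> x - y \<in> N e"
    "x \<in> N e \<Longrightarrow> - x \<in> N e" "x \<in> N e \<Longrightarrow> scale c x \<in> N e"
    "(\<And>a. a \<in> A \<Longrightarrow> h a \<in> N e) \<Longrightarrow> sum h A \<in> N e"
    by (simp_all add: sub subspace_0 subspace_add subspace_diff subspace_neg subspace_scale subspace_sum)
  show X: "X i x \<in> N (e + 1)" if "i < n" "x \<in> N e" for i using assms that by (auto simp: gsub_def)
  show "x \<in> N e \<Longrightarrow> x \<in> G e" using assms by (auto simp: gsub_def)
  show "Y s x \<in> N (e + 1)" if "x \<in> N e"
    unfolding Y_def by (intro subspace_sum[OF sub] subspace_scale[OF sub]) (simp add: X that)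
qed

lemma gsub_fin: "gsub N \<Longrightarrow> fin_subspace (N e)"
  using fin_subspace_mono[OF G_fin] by (auto simp: gsub_def)

text \<open>Castelnuovo-Mumford regularity at most 1 of the quotient \<open>G/N\<close>, in terms of
  its Koszul homology.\<close>

definition reg :: "(int \<Rightarrow> 'a set) \<Rightarrow> bool" where
  "reg N \<longleftrightarrow> (\<forall>p j. int p + 2 \<le> j \<longrightarrow> cyc N p j \<subseteq> bnd N p j)"

lemma regD: "reg N \<Longrightarrow> int p + 2 \<le> j \<Longrightarrow> f \<in> cyc N p j \<Longrightarrow> f \<in> bnd N p j"
  unfolding reg_def by blast

text \<open>The socle is the Koszul homology in the top homological degree.\<close>

lemma reg_socle:
  assumes N: "gsub N" and reg: "reg N" and e: "e \<ge> 2" and z: "z \<in> G e"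
    and X: "\<And>i. i < n \<Longrightarrow> X i z \<in> N (e + 1)"
  shows "z \<in> N e"
proof -
  define f where "f T = (if T = {..<n} then z else 0)" for T :: "nat set"
  have top: "T = {..<n}" if "T \<subseteq> {..<n}" "card T = n" for T :: "nat set"
    using that card_subset_eq[of "{..<n}" T] by simp
  \<comment> \<open>The first form records the values exactly, so that the hypothesis on the single
    element \<open>z\<close> controls the differential.\<close>
  have f1: "f \<in> chains n n {z, 0}" "f \<in> chains n n (G e)"
    by (rule chainsI; use z top in \<open>auto simp: f_def\<close>)+
  have "kd X n f \<in> chains n (n - 1) (N (e + 1))"
    by (rule kd_in_chains[OF f1(1) gsub_subspace[OF N]]) (auto simp: X gsub_simps[OF N])
  then have "f \<in> cyc N n (e + int n)" using f1(2) by (simp add: cyc_def)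
  then have "f \<in> bnd N n (e + int n)" using e by (intro regD[OF reg]) simp_all
  then obtain g where "g \<in> chains n (n + 1) (G (e + int n - int n - 1))"
    and f: "f - kd X n g \<in> chains n n (N (e + int n - int n))"
    by (rule bndE)
  \<comment> \<open>There are no chains above degree \<open>n\<close>, so a top cycle is a boundary
    only if its value lies in \<open>N\<close>.\<close>
  then have "g = 0" using chains_above by (metis less_add_one)
  then have "(f - 0) {..<n} \<in> N e" using chainsD[OF f, of "{..<n}"] by simp
  then show ?thesis by (simp add: f_def)
qed

text \<open>
  For \<open>Z(t) = (\<Sum>q. \<zeta> q t\<^sup>q)\<close> the last assumption says that \<open>(\<Sum>k. X k t\<^sup>-\<^sup>k)\<close> kills \<open>Z\<close> modulo \<open>N\<close>. For the
  least \<open>k\<close> for which this is not yet known, \<open>X k Z\<close> has a smaller support than \<open>Z\<close>, hence lies in \<open>N\<close> by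
  induction; so the extreme coefficient of \<open>Z\<close> outside \<open>N\<close> is in the socle of \<open>G/N\<close>, which is zero.
\<close>

lemma reg_pencil_kernel:
  assumes N: "gsub N" and reg: "reg N" and e: "e \<ge> 2"
    and \<zeta>: "\<And>q :: int. \<zeta> q \<in> G e" "finite {q. \<zeta> q \<notin> N e}"
      "\<And>l. (\<Sum>k<n. X k (\<zeta> (l + int k))) \<in> N (e + 1)"
  shows "\<zeta> q \<in> N e"
  using e \<zeta>
proof (induction "card {q. \<zeta> q \<notin> N e}" arbitrary: e \<zeta> q rule: less_induct)
  case (less e \<zeta> q)
  note IH = less.hyps and e = less.prems(1) and \<zeta> = less.prems(2-4)
  define A where "A = {q. \<zeta> q \<notin> N e}"
  have A: "finite A" using \<zeta>(2) by (simp add: A_def)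
  show ?case
  proof (rule ccontr)
    assume "\<zeta> q \<notin> N e"
    then have A0: "A \<noteq> {}" by (auto simp: A_def)
    define q0 where "q0 = Max A"
    have q0: "\<zeta> q \<in> N e" if "q > q0" for q
    proof (rule ccontr)
      assume "\<zeta> q \<notin> N e"
      then have "q \<le> q0" using A by (simp add: q0_def A_def)
      then show False using that by simp
    qed
    have q0A: "q0 \<in> A" unfolding q0_def using A A0 by (rule Max_in)
    have X: "\<forall>q. X k (\<zeta> q) \<in> N (e + 1)" if "k < n" for k
      using that
    proof (induction k rule: less_induct)
      case (less k)
      \<comment> \<open>In the relation for \<open>l = q0 - k\<close>, the terms with
        \<open>k' < k\<close> lie in \<open>N\<close> by the inner induction and those with
        \<open>k' > k\<close> because their index exceeds \<open>q0\<close>. Only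
        \<open>X k (\<zeta> q0)\<close> remains.\<close>
      have "X k' (\<zeta> (q0 - int k + int k')) \<in> N (e + 1)" if "k' \<in> {..<n} - {k}" for k'
      proof (cases "k' < k")
        case True
        then show ?thesis using less.IH that by simp
      next
        case False
        then have "\<zeta> (q0 - int k + int k') \<in> N e" using that by (intro q0) auto
        then show ?thesis using gsub_simps(7)[OF N] that by simp
      qed
      then have 1: "(\<Sum>k'\<in>{..<n} - {k}. X k' (\<zeta> (q0 - int k + int k'))) \<in> N (e + 1)"
        by (rule gsub_simps(6)[OF N])
      have "(\<Sum>k'<n. X k' (\<zeta> (q0 - int k + int k')))
        = X k (\<zeta> q0) + (\<Sum>k'\<in>{..<n} - {k}. X k' (\<zeta> (q0 - int k + int k')))"
        using less.prems by (subst sum.remove[of _ k]) auto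
      then have "X k (\<zeta> q0) = (\<Sum>k'<n. X k' (\<zeta> (q0 - int k + int k')))
        - (\<Sum>k'\<in>{..<n} - {k}. X k' (\<zeta> (q0 - int k + int k')))"
        by simp
      then have Xq0: "X k (\<zeta> q0) \<in> N (e + 1)"
        using gsub_simps(3)[OF N \<zeta>(3) 1] by simp
      have sub: "{q. X k (\<zeta> q) \<notin> N (e + 1)} \<subseteq> A - {q0}"
        using Xq0 gsub_simps(7)[OF N less.prems] by (auto simp: A_def)
      have fin: "finite {q. X k (\<zeta> q) \<notin> N (e + 1)}"
        using sub A by (meson finite_Diff finite_subset)
      have "card {q. X k (\<zeta> q) \<notin> N (e + 1)} \<le> card (A - {q0})"
        using sub A by (intro card_mono) auto
      also have "\<dots> < card A" using card_Diff1_less[OF A q0A] .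
      finally have "card {q. X k (\<zeta> q) \<notin> N (e + 1)} < card {q. \<zeta> q \<notin> N e}" by (simp add: A_def)
      note IH' = IH[of "\<lambda>q. X k (\<zeta> q)" "e + 1", OF this _ _ fin]
      have "(\<Sum>k'<n. X k' (X k (\<zeta> (l + int k')))) \<in> N (e + 1 + 1)" for l
      proof -
        have "(\<Sum>k'<n. X k' (X k (\<zeta> (l + int k')))) = X k (\<Sum>k'<n. X k' (\<zeta> (l + int k')))"
          by (simp add: X_comm[of k])
        then show ?thesis using gsub_simps(7)[OF N less.prems \<zeta>(3)] by simp
      qed
      then show ?case using IH' e X_G[OF less.prems \<zeta>(1)] by simp
    qed
    then have "\<zeta> q0 \<in> N e" by (intro reg_socle[OF N reg e \<zeta>(1)]) simp
    then show False using q0A by (simp add: A_def)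
  qed
qed

text \<open>
  Given many bad parameters \<open>s\<close> with witnesses \<open>z s\<close>, a suitable combination \<open>u\<close> of the geometric
  series \<open>(\<Sum>q. s\<^sup>q t\<^sup>q) z s\<close> satisfies the relation of the previous lemma, and it is a rational function
  of \<open>t\<close>, so it becomes finitely supported after multiplication by its denominator.
\<close>

lemma finite_zero_divisors:
  assumes N: "gsub N" and reg: "reg N" and e: "e \<ge> 2"
  shows "finite {s. \<exists>z\<in>G e. z \<notin> N e \<and> Y s z \<in> N (e + 1)}" (is "finite ?bad")
proof (rule ccontr)
  assume "infinite ?bad"
  \<comment> \<open>One more parameter than the \<open>n * dim (G (e + 1))\<close> scalar conditions
    imposed on the coefficients \<open>c\<close> below.\<close>
  then obtain S where S: "finite S" "card S = Suc (n * dim (G (e + 1)))" "S \<subseteq> ?bad"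
    using infinite_arbitrarily_large by blast
  define M where "M = card S"
  define z where "z s = (SOME z. z \<in> G e \<and> z \<notin> N e \<and> Y s z \<in> N (e + 1))" for s
  have z0: "z s \<in> G e \<and> z s \<notin> N e \<and> Y s (z s) \<in> N (e + 1)" if "s \<in> S" for s
  proof -
    have "\<exists>z. z \<in> G e \<and> z \<notin> N e \<and> Y s z \<in> N (e + 1)" using S(3) that by blast
    then show ?thesis unfolding z_def by (rule someI_ex)
  qed
  have z: "z s \<in> G e" "z s \<notin> N e" "Y s (z s) \<in> N (e + 1)" if "s \<in> S" for s
    using z0[OF that] by blast+
  \<comment> \<open>The tail of \<open>Y s (z s)\<close> with exponents lowered by \<open>m\<close>:
    the contribution of \<open>s\<close> to the relation for \<open>l = - m\<close>, where
    \<open>u\<close> vanishes at negative indices.\<close>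
  define w where "w s m = (\<Sum>k\<in>{m..<n}. scale (s ^ (k - m)) (X k (z s)))" for s m
  have w: "w s m \<in> G (e + 1)" if "s \<in> S" for s m
    unfolding w_def by (rule G_simps(6), rule G_simps(5), rule X_G) (simp_all add: z(1)[OF that])
  have "n * dim (G (e + 1)) < card S" unfolding S(2) by (rule lessI)
  then have "\<exists>c. (\<exists>s\<in>S. c s \<noteq> 0) \<and> (\<forall>m<n. (\<Sum>s\<in>S. scale (c s) (w s m)) = 0)"
    by (rule dependent_families[OF G_fin S(1)]) (rule w)
  then obtain c where c: "\<exists>s\<in>S. c s \<noteq> 0" and c2: "\<forall>m<n. (\<Sum>s\<in>S. scale (c s) (w s m)) = 0"
    by (elim exE conjE)
  define u where "u q = (if q < 0 then 0 else \<Sum>s\<in>S. scale (c s * s ^ nat q) (z s))" for q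
  have uG: "u q \<in> G e" for q
    unfolding u_def by (simp add: z)
  have rel: "(\<Sum>k<n. X k (u (l + int k))) \<in> N (e + 1)" for l
  proof (cases "l \<ge> 0")
    case True
    have "(\<Sum>k<n. X k (u (l + int k))) = (\<Sum>k<n. \<Sum>s\<in>S. scale (c s * s ^ (nat l)) (scale (s ^ k) (X k (z s))))"
      using True by (intro sum.cong) (auto simp: u_def nat_add_distrib power_add mult.assoc)
    also have "\<dots> = (\<Sum>s\<in>S. scale (c s * s ^ nat l) (Y s (z s)))"
      by (subst sum.swap) (simp add: Y_def scale_sum_right)
    also have "\<dots> \<in> N (e + 1)" by (rule gsub_simps(6)[OF N], rule gsub_simps(5)[OF N], rule z)
    finally show ?thesis .
  next
    case False
    define m where "m = nat (- l)"
    have m: "l = - int m" using False by (simp add: m_def)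
    have "(\<Sum>k<n. X k (u (l + int k))) = (\<Sum>k\<in>{m..<n}. X k (u (l + int k)))"
      by (rule sum.mono_neutral_right) (auto simp: u_def m)
    also have "\<dots> = (\<Sum>k\<in>{m..<n}. \<Sum>s\<in>S. scale (c s) (scale (s ^ (k - m)) (X k (z s))))"
    proof (rule sum.cong)
      fix k assume k: "k \<in> {m..<n}"
      then have "nat (l + int k) = k - m" "\<not> l + int k < 0" by (auto simp: m)
      then show "X k (u (l + int k)) = (\<Sum>s\<in>S. scale (c s) (scale (s ^ (k - m)) (X k (z s))))"
        by (simp add: u_def)
    qed simp
    also have "\<dots> = (\<Sum>s\<in>S. scale (c s) (w s m))"
      by (subst sum.swap) (simp add: w_def scale_sum_right)
    also have "\<dots> = 0"
    proof (cases "m < n")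
      case False
      then show ?thesis by (simp add: w_def)
    qed (use c2 in simp)
    finally show ?thesis using gsub_simps(1)[OF N] by simp
  qed
  define p where "p = (\<Prod>t\<in>S. [:- t, 1:])"
  have degp: "degree p = M" and lead: "coeff p M = 1"
  proof -
    show 1: "degree p = M" unfolding p_def M_def by (subst degree_prod_eq_sum_degree) auto
    have "lead_coeff p = 1" unfolding p_def lead_coeff_prod by simp
    then show "coeff p M = 1" using 1 by simp
  qed
  \<comment> \<open>Multiplying the power series \<open>u\<close> by the reversed polynomial \<open>p\<close> makes it a polynomial.\<close>
  define \<zeta> where "\<zeta> q = (\<Sum>r\<le>M. scale (coeff p (M - r)) (u (q - int r)))" for q
  have \<zeta>G: "\<zeta> q \<in> G e" for q unfolding \<zeta>_def by (intro G_simps uG)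
  have \<zeta>rel: "(\<Sum>k<n. X k (\<zeta> (l + int k))) \<in> N (e + 1)" for l
  proof -
    have "(\<Sum>k<n. X k (\<zeta> (l + int k)))
      = (\<Sum>k<n. \<Sum>r\<le>M. scale (coeff p (M - r)) (X k (u ((l - int r) + int k))))"
      by (simp add: \<zeta>_def algebra_simps)
    also have "\<dots> = (\<Sum>r\<le>M. scale (coeff p (M - r)) (\<Sum>k<n. X k (u ((l - int r) + int k))))"
      by (subst sum.swap) (simp add: scale_sum_right)
    also have "\<dots> \<in> N (e + 1)" by (rule gsub_simps(6)[OF N], rule gsub_simps(5)[OF N], rule rel)
    finally show ?thesis .
  qed
  have \<zeta>fin: "finite {q. \<zeta> q \<notin> N e}"
  proof (rule finite_subset)
    show "{q. \<zeta> q \<notin> N e} \<subseteq> {0..<int M}"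
    proof
      fix q assume q: "q \<in> {q. \<zeta> q \<notin> N e}"
      have "\<zeta> q = 0" if "q < 0" using that by (simp add: \<zeta>_def u_def)
      \<comment> \<open>From index \<open>M\<close> on, the recurrence with characteristic
        polynomial \<open>p\<close> annihilates every geometric sequence \<open>s ^ q\<close> with
        \<open>s \<in> S\<close>.\<close>
      moreover have "\<zeta> q = 0" if "q \<ge> int M"
      proof -
        have "\<zeta> q = (\<Sum>r\<le>M. \<Sum>s\<in>S. scale (c s * s ^ (nat q - M)) (scale (coeff p (M - r) * s ^ (M - r)) (z s)))"
          unfolding \<zeta>_def
        proof (rule sum.cong)
          fix r assume r: "r \<in> {..M}"
          have e: "nat (q - int r) = (nat q - M) + (M - r)" and nneg: "\<not> q - int r < 0"
            using r that by auto
          show "scale (coeff p (M - r)) (u (q - int r))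
            = (\<Sum>s\<in>S. scale (c s * s ^ (nat q - M)) (scale (coeff p (M - r) * s ^ (M - r)) (z s)))"
            by (simp only: u_def nneg if_False e scale_sum_right scale_scale power_add mult_ac)
        qed simp
        also have "\<dots> = (\<Sum>s\<in>S. scale (c s * s ^ (nat q - M)) (scale (\<Sum>r\<le>M. coeff p (M - r) * s ^ (M - r)) (z s)))"
          by (subst sum.swap) (simp only: scale_sum_right scale_sum_left)
        also have "\<dots> = 0"
        proof (rule sum.neutral, rule ballI)
          fix s assume s: "s \<in> S"
          have "(\<Sum>r\<le>M. coeff p (M - r) * s ^ (M - r)) = (\<Sum>r\<le>M. coeff p r * s ^ r)"
            by (rule sum.reindex_bij_witness[of _ "\<lambda>r. M - r" "\<lambda>r. M - r"]) auto
          also have "\<dots> = poly p s" by (simp add: poly_altdef degp)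
          also have "\<dots> = 0" unfolding p_def poly_prod using S(1) s by (intro prod_zero) auto
          finally show "scale (c s * s ^ (nat q - M))
            (scale (\<Sum>r\<le>M. coeff p (M - r) * s ^ (M - r)) (z s)) = 0" by simp
        qed
        finally show ?thesis .
      qed
      moreover have "\<zeta> q \<noteq> 0" using q gsub_simps(1)[OF N, of e] by auto
      ultimately show "q \<in> {0..<int M}" by (meson atLeastLessThan_iff not_le)
    qed
  qed simp
  have \<zeta>N: "\<zeta> q \<in> N e" for q
    by (rule reg_pencil_kernel[of N e \<zeta>, OF N reg e \<zeta>G \<zeta>fin \<zeta>rel])
  \<comment> \<open>Since \<open>p\<close> is monic, \<open>u\<close> is recovered from
    \<open>\<zeta>\<close> by recursion.\<close>
  have uN: "u (int q) \<in> N e" for q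
  proof (induction q rule: less_induct)
    case (less q)
    have "\<zeta> (int q) = scale (coeff p (M - 0)) (u (int q - int 0))
      + (\<Sum>r\<in>{..M} - {0}. scale (coeff p (M - r)) (u (int q - int r)))"
      unfolding \<zeta>_def by (rule sum.remove) auto
    then have uq: "u (int q) = \<zeta> (int q) - (\<Sum>r\<in>{..M} - {0}. scale (coeff p (M - r)) (u (int q - int r)))"
      using lead by simp
    have ur: "u (int q - int r) \<in> N e" if r: "r \<in> {..M} - {0}" for r
    proof (cases "r \<le> q")
      case True
      have "u (int (q - r)) \<in> N e" by (rule less.IH) (use r True in auto)
      then show ?thesis by (simp only: of_nat_diff[OF True])
    next
      case False
      then have "u (int q - int r) = 0" by (simp add: u_def)
      then show ?thesis by (simp only: gsub_simps(1)[OF N])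
    qed
    have "(\<Sum>r\<in>{..M} - {0}. scale (coeff p (M - r)) (u (int q - int r))) \<in> N e"
      by (rule gsub_simps(6)[OF N], rule gsub_simps(5)[OF N], rule ur)
    then show ?case unfolding uq by (rule gsub_simps(3)[OF N \<zeta>N])
  qed
  \<comment> \<open>The power sums lie in \<open>N\<close>, so Vandermonde puts each
    \<open>c s\<close> multiple of \<open>z s\<close> into \<open>N\<close>. As \<open>z s\<close>
    lies outside, every \<open>c s\<close> is zero, contrary to the choice of
    \<open>c\<close>.\<close>
  have "(\<Sum>s\<in>S. scale (s ^ i) (scale (c s) (z s))) \<in> N e" for i
    using uN[of i] by (simp add: u_def mult.commute)
  then have czN: "scale (c s) (z s) \<in> N e" if "s \<in> S" for s
    by (rule vandermonde[OF S(1) order_refl gsub_subspace[OF N] _ that])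
  have "c s = 0" if "s \<in> S" for s
  proof (rule ccontr)
    assume "c s \<noteq> 0"
    have "scale (inverse (c s)) (scale (c s) (z s)) \<in> N e"
      by (rule gsub_simps(5)[OF N czN[OF that]])
    then have "z s \<in> N e" using \<open>c s \<noteq> 0\<close> by simp
    then show False using z(2)[OF that] by blast
  qed
  then show False using c by blast
qed

end

section \<open>Hyperplane sections stay regular\<close>

context gops
begin

text \<open>For a cycle \<open>f\<close> modulo \<open>N'\<close> with \<open>p > 0\<close> write
  \<open>kd X n f = \<nu> + Y s u\<close>. Applying the differential again, injectivity of
  \<open>Y s\<close> in degrees at least 2 makes \<open>u\<close> a cycle modulo \<open>N\<close>
  with indices \<open>p - 1\<close> and \<open>j - 1\<close>. By regularity \<open>u\<close> is the
  boundary of some \<open>w\<close> modulo \<open>N\<close>; then \<open>f - Y s w\<close> is a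
  cycle modulo \<open>N\<close>, hence a boundary.\<close>

lemma reg_hyperplane:
  assumes N: "gsub N" and reg: "reg N"
    and inj: "\<And>e z. e \<ge> 2 \<Longrightarrow> z \<in> G e \<Longrightarrow> Y s z \<in> N (e + 1) \<Longrightarrow> z \<in> N e"
    and N'_def: "\<And>e. N' e = {a + Y s u | a u. a \<in> N e \<and> u \<in> G (e - 1)}"
  shows "gsub N'" "reg N'"
proof -
  interpret vp: vspace_pair scale scale ..
  have N'I: "a + Y s u \<in> N' e" if "a \<in> N e" "u \<in> G (e - 1)" for a u e
    using that unfolding N'_def by blast
  have NN': "a \<in> N' e" if "a \<in> N e" for a e using N'I[OF that, of 0] by simp
  have YN': "Y s u \<in> N' e" if "u \<in> G (e - 1)" for u e using N'I[OF gsub_simps(1)[OF N] that] by simp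
  show gsN: "gsub N'"
    unfolding gsub_def
  proof (intro conjI allI impI subsetI)
    show "subspace (N' e)" for e
      unfolding N'_def using vp.dim_sum_image(1)[OF Y_linear gsub_fin[OF N] G_fin] by (rule fin_subspaceD)
    show "x \<in> G e" if "x \<in> N' e" for x e
    proof -
      from that obtain a u where x: "x = a + Y s u" "a \<in> N e" "u \<in> G (e - 1)" unfolding N'_def by blast
      then show ?thesis using gsub_simps(8)[OF N x(2)] Y_G[OF x(3), of s] by simp
    qed
    show "X i x \<in> N' (e + 1)" if "i < n" "x \<in> N' e" for i x e
    proof -
      from that obtain a u where x: "x = a + Y s u" "a \<in> N e" "u \<in> G (e - 1)" unfolding N'_def by blast
      then show ?thesis
        using N'I[of "X i a" "e + 1" "X i u"] gsub_simps(7)[OF N \<open>i < n\<close> x(2)] X_G[OF \<open>i < n\<close> x(3)]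
        by (simp add: Y_X)
    qed
  qed
  show "reg N'"
    unfolding reg_def
  proof (intro allI impI subsetI)
    fix p j f assume j: "int p + 2 \<le> j" and f: "f \<in> cyc N' p j"
    let ?e = "j - int p"
    have fG: "f \<in> chains n p (G ?e)" and df: "kd X n f \<in> chains n (p - 1) (N' (?e + 1))"
      using f by (auto simp: cyc_def)
    have conv: "h \<in> bnd N' p j" if hb: "h \<in> bnd N p j" for h
    proof -
      obtain g where g: "h \<in> chains n p (G ?e)" "g \<in> chains n (p + 1) (G (?e - 1))"
        "h - kd X n g \<in> chains n p (N ?e)" using bndE[OF hb] by blast
      have "h - kd X n g \<in> chains n p (N' ?e)" by (rule chains_mono[OF g(3)]) (use NN' in blast)
      then show ?thesis by (rule bndI[OF g(1,2)])
    qed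
    show "f \<in> bnd N' p j"
    proof (cases "p = 0")
      \<comment> \<open>For \<open>p = 0\<close> every chain is a cycle modulo \<open>N\<close> as
        well; the main argument needs genuine \<open>(p - 1)\<close>-chains.\<close>
      case True
      then have "kd X n f = 0" using kd_chain_zero[of f n "G ?e" X] fG by simp
      then have "f \<in> cyc N p j"
        using fG chains_zero[OF gsub_simps(1)[OF N], of n "p - 1" "?e + 1"] by (simp add: cyc_def)
      then show ?thesis using regD[OF reg j] conv by blast
    next
      case False
      \<comment> \<open>Lifting to a chain of pairs selects both summands at once and keeps each of
        them a chain.\<close>
      have "\<exists>u\<in>chains n (p - 1) (N (?e + 1) \<times> G ?e). (\<lambda>T. (\<lambda>z. fst z + Y s (snd z)) (u T)) = kd X n f"
      proof (rule chains_lift[OF df])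
        fix x assume "x \<in> N' (?e + 1)"
        then obtain a u where "x = a + Y s u" "a \<in> N (?e + 1)" "u \<in> G ?e" unfolding N'_def by auto
        then show "\<exists>y\<in>N (?e + 1) \<times> G ?e. fst y + Y s (snd y) = x" by force
      qed simp
      then obtain y where y: "y \<in> chains n (p - 1) (N (?e + 1) \<times> G ?e)"
        and dfy: "kd X n f = (\<lambda>T. fst (y T) + Y s (snd (y T)))" by auto
      define \<nu> where "\<nu> T = fst (y T)" for T
      define u where "u T = snd (y T)" for T
      have \<nu>: "\<nu> \<in> chains n (p - 1) (N (?e + 1))" unfolding \<nu>_def by (rule chains_map[OF y]) auto
      have u: "u \<in> chains n (p - 1) (G ?e)" unfolding u_def by (rule chains_map[OF y]) auto
      have dY: "kd X n (\<lambda>T. Y s (h T)) = (\<lambda>T. Y s (kd X n h T))" for h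
        by (rule kd_map) (simp_all add: Y_X)
      have dfe: "kd X n f = \<nu> + (\<lambda>T. Y s (u T))" unfolding dfy by (simp add: fun_eq_iff \<nu>_def u_def)
      have 0: "kd X n \<nu> + (\<lambda>T. Y s (kd X n u T)) = 0"
        using dd[of f] unfolding dfe by (simp only: kd_simps dY)
      have "kd X n \<nu> T + Y s (kd X n u T) = 0" for T
        using fun_cong[OF 0, of T] by simp
      then have Ydu: "Y s (kd X n u T) = - kd X n \<nu> T" for T
        by (simp add: eq_neg_iff_add_eq_0 add.commute)
      have d\<nu>: "kd X n \<nu> \<in> chains n (p - 1 - 1) (N (?e + 1 + 1))" by (rule kd_in_N[OF N \<nu>])
      have du: "kd X n u \<in> chains n (p - 1 - 1) (G (?e + 1))" by (rule kd_in_G[OF u])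
      have "kd X n u \<in> chains n (p - 1 - 1) (N (?e + 1))"
      proof (rule chains_cong_in[OF du])
        fix T
        have "Y s (kd X n u T) \<in> N (?e + 1 + 1)"
          unfolding Ydu by (intro gsub_simps(4)[OF N] chains_in[OF d\<nu>] gsub_simps(1)[OF N])
        moreover have "?e + 1 \<ge> 2" using j by simp
        ultimately show "kd X n u T \<in> N (?e + 1)"
          by (intro inj[of "?e + 1", OF _ chains_in[OF du G_simps(1)]])
      qed
      then have "u \<in> cyc N (p - 1) (j - 1)"
        using u False by (simp add: cyc_def of_nat_diff)
      then have "u \<in> bnd N (p - 1) (j - 1)" using j False by (intro regD[OF reg]) (simp_all add: of_nat_diff)
      then obtain w where w: "w \<in> chains n p (G (?e - 1))" "u - kd X n w \<in> chains n (p - 1) (N ?e)"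
        using False by (elim bndE) (simp add: of_nat_diff)
      define h where "h = f - (\<lambda>T. Y s (w T))"
      have Yw: "(\<lambda>T. Y s (w T)) \<in> chains n p (G ?e)"
        by (rule chains_map[OF w(1)]) (use Y_G[of _ "?e - 1"] in auto)
      have hG: "h \<in> chains n p (G ?e)"
        unfolding h_def by (rule fs.subspace_diff[OF chains_subspace[OF G_sub] fG Yw])
      have "kd X n h = \<nu> + (\<lambda>T. Y s ((u - kd X n w) T))"
        unfolding h_def kd_simps dfe dY by (simp add: fun_eq_iff)
      also have "\<dots> \<in> chains n (p - 1) (N (?e + 1))"
        by (intro fs.subspace_add[OF chains_subspace[OF gsub_subspace[OF N]]] \<nu> chains_map[OF w(2)])
          (auto intro: gsub_simps(9)[OF N])
      finally have "h \<in> cyc N p j" using hG by (simp add: cyc_def)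
      then have "h \<in> bnd N' p j" using regD[OF reg j] conv by blast
      then obtain g where g: "g \<in> chains n (p + 1) (G (?e - 1))" "h - kd X n g \<in> chains n p (N' ?e)"
        by (rule bndE)
      have e: "f - kd X n g = (h - kd X n g) + (\<lambda>T. Y s (w T))" by (simp add: h_def)
      have "(\<lambda>T. Y s (w T)) \<in> chains n p (N' ?e)"
        by (rule chains_map[OF w(1)]) (auto intro: YN')
      then have "f - kd X n g \<in> chains n p (N' ?e)"
        unfolding e by (intro fs.subspace_add[OF chains_subspace[OF gsub_subspace[OF gsN]]] g)
      then show ?thesis by (rule bndI[where g = g, OF fG g(1)])
    qed
  qed
qed

end

text \<open>The properties of a module with 2-linear resolution that the section argument uses, over
  a field large enough to avoid countably many parameters.\<close>

locale generic_ops = gops scale X n G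
  for scale :: "'f::field \<Rightarrow> 'a::ab_group_add \<Rightarrow> 'a" and X :: "nat \<Rightarrow> 'a \<Rightarrow> 'a" and n G +
  assumes G_neg: "e < 0 \<Longrightarrow> G e = {0}"
    and G_gen: "e \<ge> 0 \<Longrightarrow> z \<in> G (e + 1) \<Longrightarrow> \<exists>u. (\<forall>i<n. u i \<in> G e) \<and> z = (\<Sum>i<n. X i (u i))"
    and no_linear: "(\<And>i. i < n \<Longrightarrow> w i \<in> G 0) \<Longrightarrow> (\<Sum>i<n. X i (w i)) = 0 \<Longrightarrow> i < n \<Longrightarrow> w i = 0"
    and reg_zero: "reg (\<lambda>_. {0})"
    and uncountable_field: "uncountable (UNIV :: 'f set)"
begin

text \<open>The submodule generated by the linear forms with parameters in \<open>S\<close>, in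
  degree \<open>e\<close>; \<open>G\<close> modulo \<open>NS S\<close> is the section.\<close>

definition NS :: "'f set \<Rightarrow> int \<Rightarrow> 'a set" where
  "NS S e = {z. \<exists>u. (\<forall>s\<in>S. u s \<in> G (e - 1)) \<and> z = (\<Sum>s\<in>S. Y s (u s))}"

lemma NS_empty: "NS {} = (\<lambda>_. {0})"
  by (simp add: NS_def fun_eq_iff)

lemma NS_insert:
  assumes "finite S" "s \<notin> S"
  shows "NS (insert s S) e = {a + Y s u | a u. a \<in> NS S e \<and> u \<in> G (e - 1)}"
proof (intro Set.set_eqI iffI)
  fix z assume "z \<in> NS (insert s S) e"
  then obtain u where u: "\<forall>t\<in>insert s S. u t \<in> G (e - 1)" "z = (\<Sum>t\<in>insert s S. Y t (u t))"
    unfolding NS_def by blast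
  have "(\<Sum>t\<in>S. Y t (u t)) \<in> NS S e" unfolding NS_def using u(1) by blast
  moreover have "z = (\<Sum>t\<in>S. Y t (u t)) + Y s (u s)" unfolding u(2) using assms by (simp add: add.commute)
  ultimately show "z \<in> {a + Y s u | a u. a \<in> NS S e \<and> u \<in> G (e - 1)}" using u(1) by blast
next
  fix z assume "z \<in> {a + Y s u | a u. a \<in> NS S e \<and> u \<in> G (e - 1)}"
  then obtain u v where u: "\<forall>t\<in>S. u t \<in> G (e - 1)" "v \<in> G (e - 1)" "z = (\<Sum>t\<in>S. Y t (u t)) + Y s v"
    unfolding NS_def by blast
  have "(\<Sum>t\<in>S. Y t ((u(s := v)) t)) = (\<Sum>t\<in>S. Y t (u t))"
    by (rule sum.cong) (use assms in auto)
  then have "z = (\<Sum>t\<in>insert s S. Y t ((u(s := v)) t))"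
    unfolding u(3) using assms by (simp add: add.commute)
  moreover have "\<forall>t\<in>insert s S. (u(s := v)) t \<in> G (e - 1)" using u by simp
  ultimately show "z \<in> NS (insert s S) e" unfolding NS_def by blast
qed

lemma NS_nonpos: "e \<le> 0 \<Longrightarrow> NS S e = {0}"
proof -
  assume "e \<le> 0"
  then have G: "G (e - 1) = {0}" using G_neg by simp
  have "(\<Sum>s\<in>S. Y s (u s)) = 0" if "\<forall>s\<in>S. u s \<in> G (e - 1)" for u
    using that G by (intro sum.neutral) simp
  then have "NS S e \<subseteq> {0}" unfolding NS_def by auto
  moreover have "0 \<in> NS S e" unfolding NS_def by (intro CollectI exI[of _ "\<lambda>_. 0"]) simp
  ultimately show ?thesis by blast
qed

text \<open>Expanding \<open>Y\<close> turns the relation into one between the \<open>X i\<close>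
  with coefficients \<open>\<Sum>s\<in>S. s ^ i w s\<close>. These vanish by
  \<open>no_linear\<close>, and Vandermonde recovers each \<open>w s\<close>.\<close>

lemma Y_independent:
  assumes S: "finite S" "card S \<le> n" and w: "\<And>s. s \<in> S \<Longrightarrow> w s \<in> G 0"
    and sum: "(\<Sum>s\<in>S. Y s (w s)) = 0" and s: "s \<in> S"
  shows "w s = 0"
proof -
  have "(\<Sum>i<n. X i (\<Sum>s\<in>S. scale (s ^ i) (w s))) = (\<Sum>s\<in>S. Y s (w s))"
    unfolding Y_def by (subst sum.swap) simp
  then have 0: "(\<Sum>i<n. X i (\<Sum>s\<in>S. scale (s ^ i) (w s))) = 0" using sum by simp
  have "(\<Sum>s\<in>S. scale (s ^ i) (w s)) = 0" if "i < n" for i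
    by (rule no_linear[OF _ 0 that]) (intro G_simps(6) G_simps(5) w)
  then have "w s \<in> {0}"
    using vandermonde[OF S subspace_single_0 _ s, of w] by simp
  then show ?thesis by simp
qed

lemma sum_Y_linear: "Vector_Spaces.linear (fun_scale scale) scale (\<lambda>u. \<Sum>s\<in>S. Y s (u s))"
  by unfold_locales (simp_all add: fun_scale_def sum.distrib scale_sum_right)

lemma sum_X_linear: "Vector_Spaces.linear (fun_scale scale) scale (\<lambda>u. \<Sum>i<n. X i (u i))"
  by unfold_locales (simp_all add: fun_scale_def sum.distrib scale_sum_right)

text \<open>Both sides are injective images of \<open>n\<close> copies of \<open>G 0\<close>, by
  \<open>Y_independent\<close> and by \<open>no_linear\<close> respectively, so the inclusion is an
  equality for dimension reasons.\<close>

lemma NS_full_1: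
  assumes S: "finite S" "card S = n" and sub: "subspace (NS S 1)" "NS S 1 \<subseteq> G 1"
  shows "NS S 1 = G 1"
proof -
  interpret fp: vspace_pair "fun_scale scale :: 'f \<Rightarrow> ('f \<Rightarrow> 'a) \<Rightarrow> 'f \<Rightarrow> 'a" scale ..
  interpret fp': vspace_pair "fun_scale scale :: 'f \<Rightarrow> (nat \<Rightarrow> 'a) \<Rightarrow> nat \<Rightarrow> 'a" scale ..
  have "dim ((\<lambda>u. \<Sum>s\<in>S. Y s (u s)) ` fun_on S (G 0)) = vector_space.dim (fun_scale scale) (fun_on S (G 0))"
  proof (rule fp.dim_image_inj[OF sum_Y_linear fun_on_fin_subspace[OF S(1) G_fin]])
    fix v assume v: "v \<in> fun_on S (G 0)" "(\<Sum>s\<in>S. Y s (v s)) = 0"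
    have "v s = 0" for s
      using Y_independent[OF S(1) _ fun_on_in[OF v(1)] v(2)] S(2) fun_on_out[OF v(1)] by (cases "s \<in> S") simp_all
    then show "v = 0" by (simp add: fun_eq_iff)
  qed
  also have "(\<lambda>u. \<Sum>s\<in>S. Y s (u s)) ` fun_on S (G 0) = NS S 1"
  proof (intro Set.set_eqI iffI)
    fix z assume "z \<in> NS S 1"
    then obtain u where u: "\<forall>s\<in>S. u s \<in> G 0" "z = (\<Sum>s\<in>S. Y s (u s))" unfolding NS_def by auto
    have "(\<lambda>s. if s \<in> S then u s else 0) \<in> fun_on S (G 0)" by (rule fun_onI) (use u in auto)
    moreover have "z = (\<Sum>s\<in>S. Y s ((\<lambda>s. if s \<in> S then u s else 0) s))" unfolding u(2) by (rule sum.cong) auto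
    ultimately show "z \<in> (\<lambda>u. \<Sum>s\<in>S. Y s (u s)) ` fun_on S (G 0)"
      by (intro image_eqI[of _ _ "\<lambda>s. if s \<in> S then u s else 0"])
  next
    fix z assume "z \<in> (\<lambda>u. \<Sum>s\<in>S. Y s (u s)) ` fun_on S (G 0)"
    then obtain u where "u \<in> fun_on S (G 0)" "z = (\<Sum>s\<in>S. Y s (u s))" by blast
    then show "z \<in> NS S 1" unfolding NS_def using fun_on_in[of u S "G 0"] by auto
  qed
  also have "vector_space.dim (fun_scale scale) (fun_on S (G 0)) = n * dim (G 0)" using dim_fun_on[OF S(1) G_fin] S(2) by simp
  finally have 1: "dim (NS S 1) = n * dim (G 0)" .
  have "dim ((\<lambda>u. \<Sum>i<n. X i (u i)) ` fun_on {..<n} (G 0)) = vector_space.dim (fun_scale scale) (fun_on {..<n} (G 0))"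
  proof (rule fp'.dim_image_inj[OF sum_X_linear fun_on_fin_subspace[OF finite_lessThan G_fin]])
    fix v assume v: "v \<in> fun_on {..<n} (G 0)" "(\<Sum>i<n. X i (v i)) = 0"
    have "v i = 0" for i
    proof (cases "i < n")
      case True
      show ?thesis by (rule no_linear[OF _ v(2) True]) (rule fun_on_in[OF v(1)], simp)
    next
      case False then show ?thesis by (intro fun_on_out[OF v(1)]) simp
    qed
    then show "v = 0" by (simp add: fun_eq_iff)
  qed
  also have "(\<lambda>u. \<Sum>i<n. X i (u i)) ` fun_on {..<n} (G 0) = G 1"
  proof (intro Set.set_eqI iffI)
    fix z assume "z \<in> G 1"
    then obtain u where u: "\<forall>i<n. u i \<in> G 0" "z = (\<Sum>i<n. X i (u i))" using G_gen[of 0 z] by auto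
    have "(\<lambda>i. if i \<in> {..<n} then u i else 0) \<in> fun_on {..<n} (G 0)" by (rule fun_onI) (use u in auto)
    moreover have "z = (\<Sum>i<n. X i ((\<lambda>i. if i \<in> {..<n} then u i else 0) i))" unfolding u(2) by (rule sum.cong) auto
    ultimately show "z \<in> (\<lambda>u. \<Sum>i<n. X i (u i)) ` fun_on {..<n} (G 0)"
      by (intro image_eqI[of _ _ "\<lambda>i. if i \<in> {..<n} then u i else 0"])
  next
    fix z assume "z \<in> (\<lambda>u. \<Sum>i<n. X i (u i)) ` fun_on {..<n} (G 0)"
    then obtain u where u: "u \<in> fun_on {..<n} (G 0)" "z = (\<Sum>i<n. X i (u i))" by blast
    have "X i (u i) \<in> G 1" if "i < n" for i
      using X_G[OF that, of "u i" 0] fun_on_in[OF u(1), of i] that by simp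
    then show "z \<in> G 1" unfolding u(2) by (intro G_simps(6)) simp
  qed
  also have "vector_space.dim (fun_scale scale) (fun_on {..<n} (G 0)) = n * dim (G 0)" using dim_fun_on[OF finite_lessThan G_fin] by simp
  finally have "dim (G 1) = n * dim (G 0)" .
  then show ?thesis using dim_eq_fin[OF G_fin sub] 1 by simp
qed

lemma NS_full:
  assumes S: "finite S" "card S = n" and N: "gsub (NS S)" and e: "e \<ge> 1"
  shows "NS S e = G e"
  using e
proof (induction e rule: int_ge_induct)
  case base
  show ?case by (rule NS_full_1[OF S gsub_subspace[OF N]]) (use gsub_simps(8)[OF N] in blast)
next
  case (step e)
  have "z \<in> NS S (e + 1)" if z: "z \<in> G (e + 1)" for z
  proof -
    obtain u where u: "\<forall>i<n. u i \<in> G e" "z = (\<Sum>i<n. X i (u i))" using G_gen[OF _ z] step(1) by auto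
    show ?thesis unfolding u(2)
      by (rule gsub_simps(6)[OF N], rule gsub_simps(7)[OF N]) (use u(1) step(2) in auto)
  qed
  then show ?case using gsub_simps(8)[OF N] by blast
qed

text \<open>The preimage in \<open>G 1\<close> of the degree 1 socle of the quotient; it contains
  \<open>NS S 1\<close>, which \<open>alpha\<close> subtracts.\<close>

definition socle :: "'f set \<Rightarrow> 'a set" where
  "socle S = {z \<in> G 1. \<forall>i<n. X i z \<in> NS S 2}"

text \<open>The overview's \<open>b l\<close> for \<open>l = n - card S - 1\<close>.\<close>

definition alpha :: "'f set \<Rightarrow> int" where
  "alpha S = int (dim (socle S)) - int (dim (NS S 1))"

definition hilb :: "'f set \<Rightarrow> int \<Rightarrow> int" where
  "hilb S e = int (dim (G e)) - int (dim (NS S e))"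

text \<open>Degrees below 2 are left out: in degree 1 the kernel of a good form is the whole socle,
  which need not vanish, and in degree 0 injectivity already follows from
  \<open>Y_independent\<close>.\<close>

definition nonzerodivisor :: "'f set \<Rightarrow> 'f \<Rightarrow> bool" where
  "nonzerodivisor S s \<longleftrightarrow> (\<forall>e\<ge>2. \<forall>z\<in>G e. Y s z \<in> NS S (e + 1) \<longrightarrow> z \<in> NS S e)"

lemma socle_subspace:
  assumes N: "gsub (NS S)"
  shows "subspace (socle S)" "NS S 1 \<subseteq> socle S" "socle S \<subseteq> G 1"
proof -
  show "subspace (socle S)"
    unfolding subspace_def socle_def using gsub_simps(1,2,5)[OF N] by simp
  show "NS S 1 \<subseteq> socle S"
    unfolding socle_def using gsub_simps(8)[OF N, of _ 1] gsub_simps(7)[OF N, of _ _ 1] by auto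
qed (auto simp: socle_def)

lemma alpha_nonneg: "gsub (NS S) \<Longrightarrow> alpha S \<ge> 0"
  unfolding alpha_def
  using dim_mono_fin[OF fin_subspace_mono[OF G_fin, of "socle S" 1], of "NS S 1"]
    socle_subspace[of S] gsub_subspace[of "NS S" 1] by simp

text \<open>In degree 1, if \<open>Y s\<close> kills \<open>z\<close> in the quotient, it kills
  \<open>X i z\<close>, which has degree 2 where \<open>Y s\<close> is injective; so
  \<open>z\<close> is in the socle. In degree 0 the forms of \<open>insert s S\<close> are
  independent over \<open>G 0\<close>, since there are at most \<open>n\<close> of them.\<close>

lemma kernel:
  assumes S: "finite S" "s \<notin> S" "card S < n" and N: "gsub (NS S)" and s: "nonzerodivisor S s"
  shows "{u \<in> G (e - 1). Y s u \<in> NS S e} = (if e = 2 then socle S else NS S (e - 1))"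
proof -
  have YN: "Y s u \<in> NS S e" if "u \<in> NS S (e - 1)" for u e
    using gsub_simps(9)[OF N that, of s] by simp
  have *: "u \<in> NS S (e - 1)" if "e \<ge> 3" "u \<in> G (e - 1)" "Y s u \<in> NS S e" for u e
    using s that unfolding nonzerodivisor_def by (elim allE[of _ "e - 1"]) simp
  consider "e \<ge> 3" | "e = 2" | "e = 1" | "e \<le> 0" by linarith
  then show ?thesis
  proof cases
    case 1
    then show ?thesis using * YN gsub_simps(8)[OF N, of _ "e - 1"] by auto
  next
    case 2
    have "X i z \<in> NS S 2" if "z \<in> G 1" "Y s z \<in> NS S 2" "i < n" for z i
    proof -
      have "X i z \<in> G 2" using X_G[OF that(3,1)] by simp
      moreover have "Y s (X i z) \<in> NS S 3" using gsub_simps(7)[OF N that(3,2)] by (simp add: Y_X)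
      ultimately show ?thesis using *[of 3 "X i z"] by simp
    qed
    moreover have "Y s z \<in> NS S 2" if "\<forall>i<n. X i z \<in> NS S 2" for z
      unfolding Y_def by (rule gsub_simps(6)[OF N], rule gsub_simps(5)[OF N]) (use that in auto)
    ultimately show ?thesis using 2 unfolding socle_def by auto
  next
    case 3
    have "u = 0" if u: "u \<in> G 0" "Y s u \<in> NS S 1" for u
    proof -
      obtain w where w: "\<forall>t\<in>S. w t \<in> G 0" "Y s u = (\<Sum>t\<in>S. Y t (w t))" using u(2) unfolding NS_def by auto
      define v where "v t = (if t = s then u else - w t)" for t
      have "(\<Sum>t\<in>S. Y t (v t)) = (\<Sum>t\<in>S. - Y t (w t))"
        by (rule sum.cong) (use S in \<open>auto simp: v_def\<close>)
      then have "(\<Sum>t\<in>insert s S. Y t (v t)) = 0"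
        using S w(2) by (simp add: v_def sum_negf)
      moreover have "finite (insert s S)" "card (insert s S) \<le> n" using S by simp_all
      moreover have "v t \<in> G 0" if "t \<in> insert s S" for t using that w(1) u(1) by (auto simp: v_def)
      ultimately have "v s = 0" using Y_independent[of "insert s S" v s] by blast
      then show "u = 0" by (simp add: v_def)
    qed
    then show ?thesis using 3 NS_nonpos[of 0 S] gsub_simps(1)[OF N, of 1] by auto
  next
    case 4
    then show ?thesis using NS_nonpos[of "e - 1" S] G_neg[of "e - 1"] gsub_simps(1)[OF N, of e] by auto
  qed
qed

text \<open>Dimension count for multiplication by \<open>Y s\<close> from degree
  \<open>e - 1\<close> to \<open>e\<close>. On the quotient its only kernel is the socle in degree
  1, whence the correction at \<open>e = 2\<close>.\<close>

lemma hilb_insert: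
  assumes S: "finite S" "s \<notin> S" "card S < n" and N: "gsub (NS S)" and s: "nonzerodivisor S s"
  shows "hilb (insert s S) e = hilb S e - hilb S (e - 1) + (if e = 2 then alpha S else 0)"
proof -
  interpret vp: vspace_pair scale scale ..
  have "dim (NS (insert s S) e) + dim {u \<in> G (e - 1). Y s u \<in> NS S e} = dim (NS S e) + dim (G (e - 1))"
    unfolding NS_insert[OF S(1,2)] by (rule vp.dim_sum_image(2)[OF Y_linear gsub_fin[OF N] G_fin])
  then show ?thesis unfolding hilb_def alpha_def kernel[OF S N s] by (auto split: if_splits)
qed

text \<open>The images of the spaces \<open>?W s\<close> under \<open>Y s\<close> lie in the socle
  and are independent modulo \<open>NS S 1\<close>, because at most \<open>n\<close> linear forms
  occur in total.\<close>

lemma socle_generic_bound: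
  assumes S: "finite S" and T: "finite T" "S \<inter> T = {}" "card S + card T \<le> n" and N: "gsub (NS S)"
  shows "(\<Sum>s\<in>T. int (dim {u \<in> G 0. Y s u \<in> socle S})) \<le> alpha S"
proof -
  interpret vp: vspace_pair scale scale ..
  let ?W = "\<lambda>s. {u \<in> G 0. Y s u \<in> socle S}"
  have sub: "subspace (socle S)" and NA: "NS S 1 \<subseteq> socle S" and AG: "socle S \<subseteq> G 1"
    using socle_subspace[OF N] .
  have W: "fin_subspace (?W s)" for s
  proof (rule fin_subspace_mono[OF G_fin])
    show "subspace (?W s)"
      using sub G_sub[of 0] unfolding subspace_def by simp
  qed auto
  define V where "V T = {a + (\<Sum>s\<in>T. Y s (u s)) | a u. a \<in> NS S 1 \<and> (\<forall>s\<in>T. u s \<in> ?W s)}" for T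
  have "T' \<subseteq> T \<Longrightarrow> fin_subspace (V T') \<and>
    int (dim (V T')) = int (dim (NS S 1)) + (\<Sum>s\<in>T'. int (dim (?W s)))" if "finite T'" for T'
    using that
  proof (induction T' rule: finite_induct)
    case empty
    have "V {} = NS S 1" by (simp add: V_def)
    then show ?case using gsub_fin[OF N] by simp
  next
    case (insert s T')
    then have IH: "fin_subspace (V T')" "int (dim (V T')) = int (dim (NS S 1)) + (\<Sum>s\<in>T'. int (dim (?W s)))"
      by auto
    have V: "V (insert s T') = {v + Y s u | v u. v \<in> V T' \<and> u \<in> ?W s}"
    proof (intro Set.set_eqI iffI)
      fix z assume "z \<in> V (insert s T')"
      then obtain a u where z: "a \<in> NS S 1" "\<forall>t\<in>insert s T'. u t \<in> ?W t"
        "z = a + (\<Sum>t\<in>insert s T'. Y t (u t))" unfolding V_def by blast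
      have "z = (a + (\<Sum>t\<in>T'. Y t (u t))) + Y s (u s)" unfolding z(3) using insert(1,2) by (simp add: algebra_simps)
      moreover have "a + (\<Sum>t\<in>T'. Y t (u t)) \<in> V T'" unfolding V_def using z(1,2) by blast
      ultimately show "z \<in> {v + Y s u | v u. v \<in> V T' \<and> u \<in> ?W s}" using z(2) by blast
    next
      fix z assume "z \<in> {v + Y s u | v u. v \<in> V T' \<and> u \<in> ?W s}"
      then obtain a u w where z: "a \<in> NS S 1" "\<forall>t\<in>T'. u t \<in> ?W t" "w \<in> ?W s"
        "z = (a + (\<Sum>t\<in>T'. Y t (u t))) + Y s w" unfolding V_def by blast
      have "(\<Sum>t\<in>T'. Y t ((u(s := w)) t)) = (\<Sum>t\<in>T'. Y t (u t))"
        by (rule sum.cong) (use insert(2) in auto)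
      then have "z = a + (\<Sum>t\<in>insert s T'. Y t ((u(s := w)) t))"
        unfolding z(4) using insert(1,2) by (simp add: algebra_simps)
      moreover have "\<forall>t\<in>insert s T'. (u(s := w)) t \<in> ?W t" using z(2,3) by simp
      ultimately show "z \<in> V (insert s T')" unfolding V_def using z(1) by blast
    qed
    have "{u \<in> ?W s. Y s u \<in> V T'} = {0}"
    proof -
      have "u = 0" if u: "u \<in> G 0" "Y s u \<in> V T'" for u
      proof -
        obtain a w where w: "a \<in> NS S 1" "\<forall>t\<in>T'. w t \<in> ?W t" "Y s u = a + (\<Sum>t\<in>T'. Y t (w t))"
          using u(2) unfolding V_def by blast
        obtain v where v: "\<forall>t\<in>S. v t \<in> G 0" "a = (\<Sum>t\<in>S. Y t (v t))" using w(1) unfolding NS_def by auto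
        \<comment> \<open>The coefficients of a relation over \<open>G 0\<close> between the forms
          of \<open>insert s (S \<union> T')\<close>; by \<open>Y_independent\<close> all of them
          vanish, in particular \<open>u\<close>.\<close>
        define y where "y t = (if t = s then u else if t \<in> S then - v t else - w t)" for t
        have sT: "s \<in> T" "s \<notin> S" "S \<inter> T' = {}" "T' \<subseteq> T" using insert T(2) by auto
        have 1: "(\<Sum>t\<in>S. Y t (y t)) = - a" unfolding v(2) sum_negf[symmetric]
          by (rule sum.cong) (use sT in \<open>auto simp: y_def\<close>)
        have 2: "(\<Sum>t\<in>T'. Y t (y t)) = - (\<Sum>t\<in>T'. Y t (w t))" unfolding sum_negf[symmetric]
          by (rule sum.cong) (use sT insert(2) in \<open>auto simp: y_def\<close>)
        have "(\<Sum>t\<in>S \<union> T'. Y t (y t)) = - a - (\<Sum>t\<in>T'. Y t (w t))"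
          using 1 2 by (subst sum.union_disjoint[OF S insert(1) sT(3)]) simp
        then have sum0: "(\<Sum>t\<in>insert s (S \<union> T'). Y t (y t)) = 0"
          using S insert(1,2) sT(2) w(3) by (simp add: y_def)
        have "card (insert s (S \<union> T')) = card S + card (insert s T')"
          using S insert(1,2) sT card_Un_disjoint[of S "insert s T'"] by simp
        also have "\<dots> \<le> card S + card T" using card_mono[OF T(1) insert.prems] by simp
        finally have card: "card (insert s (S \<union> T')) \<le> n" using T(3) by simp
        have fin: "finite (insert s (S \<union> T'))" using S insert(1) by simp
        have "y s = 0"
        proof (rule Y_independent[OF fin card _ sum0])
          show "y t \<in> G 0" if "t \<in> insert s (S \<union> T')" for t
            using that u(1) v(1) w(2) by (auto simp: y_def)
        qed simp
        then show ?thesis by (simp add: y_def)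
      qed
      moreover have "0 \<in> V T'" using subspace_0[OF fin_subspaceD[OF IH(1)]] .
      ultimately show ?thesis using subspace_0[OF sub] by auto
    qed
    then have "dim (V (insert s T')) = dim (V T') + dim (?W s)"
      using vp.dim_sum_image(2)[OF Y_linear IH(1) W, of s s] unfolding V by simp
    moreover have "fin_subspace (V (insert s T'))"
      unfolding V by (rule vp.dim_sum_image(1)[OF Y_linear IH(1) W])
    ultimately show ?case using IH(2) insert(1,2) by simp
  qed
  from this[OF T(1) order_refl] have V: "fin_subspace (V T)"
    "int (dim (V T)) = int (dim (NS S 1)) + (\<Sum>s\<in>T. int (dim (?W s)))" by auto
  have "V T \<subseteq> socle S"
  proof
    fix z assume "z \<in> V T"
    then obtain a u where z: "a \<in> NS S 1" "\<forall>s\<in>T. u s \<in> ?W s" "z = a + (\<Sum>s\<in>T. Y s (u s))"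
      unfolding V_def by blast
    then show "z \<in> socle S" unfolding z(3)
      by (intro subspace_add[OF sub] subspace_sum[OF sub]) (use NA in auto)
  qed
  then have "dim (V T) \<le> dim (socle S)"
    by (intro dim_mono_fin[OF fin_subspace_mono[OF G_fin sub AG] fin_subspaceD[OF V(1)]])
  then show ?thesis using V(2) unfolding alpha_def by linarith
qed

text \<open>The old socle maps into the new one. Since \<open>Y s\<close> is injective on
  \<open>G 0\<close> modulo \<open>NS S 1\<close>, the kernel of this map has the dimension of
  \<open>{u \<in> G 0. Y s u \<in> socle S}\<close>, which is the loss.\<close>

lemma alpha_insert:
  assumes S: "finite S" "s \<notin> S" "card S < n" and N: "gsub (NS S)" and s: "nonzerodivisor S s"
    and N': "gsub (NS (insert s S))"
  shows "alpha S - int (dim {u \<in> G 0. Y s u \<in> socle S}) \<le> alpha (insert s S)"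
proof -
  interpret vp: vspace_pair scale scale ..
  note sub = socle_subspace[OF N]
  have fA: "fin_subspace (socle S)" by (rule fin_subspace_mono[OF G_fin sub(1,3)])
  have ins: "NS (insert s S) e = {a + Y s u | a u. a \<in> NS S e \<and> u \<in> G (e - 1)}" for e
    by (rule NS_insert[OF S(1,2)])
  have "dim (NS (insert s S) 1) + dim {u \<in> G 0. Y s u \<in> NS S 1} = dim (NS S 1) + dim (G 0)"
    using vp.dim_sum_image(2)[OF Y_linear gsub_fin[OF N, of 1] G_fin[of 0], of s] unfolding ins[of 1] by simp
  moreover have "{u \<in> G 0. Y s u \<in> NS S 1} = {0}"
    using kernel[OF S N s, of 1] NS_nonpos[of 0 S] by simp
  ultimately have 1: "dim (NS (insert s S) 1) = dim (NS S 1) + dim (G 0)" by simp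
  let ?B = "{a + Y s u | a u. a \<in> socle S \<and> u \<in> G 0}"
  have 2: "fin_subspace ?B" "dim ?B + dim {u \<in> G 0. Y s u \<in> socle S} = dim (socle S) + dim (G 0)"
    using vp.dim_sum_image[OF Y_linear fA G_fin[of 0], of s] by auto
  have "?B \<subseteq> socle (insert s S)"
  proof
    fix z assume "z \<in> ?B"
    then obtain a u where z: "a \<in> socle S" "u \<in> G 0" "z = a + Y s u" by blast
    have "X i z \<in> NS (insert s S) 2" if "i < n" for i
    proof -
      have "X i z = X i a + Y s (X i u)" by (simp add: z(3) Y_X)
      moreover have "X i a \<in> NS S 2" using z(1) that by (simp add: socle_def)
      moreover have "X i u \<in> G (2 - 1)" using X_G[OF that z(2)] by simp
      ultimately show ?thesis unfolding ins[of 2] by blast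
    qed
    moreover have "z \<in> G 1" using z sub(3) Y_G[OF z(2), of s] by auto
    ultimately show "z \<in> socle (insert s S)" by (simp add: socle_def)
  qed
  then have "dim ?B \<le> dim (socle (insert s S))"
    using socle_subspace[OF N'] by (intro dim_mono_fin[OF fin_subspace_mono[OF G_fin] fin_subspaceD[OF 2(1)]])
  then show ?thesis using 1 2(2) unfolding alpha_def by linarith
qed

text \<open>Among \<open>n - card S\<close> good parameters some \<open>s\<close> satisfies
  \<open>card T * W s \<le> alpha S\<close>, by averaging over \<open>socle_generic_bound\<close>.
  Then \<open>alpha_insert\<close> gives the ratio between consecutive values of
  \<open>alpha\<close>.\<close>

lemma generic_section:
  assumes S: "finite S" "card S < n" and N: "gsub (NS S)" "reg (NS S)"
  obtains s where "s \<notin> S" "nonzerodivisor S s" "gsub (NS (insert s S))" "reg (NS (insert s S))"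
    "int (n - card S - 1) * alpha S \<le> int (n - card S) * alpha (insert s S)"
proof -
  \<comment> \<open>One finite set for each degree \<open>e\<close>, hence a countable union;
    including \<open>S\<close> keeps the new parameter distinct.\<close>
  define bad where "bad = (\<Union>e\<in>{2..}. {s. \<exists>z\<in>G e. z \<notin> NS S e \<and> Y s z \<in> NS S (e + 1)}) \<union> S"
  have "countable (\<Union>e\<in>{2 :: int..}. {s. \<exists>z\<in>G e. z \<notin> NS S e \<and> Y s z \<in> NS S (e + 1)})"
    by (intro countable_UN countableI_type countable_finite[OF finite_zero_divisors[OF N]]) simp
  then have "countable bad"
    unfolding bad_def using countable_finite[OF S(1)] by (rule countable_Un)
  then have "infinite (UNIV - bad)"
    using uncountable_minus_countable[OF uncountable_field] by (metis countable_finite)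
  then obtain T where T: "finite T" "card T = n - card S" "T \<subseteq> UNIV - bad"
    using infinite_arbitrarily_large by blast
  have nzd: "nonzerodivisor S s" if "s \<in> T" for s
    using T(3) that unfolding nonzerodivisor_def bad_def by auto
  have TS: "S \<inter> T = {}" using T(3) by (auto simp: bad_def)
  define W where "W s = int (dim {u \<in> G 0. Y s u \<in> socle S})" for s
  have "\<exists>s\<in>T. int (card T) * W s \<le> alpha S"
  proof (rule ccontr)
    assume "\<not> ?thesis"
    then have "alpha S < int (card T) * W s" if "s \<in> T" for s using that by auto
    moreover have "T \<noteq> {}" using T(2) S(2) by auto
    ultimately have "(\<Sum>s\<in>T. alpha S) < (\<Sum>s\<in>T. int (card T) * W s)"
      by (intro sum_strict_mono T(1)) auto
    then have "int (card T) * alpha S < int (card T) * (\<Sum>s\<in>T. W s)"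
      by (simp add: sum_distrib_left)
    also have "\<dots> \<le> int (card T) * alpha S"
      using socle_generic_bound[OF S(1) T(1) TS _ N(1)] T(2) S(2) unfolding W_def
      by (intro mult_left_mono) simp_all
    finally show False by simp
  qed
  then obtain s where s: "s \<in> T" "int (card T) * W s \<le> alpha S" by blast
  have sS: "s \<notin> S" using s(1) TS by auto
  note ins = NS_insert[OF S(1) sS]
  have inj: "z \<in> NS S e" if "e \<ge> 2" "z \<in> G e" "Y s z \<in> NS S (e + 1)" for e z
    using nzd[OF s(1)] that unfolding nonzerodivisor_def by blast
  have N': "gsub (NS (insert s S))" "reg (NS (insert s S))"
    by (rule reg_hyperplane[OF N inj ins]; assumption)+
  have "int (card T) * (alpha S - W s) \<le> int (card T) * alpha (insert s S)"
    unfolding W_def by (intro mult_left_mono alpha_insert[OF S(1) sS S(2) N(1) nzd[OF s(1)] N'(1)]) simp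
  then have "(int (card T) - 1) * alpha S \<le> int (card T) * alpha (insert s S)"
    using s(2) by (simp add: algebra_simps)
  moreover have "int (n - card S - 1) = int (card T) - 1" "int (n - card S) = int (card T)"
    using T(2) S(2) by simp_all
  ultimately have "int (n - card S - 1) * alpha S \<le> int (n - card S) * alpha (insert s S)"
    by (simp only:)
  then show ?thesis by (rule that[OF sS nzd[OF s(1)] N'])
qed

section \<open>Hilbert series of successive sections\<close>

definition hilb_series :: "'f set \<Rightarrow> int fps" where
  "hilb_series S = Abs_fps (\<lambda>e. hilb S (int e))"

lemma hilb_zero: "hilb S 0 = int (dim (G 0))"
  by (simp add: hilb_def NS_nonpos)

lemma hilb_neg: "e < 0 \<Longrightarrow> hilb S e = 0"
  by (simp add: hilb_def NS_nonpos G_neg)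

lemma hilb_series_insert:
  assumes "finite S" "s \<notin> S" "card S < n" "gsub (NS S)" "nonzerodivisor S s"
  shows "hilb_series (insert s S) = hilb_series S * (1 - fps_X) + fps_const (alpha S) * fps_X ^ 2"
proof (rule fps_ext)
  fix e
  show "fps_nth (hilb_series (insert s S)) e
    = fps_nth (hilb_series S * (1 - fps_X) + fps_const (alpha S) * fps_X ^ 2) e"
    using hilb_insert[OF assms, of "int e"] hilb_neg[of "-1" S]
    by (cases e) (auto simp: hilb_series_def right_diff_distrib fps_X_power_nth numeral_2_eq_2)
qed

text \<open>Induction on the number \<open>k\<close> of forms still to be divided out. Each step
  back from the section appends \<open>alpha S\<close> as the new last entry; the clause on
  \<open>b (k - 1)\<close> is what allows the next inequality to be attached.\<close>

lemma sections_hilbert_series: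
  assumes "k \<le> n" "finite S" "card S = n - k" "gsub (NS S)" "reg (NS S)"
  shows "\<exists>b :: nat \<Rightarrow> int. (\<forall>i<k. b i \<ge> 0) \<and> (\<forall>i. Suc i < k \<longrightarrow> int (i + 1) * b (Suc i) \<le> int (i + 2) * b i) \<and>
    (0 < k \<longrightarrow> b 0 \<le> int (dim (G 0)) \<and> b (k - 1) = alpha S) \<and>
    hilb_series S * (1 - fps_X) ^ k
      = fps_const (int (dim (G 0))) - (\<Sum>i<k. fps_const (b i) * fps_X ^ 2 * (1 - fps_X) ^ i)"
  using assms
proof (induction k arbitrary: S)
  case 0
  have "hilb_series S = fps_const (int (dim (G 0)))"
  proof (rule fps_ext)
    fix e
    have "card S = n" using 0 by simp
    from NS_full[OF \<open>finite S\<close> this \<open>gsub (NS S)\<close>]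
    have "hilb S (int e) = 0" if "e \<ge> 1" using that by (simp add: hilb_def)
    then show "fps_nth (hilb_series S) e = fps_nth (fps_const (int (dim (G 0)))) e"
      using hilb_zero by (cases e) (auto simp: hilb_series_def)
  qed
  then show ?case by simp
next
  case (Suc k)
  have cS: "card S < n" "n - card S = Suc k" using Suc.prems by auto
  obtain s where s: "s \<notin> S" "nonzerodivisor S s" "gsub (NS (insert s S))" "reg (NS (insert s S))"
    "int (n - card S - 1) * alpha S \<le> int (n - card S) * alpha (insert s S)"
    using generic_section[OF Suc.prems(2) cS(1) Suc.prems(4,5)] .
  have "k \<le> n" "finite (insert s S)" "card (insert s S) = n - k" using Suc.prems s(1) by auto
  from Suc.IH[OF this s(3,4)] obtain b where b: "\<forall>i<k. b i \<ge> 0"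
    "\<forall>i. Suc i < k \<longrightarrow> int (i + 1) * b (Suc i) \<le> int (i + 2) * b i"
    "0 < k \<longrightarrow> b 0 \<le> int (dim (G 0)) \<and> b (k - 1) = alpha (insert s S)"
    "hilb_series (insert s S) * (1 - fps_X) ^ k
      = fps_const (int (dim (G 0))) - (\<Sum>i<k. fps_const (b i) * fps_X ^ 2 * (1 - fps_X) ^ i)"
    by blast
  define b' where "b' = b(k := alpha S)"
  have ineq: "int k * alpha S \<le> int (k + 1) * alpha (insert s S)"
    using s(5) unfolding cS(2) by simp
  note ser = hilb_series_insert[OF Suc.prems(2) s(1) cS(1) Suc.prems(4) s(2)]
  have "(\<Sum>i<Suc k. fps_const (b' i) * fps_X ^ 2 * (1 - fps_X) ^ i)
    = (\<Sum>i<k. fps_const (b i) * fps_X ^ 2 * (1 - fps_X) ^ i) + fps_const (alpha S) * fps_X ^ 2 * (1 - fps_X) ^ k"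
    by (simp add: b'_def)
  moreover have "hilb_series S * (1 - fps_X) ^ Suc k
    = hilb_series (insert s S) * (1 - fps_X) ^ k - fps_const (alpha S) * fps_X ^ 2 * (1 - fps_X) ^ k"
    unfolding ser by (simp add: algebra_simps)
  ultimately have "hilb_series S * (1 - fps_X) ^ Suc k
      = fps_const (int (dim (G 0))) - (\<Sum>i<Suc k. fps_const (b' i) * fps_X ^ 2 * (1 - fps_X) ^ i)"
    unfolding b(4) by simp
  moreover have "\<forall>i<Suc k. b' i \<ge> 0"
    using b(1) alpha_nonneg[OF Suc.prems(4)] by (simp add: b'_def less_Suc_eq)
  moreover have "int (i + 1) * b' (Suc i) \<le> int (i + 2) * b' i" if "Suc i < Suc k" for i
  proof (cases "Suc i = k")
    case True
    then have "b' i = alpha (insert s S)" "b' (Suc i) = alpha S" using b(3) by (auto simp: b'_def)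
    then show ?thesis using ineq True by simp
  next
    case False
    then show ?thesis using b(2) that by (simp add: b'_def)
  qed
  moreover have "b' 0 \<le> int (dim (G 0))"
  proof (cases "k = 0")
    \<comment> \<open>With one form left, dividing by it leaves only \<open>G 0\<close>. So
      \<open>hilb S\<close> equals \<open>dim (G 0)\<close> in degree 1 and
      \<open>dim (G 0) - alpha S\<close> in degree 2, and the latter is nonnegative.\<close>
    case True
    have "hilb_series (insert s S) = fps_const (int (dim (G 0)))" using b(4) True by simp
    then have h: "hilb (insert s S) (int e) = (if e = 0 then int (dim (G 0)) else 0)" for e
      by (auto simp: hilb_series_def fps_eq_iff)
    have "hilb S 1 = int (dim (G 0))"
      using hilb_insert[OF Suc.prems(2) s(1) cS(1) Suc.prems(4) s(2), of 1] h[of 1] hilb_zero by simp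
    moreover have "hilb S 2 = hilb S 1 - alpha S"
      using hilb_insert[OF Suc.prems(2) s(1) cS(1) Suc.prems(4) s(2), of 2] h[of 2] by simp
    moreover have "hilb S 2 \<ge> 0"
      unfolding hilb_def using dim_mono_fin[OF G_fin gsub_subspace[OF Suc.prems(4)], of 2 2]
        gsub_simps(8)[OF Suc.prems(4)] by (simp add: subset_iff)
    ultimately show ?thesis using True by (simp add: b'_def)
  next
    case False then show ?thesis using b(3) by (simp add: b'_def)
  qed
  moreover have "b' (Suc k - 1) = alpha S" by (simp add: b'_def)
  ultimately show ?case by blast
qed

theorem hilbert_series:
  "\<exists>b :: nat \<Rightarrow> int. (\<forall>i<n. b i \<ge> 0) \<and> (\<forall>i. Suc i < n \<longrightarrow> int (i + 1) * b (Suc i) \<le> int (i + 2) * b i) \<and>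
    (0 < n \<longrightarrow> b 0 \<le> int (dim (G 0))) \<and>
    Abs_fps (\<lambda>e. int (dim (G (int e)))) * (1 - fps_X) ^ n
      = fps_const (int (dim (G 0))) - (\<Sum>i<n. fps_const (b i) * fps_X ^ 2 * (1 - fps_X) ^ i)"
proof -
  have "hilb_series {} = Abs_fps (\<lambda>e. int (dim (G (int e))))"
    by (simp add: hilb_series_def hilb_def NS_empty)
  then show ?thesis
    using sections_hilbert_series[of n "{}"] gsub_zero reg_zero unfolding NS_empty by auto
qed

end

section \<open>Extension of scalars to an uncountable field\<close>

text \<open>The sets of natural numbers embed as series with coefficients 0 and 1, whatever the
  field of coefficients.\<close>

lemma uncountable_fls: "uncountable (UNIV :: 'f::field fls set)"
proof
  assume c: "countable (UNIV :: 'f fls set)"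
  define h :: "nat set \<Rightarrow> 'f fls" where
    "h A = Abs_fls (\<lambda>k. if 0 \<le> k \<and> nat k \<in> A then 1 else 0)" for A
  have nth: "fls_nth (h A) k = (if 0 \<le> k \<and> nat k \<in> A then 1 else 0)" for A k
    unfolding h_def by (rule nth_Abs_fls_lower_bound[of 0]) auto
  have "inj h"
  proof (rule injI)
    fix A B assume "h A = h B"
    then have "fls_nth (h A) (int k) = fls_nth (h B) (int k)" for k by simp
    then have "k \<in> A \<longleftrightarrow> k \<in> B" for k
      unfolding nth by (metis int_ops(1) nat_int of_nat_0_le_iff zero_neq_one)
    then show "A = B" by blast
  qed
  have "countable (h ` UNIV)" by (rule countable_subset[OF subset_UNIV c])
  then have "countable (UNIV :: nat set set)" using \<open>inj h\<close> by (rule countable_image_inj_on)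
  from range_from_nat_into[OF UNIV_not_empty this] show False
    using Cantors_theorem[of "UNIV :: nat set"] unfolding Pow_UNIV by blast
qed

lemma vspace_times: "vspace ((*) :: 'f::field \<Rightarrow> 'f \<Rightarrow> 'f)"
  by unfold_locales (simp_all add: algebra_simps)

lemma fin_subspace_UNIV_times:
  "vspace.fin_subspace ((*) :: 'f::field \<Rightarrow> 'f \<Rightarrow> 'f) UNIV"
  "vector_space.dim ((*) :: 'f::field \<Rightarrow> 'f \<Rightarrow> 'f) UNIV = 1"
proof -
  interpret t: vspace "(*) :: 'f::field \<Rightarrow> 'f \<Rightarrow> 'f" by (rule vspace_times)
  have s: "t.span {1} = UNIV"
    using t.span_scale[OF t.span_base[of 1 "{1}"]] by auto
  then show "t.fin_subspace UNIV" using t.fin_subspace_span[of "{1}"] by simp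
  show "t.dim UNIV = 1"
    by (rule t.dim_unique[of "{1}"]) (simp_all add: s t.dependent_single)
qed

text \<open>The conditions of \<open>generic_ops\<close> over a field of any size. They and the
  dimensions of the components survive the extension to Laurent series.\<close>

locale resolved_ops = gops scale X n G
  for scale :: "'f::field \<Rightarrow> 'a::ab_group_add \<Rightarrow> 'a" and X :: "nat \<Rightarrow> 'a \<Rightarrow> 'a" and n G +
  assumes G_neg: "e < 0 \<Longrightarrow> G e = {0}"
    and G_gen: "e \<ge> 0 \<Longrightarrow> z \<in> G (e + 1) \<Longrightarrow> \<exists>u. (\<forall>i<n. u i \<in> G e) \<and> z = (\<Sum>i<n. X i (u i))"
    and no_linear: "(\<And>i. i < n \<Longrightarrow> w i \<in> G 0) \<Longrightarrow> (\<Sum>i<n. X i (w i)) = 0 \<Longrightarrow> i < n \<Longrightarrow> w i = 0"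
    and reg_zero: "reg (\<lambda>_. {0})"
begin

definition bas :: "int \<Rightarrow> 'a set" where
  "bas e = (SOME B. B \<subseteq> G e \<and> finite B \<and> independent B \<and> span B = G e \<and> card B = dim (G e))"

lemma bas: "bas e \<subseteq> G e" "finite (bas e)" "independent (bas e)" "span (bas e) = G e"
  "card (bas e) = dim (G e)"
proof -
  have "\<exists>B. B \<subseteq> G e \<and> finite B \<and> independent B \<and> span B = G e \<and> card B = dim (G e)"
    by (rule fin_subspace_basis[OF G_fin[of e]]) blast
  from someI_ex[OF this] show "bas e \<subseteq> G e" "finite (bas e)" "independent (bas e)"
    "span (bas e) = G e" "card (bas e) = dim (G e)" unfolding bas_def by auto
qed

abbreviation coord :: "int \<Rightarrow> 'a \<Rightarrow> 'a \<Rightarrow> 'f" where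
  "coord e \<equiv> representation (bas e)"

lemma coord_sum: "x \<in> G e \<Longrightarrow> (\<Sum>b\<in>bas e. scale (coord e x b) b) = x"
  using sum_representation_eq[OF bas(3) _ bas(2) order_refl, of x e] bas(4)[of e] by simp

lemma coord_unique:
  assumes "(\<Sum>b\<in>bas e. scale (u b) b) = (\<Sum>b\<in>bas e. scale (v b) b)" "b \<in> bas e"
  shows "u b = v b"
proof -
  have "(\<Sum>b\<in>bas e. scale (u b - v b) b) = 0"
    using assms(1) by (simp add: scale_left_diff_distrib sum_subtractf)
  from independentD[OF bas(3) bas(2) order_refl this assms(2)] show ?thesis by simp
qed

text \<open>Extension of scalars in coordinates: degree \<open>e\<close> consists of the families supported on
  \<open>{e} \<times> bas e\<close>, and \<open>slice m e\<close> extracts the coefficient of the \<open>m\<close>-th power of the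
  indeterminate, an element of \<open>G e\<close>.\<close>

definition GK :: "int \<Rightarrow> (int \<times> 'a \<Rightarrow> 'f fls) set" where
  "GK e = fun_on ({e} \<times> bas e) UNIV"

text \<open>The matrix of \<open>X i\<close> in the chosen bases. For \<open>i \<ge> n\<close>,
  where \<open>X i\<close> need not respect the grading, it is set to 0, so that the operators
  commute for all indices.\<close>

definition XK :: "nat \<Rightarrow> (int \<times> 'a \<Rightarrow> 'f fls) \<Rightarrow> int \<times> 'a \<Rightarrow> 'f fls" where
  "XK i z p = (if i < n \<and> snd p \<in> bas (fst p)
     then \<Sum>b\<in>bas (fst p - 1). fls_const (coord (fst p) (X i b) (snd p)) * z (fst p - 1, b) else 0)"

definition slice :: "int \<Rightarrow> int \<Rightarrow> (int \<times> 'a \<Rightarrow> 'f fls) \<Rightarrow> 'a" where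
  "slice m e z = (\<Sum>b\<in>bas e. scale (fls_nth (z (e, b)) m) b)"

lemma slice_simps [simp]:
  "slice m e 0 = 0" "slice m e (x + y) = slice m e x + slice m e y"
  "slice m e (x - y) = slice m e x - slice m e y" "slice m e (- x) = - slice m e x"
  "slice m e (\<Sum>a\<in>A. h a) = (\<Sum>a\<in>A. slice m e (h a))"
proof -
  show 0: "slice m e 0 = 0" and add: "slice m e (x + y) = slice m e x + slice m e y" for x y
    by (simp_all add: slice_def scale_left_distrib sum.distrib)
  show "slice m e (x - y) = slice m e x - slice m e y" "slice m e (- x) = - slice m e x"
    by (simp_all add: slice_def scale_left_diff_distrib sum_subtractf sum_negf)
  interpret Modules.additive "slice m e" by unfold_locales (rule add)
  show "slice m e (\<Sum>a\<in>A. h a) = (\<Sum>a\<in>A. slice m e (h a))"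
    by (rule sum)
qed

lemma slice_in: "slice m e z \<in> G e"
  unfolding slice_def using bas(1)[of e] by (intro G_simps(6) G_simps(5)) auto

text \<open>The matrix entries are constants, so powers of the indeterminate are not mixed.\<close>

lemma slice_X: "i < n \<Longrightarrow> slice m (e + 1) (XK i z) = X i (slice m e z)"
proof -
  assume i: "i < n"
  have "slice m (e + 1) (XK i z)
    = (\<Sum>b'\<in>bas (e + 1). \<Sum>b\<in>bas e. scale (fls_nth (z (e, b)) m) (scale (coord (e + 1) (X i b) b') b'))"
    unfolding slice_def XK_def
    by (intro sum.cong) (simp_all add: i fls_nth_sum scale_sum_left mult.commute)
  also have "\<dots> = (\<Sum>b\<in>bas e. scale (fls_nth (z (e, b)) m) (\<Sum>b'\<in>bas (e + 1). scale (coord (e + 1) (X i b) b') b'))"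
    by (subst sum.swap) (simp add: scale_sum_right)
  also have "\<dots> = (\<Sum>b\<in>bas e. scale (fls_nth (z (e, b)) m) (X i b))"
    by (intro sum.cong refl arg_cong2[where f = scale] coord_sum X_G[OF i]) (use bas(1) in auto)
  also have "\<dots> = X i (slice m e z)" by (simp add: slice_def)
  finally show ?thesis .
qed

lemma slice_inj_at:
  assumes "\<And>m. slice m e x = slice m e y" "b \<in> bas e"
  shows "x (e, b) = y (e, b)"
proof (rule fls_eqI)
  fix m
  show "fls_nth (x (e, b)) m = fls_nth (y (e, b)) m"
    using coord_unique[of "\<lambda>b. fls_nth (x (e, b)) m" e "\<lambda>b. fls_nth (y (e, b)) m" b]
      assms(1)[of m] assms(2) by (simp add: slice_def)
qed

lemma slice_inj:
  assumes "x \<in> GK e" "y \<in> GK e" "\<And>m. slice m e x = slice m e y"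
  shows "x = y"
proof
  fix p
  show "x p = y p"
  proof (cases "p \<in> {e} \<times> bas e")
    case True
    then show ?thesis using slice_inj_at[OF assms(3)] by auto
  next
    case False
    then show ?thesis using fun_on_out[OF assms(1)[unfolded GK_def] False] fun_on_out[OF assms(2)[unfolded GK_def] False] by simp
  qed
qed

text \<open>The bound \<open>m0\<close> makes the coordinates Laurent series. For this reason every
  slicewise choice below takes the zero solution for small \<open>m\<close>.\<close>

lemma slice_surj:
  assumes g: "\<And>m. g m \<in> G e" and low: "\<And>m. m < m0 \<Longrightarrow> g m = 0"
  shows "\<exists>z\<in>GK e. \<forall>m. slice m e z = g m"
proof -
  define z where "z p = (if p \<in> {e} \<times> bas e then Abs_fls (\<lambda>m. coord e (g m) (snd p)) else 0)" for p
  have nth: "fls_nth (z (e, b)) m = coord e (g m) b" if "b \<in> bas e" for b m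
  proof -
    have "fls_nth (Abs_fls (\<lambda>m. coord e (g m) b)) m = coord e (g m) b"
      by (rule nth_Abs_fls_lower_bound[of m0]) (simp add: low representation_zero)
    then show ?thesis using that by (simp add: z_def)
  qed
  have "z \<in> GK e" unfolding GK_def by (rule fun_onI) (auto simp: z_def)
  moreover have "slice m e z = g m" for m
    unfolding slice_def using coord_sum[OF g, of m] by (simp add: nth cong: sum.cong)
  ultimately show ?thesis by blast
qed

lemma slice_lower:
  obtains m0 where "\<And>m. m < m0 \<Longrightarrow> slice m e z = 0"
proof
  fix m assume m: "m < Min (insert 0 ((\<lambda>b. fls_subdegree (z (e, b))) ` bas e))"
  have "m < fls_subdegree (z (e, b))" if "b \<in> bas e" for b
    using m that bas(2)[of e] by simp
  then show "slice m e z = 0" by (simp add: slice_def)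
qed

lemma slice_kd: "slice m (e + 1) (kd XK n f T) = kd X n (\<lambda>T. slice m e (f T)) T"
proof -
  have "slice m (e + 1) (ksign i T x) = ksign i T (slice m (e + 1) x)" for i T x
    by (rule ksign_map[where \<phi> = "slice m (e + 1)"]) simp
  then show ?thesis unfolding kd_def by (auto intro!: sum.cong simp: slice_X)
qed

lemma slice_family:
  assumes u: "\<And>m. (\<forall>i\<in>I. u m i \<in> G e)" and low: "\<And>m. m < m0 \<Longrightarrow> (\<forall>i\<in>I. u m i = 0)"
  shows "\<exists>v. (\<forall>i\<in>I. v i \<in> GK e) \<and> (\<forall>i\<in>I. \<forall>m. slice m e (v i) = u m i)"
proof -
  have "\<forall>i\<in>I. \<exists>v. v \<in> GK e \<and> (\<forall>m. slice m e v = u m i)"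
  proof
    fix i assume i: "i \<in> I"
    have "\<exists>z\<in>GK e. \<forall>m. slice m e z = u m i"
      by (rule slice_surj[of _ _ m0]) (use u low i in auto)
    then show "\<exists>v. v \<in> GK e \<and> (\<forall>m. slice m e v = u m i)" by blast
  qed
  from bchoice[OF this] show ?thesis by blast
qed

lemma XK_linear: "Vector_Spaces.linear (fun_scale (*)) (fun_scale (*)) (XK i)"
proof -
  interpret t: vspace "(*) :: 'f fls \<Rightarrow> 'f fls \<Rightarrow> 'f fls" by (rule vspace_times)
  interpret ft: vspace "fun_scale (*) :: 'f fls \<Rightarrow> (int \<times> 'a \<Rightarrow> 'f fls) \<Rightarrow> int \<times> 'a \<Rightarrow> 'f fls"
    by (rule vspace_fun) (rule vspace_times)
  show ?thesis
  proof unfold_locales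
    show "XK i (x + y) = XK i x + XK i y" for x y
      by (rule ext) (simp add: XK_def distrib_left sum.distrib)
    show "XK i (fun_scale (*) c x) = fun_scale (*) c (XK i x)" for c x
    proof
      fix p
      have "(\<Sum>b\<in>bas (fst p - 1). fls_const (coord (fst p) (X i b) (snd p)) * (c * x (fst p - 1, b)))
        = c * (\<Sum>b\<in>bas (fst p - 1). fls_const (coord (fst p) (X i b) (snd p)) * x (fst p - 1, b))"
        unfolding sum_distrib_left by (intro sum.cong refl mult.left_commute)
      then show "XK i (fun_scale (*) c x) p = fun_scale (*) c (XK i x) p"
        by (simp only: XK_def fun_scale_def if_distrib[of "\<lambda>t. c * t"] mult_zero_right)
    qed
  qed
qed

lemma XK_GK: "z \<in> GK e \<Longrightarrow> XK i z \<in> GK (e + 1)"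
proof -
  assume z: "z \<in> GK e"
  show ?thesis
    unfolding GK_def
  proof (rule fun_onI)
    fix p assume p: "p \<notin> {e + 1} \<times> bas (e + 1)"
    show "XK i z p = 0"
    proof (cases "i < n \<and> snd p \<in> bas (fst p)")
      case True
      then have "fst p \<noteq> e + 1" using p by (cases p) auto
      then have "z (fst p - 1, b) = 0" for b
        using fun_on_out[OF z[unfolded GK_def], of "(fst p - 1, b)"] by auto
      then show ?thesis by (simp add: XK_def)
    qed (simp only: XK_def if_False)
  qed simp
qed

lemma XK_comm: "XK i (XK j z) = XK j (XK i z)"
proof (cases "i < n \<and> j < n")
  case True
  show ?thesis
  proof
    fix p
    show "XK i (XK j z) p = XK j (XK i z) p"
    proof (cases "snd p \<in> bas (fst p)")
      case in_bas: True
      have "slice m (fst p) (XK i (XK j z)) = slice m (fst p) (XK j (XK i z))" for m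
        using slice_X[of i m "fst p - 1" "XK j z"] slice_X[of j m "fst p - 1" "XK i z"]
          slice_X[of i m "fst p - 2" z] slice_X[of j m "fst p - 2" z] True
        by (simp add: X_comm[of i j])
      from slice_inj_at[OF this in_bas] show ?thesis by simp
    qed (simp add: XK_def)
  qed
next
  case False
  have 0: "XK k 0 = 0" for k by (simp add: XK_def fun_eq_iff)
  have 1: "XK k y = 0" if "\<not> k < n" for k y using that by (simp add: XK_def fun_eq_iff)
  from False consider "\<not> i < n" | "\<not> j < n" by blast
  then show ?thesis by cases (simp_all add: 0 1)
qed

lemma gops_XK: "gops (fun_scale (*)) XK n GK"
proof -
  interpret t: vspace "(*) :: 'f fls \<Rightarrow> 'f fls \<Rightarrow> 'f fls" by (rule vspace_times)
  interpret ft: vspace "fun_scale (*) :: 'f fls \<Rightarrow> (int \<times> 'a \<Rightarrow> 'f fls) \<Rightarrow> int \<times> 'a \<Rightarrow> 'f fls"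
    by (rule vspace_fun) (rule vspace_times)
  show ?thesis
  proof unfold_locales
    show "ft.fin_subspace (GK d)" for d
      unfolding GK_def by (rule t.fun_on_fin_subspace) (use bas(2) fin_subspace_UNIV_times in auto)
    show "XK i (x + y) = XK i x + XK i y" for i x y
      using XK_linear[of i] by (simp add: Vector_Spaces.linear_iff)
    show "XK i (fun_scale (*) c x) = fun_scale (*) c (XK i x)" for i c x
      using XK_linear[of i] by (simp add: Vector_Spaces.linear_iff)
    show "XK i (XK j x) = XK j (XK i x)" for i j x by (rule XK_comm)
    show "XK i x \<in> GK (d + 1)" if "x \<in> GK d" for i x d by (rule XK_GK[OF that])
  qed
qed

lemma dim_GK: "vector_space.dim (fun_scale (*)) (GK e) = dim (G e)"
proof -
  interpret t: vspace "(*) :: 'f fls \<Rightarrow> 'f fls \<Rightarrow> 'f fls" by (rule vspace_times)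
  have "finite ({e} \<times> bas e)" using bas(2) by simp
  from t.dim_fun_on[OF this fin_subspace_UNIV_times(1)]
  show ?thesis unfolding GK_def fin_subspace_UNIV_times(2) by (simp add: card_cartesian_product bas(5))
qed

text \<open>Each condition is linear with constant coefficients, so it is solved slice by slice over
  the small field and the solutions are reassembled.\<close>

lemma generic_ops_XK: "generic_ops (fun_scale (*)) XK n GK"
proof -
  interpret K: gops "fun_scale (*)" XK n GK by (rule gops_XK)
  show ?thesis
  proof unfold_locales
    fix e :: int assume "e < 0"
    moreover have "0 \<notin> bas e" using dependent_zero[of "bas e"] bas(3)[of e] by blast
    ultimately have "bas e = {}" using bas(1)[of e] G_neg[of e] by auto
    then have GK: "GK e = fun_on {} UNIV" by (simp add: GK_def)
    have "f = 0" if f: "f \<in> GK e" for f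
      using fun_on_out[OF f[unfolded GK]] by (simp add: fun_eq_iff)
    then show "GK e = {0}" using K.G_simps(1) by blast
  next
    fix e z assume e: "e \<ge> 0" and z: "z \<in> GK (e + 1)"
    obtain m0 where m0: "\<And>m. m < m0 \<Longrightarrow> slice m (e + 1) z = 0" by (rule slice_lower[of "e + 1" z]) blast
    have "\<forall>m. \<exists>u. (\<forall>i<n. u i \<in> G e) \<and> slice m (e + 1) z = (\<Sum>i<n. X i (u i)) \<and> (m < m0 \<longrightarrow> (\<forall>i<n. u i = 0))"
    proof
      fix m
      show "\<exists>u. (\<forall>i<n. u i \<in> G e) \<and> slice m (e + 1) z = (\<Sum>i<n. X i (u i)) \<and> (m < m0 \<longrightarrow> (\<forall>i<n. u i = 0))"
      proof (cases "m < m0")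
        case True
        then show ?thesis using m0 by (intro exI[of _ "\<lambda>_. 0"]) simp
      next
        case False
        then show ?thesis using G_gen[OF e slice_in[of m "e + 1" z]] by blast
      qed
    qed
    from choice[OF this] obtain u where u: "\<And>m. (\<forall>i<n. u m i \<in> G e) \<and> slice m (e + 1) z = (\<Sum>i<n. X i (u m i))
      \<and> (m < m0 \<longrightarrow> (\<forall>i<n. u m i = 0))" by blast
    obtain v where v: "\<forall>i\<in>{..<n}. v i \<in> GK e" "\<forall>i\<in>{..<n}. \<forall>m. slice m e (v i) = u m i"
      using slice_family[of "{..<n}" u e m0] u by auto
    have "z = (\<Sum>i<n. XK i (v i))"
    proof (rule slice_inj[OF z])
      show "(\<Sum>i<n. XK i (v i)) \<in> GK (e + 1)"
        by (rule K.G_simps(6), rule XK_GK) (use v(1) in auto)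
      show "slice m (e + 1) z = slice m (e + 1) (\<Sum>i<n. XK i (v i))" for m
        using u[of m] v(2) by (auto intro!: sum.cong simp: slice_X)
    qed
    then show "\<exists>u. (\<forall>i<n. u i \<in> GK e) \<and> z = (\<Sum>i<n. XK i (u i))" using v(1) by auto
  next
    fix w i assume w: "\<And>i. i < n \<Longrightarrow> w i \<in> GK 0" and sum: "(\<Sum>i<n. XK i (w i)) = 0" and i: "i < n"
    show "w i = 0"
    proof (rule slice_inj[OF w[OF i] K.G_simps(1)])
      fix m
      have "(\<Sum>i<n. X i (slice m 0 (w i))) = slice m (0 + 1) (\<Sum>i<n. XK i (w i))"
        unfolding slice_simps by (intro sum.cong refl slice_X[symmetric]) simp
      then have "(\<Sum>i<n. X i (slice m 0 (w i))) = 0" unfolding sum by simp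
      from no_linear[OF slice_in this i] show "slice m 0 (w i) = slice m 0 0" by simp
    qed
  next
    show "K.reg (\<lambda>_. {0})"
      unfolding K.reg_def
    proof (intro allI impI subsetI)
      fix p j f assume j: "int p + 2 \<le> j" and "f \<in> K.cyc (\<lambda>_. {0}) p j"
      define e where "e = j - int p"
      from \<open>f \<in> K.cyc (\<lambda>_. {0}) p j\<close> have f: "f \<in> chains n p (GK e)" and df: "kd XK n f = 0"
        by (auto simp: K.cyc_def e_def dest: chains_trivial)
      let ?P = "{T. T \<subseteq> {..<n} \<and> card T = p}"
      \<comment> \<open>A lower bound common to all components of the chain, available because there
        are finitely many index sets.\<close>
      have "\<exists>m0. \<forall>T\<in>I. \<forall>m<m0. slice m e (f T) = 0" if "finite I" for I
        using that
      proof (induction I rule: finite_induct)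
        case (insert T I)
        then obtain m0 where m0: "\<forall>T\<in>I. \<forall>m<m0. slice m e (f T) = 0" by blast
        obtain m1 where m1: "\<And>m. m < m1 \<Longrightarrow> slice m e (f T) = 0" by (rule slice_lower[of e "f T"]) blast
        show ?case by (rule exI[of _ "min m0 m1"]) (use m0 m1 in auto)
      qed simp
      from this[OF finite_chain_index[of n p]] obtain m0 where
        m0: "\<forall>T\<in>?P. \<forall>m<m0. slice m e (f T) = 0" by blast
      have fm: "(\<lambda>T. slice m e (f T)) \<in> chains n p (G e)" for m
        by (rule chains_map[OF f, of "slice m e"], rule slice_in, rule slice_simps(1))
      have "\<forall>m. \<exists>g. g \<in> chains n (p + 1) (G (e - 1)) \<and> (\<lambda>T. slice m e (f T)) = kd X n g \<and> (m < m0 \<longrightarrow> g = 0)"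
      proof
        fix m
        show "\<exists>g. g \<in> chains n (p + 1) (G (e - 1)) \<and> (\<lambda>T. slice m e (f T)) = kd X n g \<and> (m < m0 \<longrightarrow> g = 0)"
        proof (cases "m < m0")
          case True
          have "slice m e (f T) = 0" for T
            using m0 True chains_outside[OF fm, of T m] by (cases "T \<in> ?P") auto
          then have "(\<lambda>T. slice m e (f T)) = kd X n 0" by (simp add: fun_eq_iff)
          then show ?thesis by (intro exI[of _ 0]) (simp add: chains_zero)
        next
          case False
          have "kd X n (\<lambda>T. slice m e (f T)) = 0"
            by (rule ext) (simp add: slice_kd[symmetric] df)
          then have "(\<lambda>T. slice m e (f T)) \<in> cyc (\<lambda>_. {0}) p j"
            using fm[of m] chains_zero[of "{0}" n "p - 1"] unfolding cyc_def e_def by simp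
          then have "(\<lambda>T. slice m e (f T)) \<in> bnd (\<lambda>_. {0}) p j" by (rule regD[OF reg_zero j])
          then obtain g where g: "g \<in> chains n (p + 1) (G (e - 1))"
            "(\<lambda>T. slice m e (f T)) - kd X n g \<in> chains n p {0}"
            unfolding e_def by (rule bndE)
          from chains_trivial[OF g(2)] have "(\<lambda>T. slice m e (f T)) = kd X n g" by simp
          then show ?thesis using g(1) False by blast
        qed
      qed
      from choice[OF this] obtain g where g: "\<And>m. g m \<in> chains n (p + 1) (G (e - 1)) \<and>
        (\<lambda>T. slice m e (f T)) = kd X n (g m) \<and> (m < m0 \<longrightarrow> g m = 0)" by blast
      let ?Q = "{T. T \<subseteq> {..<n} \<and> card T = p + 1}"
      have "\<forall>T\<in>?Q. g m T \<in> G (e - 1)" for m using g[of m] chainsD by blast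
      moreover have "\<forall>T\<in>?Q. g m T = 0" if "m < m0" for m using g[of m] that by simp
      ultimately obtain v where v: "\<forall>T\<in>?Q. v T \<in> GK (e - 1)" "\<forall>T\<in>?Q. \<forall>m. slice m (e - 1) (v T) = g m T"
        using slice_family[of ?Q g "e - 1" m0] by blast
      define h where "h T = (if T \<in> ?Q then v T else 0)" for T
      have h: "h \<in> chains n (p + 1) (GK (e - 1))"
        by (rule chainsI) (use v(1) in \<open>auto simp: h_def\<close>)
      have hs: "(\<lambda>T. slice m (e - 1) (h T)) = g m" for m
      proof
        fix T show "slice m (e - 1) (h T) = g m T"
          using v(2) chains_outside[of "g m" n "p + 1" "G (e - 1)" T] g[of m]
          by (cases "T \<in> ?Q") (auto simp: h_def)
      qed
      have dh: "kd XK n h \<in> chains n p (GK e)" using K.kd_in_G[OF h] by simp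
      have "f T = kd XK n h T" for T
      proof (rule slice_inj[of _ e])
        show "f T \<in> GK e" by (rule chains_in[OF f K.G_simps(1)])
        show "kd XK n h T \<in> GK e" by (rule chains_in[OF dh K.G_simps(1)])
        show "slice m e (f T) = slice m e (kd XK n h T)" for m
        proof -
          have "slice m e (kd XK n h T) = kd X n (\<lambda>T. slice m (e - 1) (h T)) T"
            using slice_kd[of m "e - 1" h T] by simp
          also have "\<dots> = kd X n (g m) T" by (simp only: hs)
          also have "\<dots> = slice m e (f T)"
            using fun_cong[of "\<lambda>T. slice m e (f T)" "kd X n (g m)" T] g[of m] by simp
          finally show ?thesis by simp
        qed
      qed
      then have "f - kd XK n h = 0" by (simp add: fun_eq_iff)
      then show "f \<in> K.bnd (\<lambda>_. {0}) p j"
        by (intro K.bndI[where g = h]) (use f h chains_zero[of "{0}" n p] in \<open>simp_all add: e_def\<close>)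
    qed
  next
    show "uncountable (UNIV :: 'f fls set)" by (rule uncountable_fls)
  qed
qed

theorem hilbert_series:
  "\<exists>b :: nat \<Rightarrow> int. (\<forall>i<n. b i \<ge> 0) \<and> (\<forall>i. Suc i < n \<longrightarrow> int (i + 1) * b (Suc i) \<le> int (i + 2) * b i) \<and>
    (0 < n \<longrightarrow> b 0 \<le> int (dim (G 0))) \<and>
    Abs_fps (\<lambda>e. int (dim (G (int e)))) * (1 - fps_X) ^ n
      = fps_const (int (dim (G 0))) - (\<Sum>i<n. fps_const (b i) * fps_X ^ 2 * (1 - fps_X) ^ i)"
  using generic_ops.hilbert_series[OF generic_ops_XK] unfolding dim_GK .

end

section \<open>Polynomials and their Koszul complex\<close>

abbreviation coef :: "('v, 'k::zero) mpoly \<Rightarrow> ('v \<Rightarrow>\<^sub>0 nat) \<Rightarrow> 'k" where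
  "coef \<equiv> Poly_Mapping.lookup"

definition edeg :: "('v::finite \<Rightarrow>\<^sub>0 nat) \<Rightarrow> int" where
  "edeg e = int (\<Sum>x\<in>UNIV. Poly_Mapping.lookup e x)"

definition unit_exp :: "'v \<Rightarrow> ('v \<Rightarrow>\<^sub>0 nat)" where
  "unit_exp v = Poly_Mapping.single v 1"

definition cst :: "'k \<Rightarrow> ('v, 'k::zero) mpoly" where
  "cst c = Poly_Mapping.single 0 c"

lemma edeg_add: "edeg (a + b) = edeg a + edeg b"
  by (simp add: edeg_def lookup_add sum.distrib)

lemma edeg_zero [simp]: "edeg 0 = 0"
  by (simp add: edeg_def)

lemma edeg_unit_exp [simp]: "edeg (unit_exp v) = 1"
  by (simp add: edeg_def unit_exp_def lookup_single when_def)

lemma homogeneousI: "(\<And>e. coef p e \<noteq> 0 \<Longrightarrow> edeg e = d) \<Longrightarrow> p \<in> homogeneous d"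
  by (auto simp: homogeneous_def edeg_def in_keys_iff)

lemma homogeneousD: "p \<in> homogeneous d \<Longrightarrow> coef p e \<noteq> 0 \<Longrightarrow> edeg e = d"
  by (auto simp: homogeneous_def edeg_def in_keys_iff)

lemma homogeneous_simps [simp]:
  "0 \<in> homogeneous d" "p \<in> homogeneous d \<Longrightarrow> q \<in> homogeneous d \<Longrightarrow> p + q \<in> homogeneous d"
  "p \<in> homogeneous d \<Longrightarrow> q \<in> homogeneous d \<Longrightarrow> p - q \<in> homogeneous d"
  "p \<in> homogeneous d \<Longrightarrow> - p \<in> homogeneous d"
proof -
  show "0 \<in> homogeneous d" by (simp add: homogeneous_def)
  show "p + q \<in> homogeneous d" if "p \<in> homogeneous d" "q \<in> homogeneous d"
  proof (rule homogeneousI)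
    fix e assume "coef (p + q) e \<noteq> 0"
    then have "coef p e \<noteq> 0 \<or> coef q e \<noteq> 0" by (auto simp: lookup_add)
    then show "edeg e = d" using that homogeneousD by blast
  qed
  show "p - q \<in> homogeneous d" if "p \<in> homogeneous d" "q \<in> homogeneous d"
  proof (rule homogeneousI)
    fix e assume "coef (p - q) e \<noteq> 0"
    then have "coef p e \<noteq> 0 \<or> coef q e \<noteq> 0" by (auto simp: lookup_minus)
    then show "edeg e = d" using that homogeneousD by blast
  qed
  show "- p \<in> homogeneous d" if "p \<in> homogeneous d"
  proof (rule homogeneousI)
    fix e assume "coef (- p) e \<noteq> 0"
    then have "coef p e \<noteq> 0" by (simp add: lookup_uminus)
    then show "edeg e = d" using that homogeneousD by blast
  qed
qed

lemma homogeneous_sum: "(\<And>a. a \<in> A \<Longrightarrow> h a \<in> homogeneous d) \<Longrightarrow> sum h A \<in> homogeneous d"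
  by (induction A rule: infinite_finite_induct) simp_all

lemma homogeneous_mult:
  assumes "p \<in> homogeneous d" "q \<in> homogeneous d'"
  shows "p * q \<in> homogeneous (d + d')"
proof (rule homogeneousI)
  fix e assume "coef (p * q) e \<noteq> 0"
  then have "e \<in> Poly_Mapping.keys (p * q)" by (simp add: in_keys_iff)
  then obtain a b where "a \<in> Poly_Mapping.keys p" "b \<in> Poly_Mapping.keys q" "e = a + b"
    using keys_mult[of p q] by blast
  then show "edeg e = d + d'"
    using homogeneousD[OF assms(1), of a] homogeneousD[OF assms(2), of b] by (simp add: in_keys_iff edeg_add)
qed

lemma homogeneous_single: "Poly_Mapping.single e c \<in> homogeneous (edeg e)"
  by (rule homogeneousI) (auto simp: lookup_single when_def split: if_splits)

lemma homogeneous_cst: "cst c \<in> homogeneous 0"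
  using homogeneous_single[of 0 c] by (simp add: cst_def)

lemma coef_single_mult_add: "coef (Poly_Mapping.single a c * p) (a + e) = c * coef p e"
  for p :: "('v, 'k::comm_ring_1) mpoly"
  by (simp add: lookup_mult lookup_single when_mult Sum_any_when_equal')

lemma coef_single_mult_zero:
  fixes p :: "('v, 'k::comm_ring_1) mpoly"
  assumes "\<And>b. e \<noteq> a + b"
  shows "coef (Poly_Mapping.single a c * p) e = 0"
  using assms by (simp add: lookup_mult lookup_single when_mult Sum_any_when_equal')

lemma coef_cst_mult: "coef (cst c * p) e = c * coef p e" for p :: "('v, 'k::comm_ring_1) mpoly"
  using coef_single_mult_add[of 0 c p e] by (simp add: cst_def)

lemma cst_simps: "cst (a + b) = cst a + cst b" "cst (a * b) = cst a * cst b" "cst 1 = 1" "cst 0 = 0"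
  for a b :: "'k::comm_ring_1"
  by (simp_all add: cst_def single_add mult_single)

lemma mpoly_monomials: "p = (\<Sum>e\<in>Poly_Mapping.keys p. Poly_Mapping.single e (coef p e))"
proof (rule poly_mapping_eqI)
  fix e
  show "coef p e = coef (\<Sum>e\<in>Poly_Mapping.keys p. Poly_Mapping.single e (coef p e)) e"
    by (simp add: lookup_sum lookup_single when_def in_keys_iff)
qed

text \<open>Multiplicativity of the residue map onto the field: the exponent 0 has no decomposition
  other than \<open>0 + 0\<close>.\<close>

lemma coef_mult_zero: "coef (p * q) 0 = coef p 0 * coef q 0" for p :: "('v, 'k::comm_ring_1) mpoly"
proof -
  have single: "coef (Poly_Mapping.single a c * q) 0 = coef (Poly_Mapping.single a c) 0 * coef q 0" for a c
  proof (cases "a = 0")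
    case True then show ?thesis using coef_single_mult_add[of 0 c q 0] by simp
  next
    case False
    have "0 \<noteq> a + b" for b
    proof
      assume "0 = a + b"
      then have "Poly_Mapping.lookup a x = 0" for x using lookup_add[of a b x] by (simp add: lookup_zero)
      then show False using False by (simp add: poly_mapping_eqI)
    qed
    then show ?thesis using False coef_single_mult_zero[of 0 a c q] by (simp add: lookup_single)
  qed
  have "coef (p * q) 0 = coef ((\<Sum>e\<in>Poly_Mapping.keys p. Poly_Mapping.single e (coef p e)) * q) 0"
    using mpoly_monomials[of p] by simp
  also have "\<dots> = (\<Sum>e\<in>Poly_Mapping.keys p. coef (Poly_Mapping.single e (coef p e)) 0 * coef q 0)"
    by (simp only: sum_distrib_right lookup_sum single)
  also have "\<dots> = coef (\<Sum>e\<in>Poly_Mapping.keys p. Poly_Mapping.single e (coef p e)) 0 * coef q 0"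
    by (simp only: sum_distrib_right lookup_sum)
  also have "\<dots> = coef p 0 * coef q 0" using mpoly_monomials[of p] by simp
  finally show ?thesis .
qed

definition hcomp :: "int \<Rightarrow> ('v::finite, 'k::comm_monoid_add) mpoly \<Rightarrow> ('v, 'k) mpoly" where
  "hcomp d p = (\<Sum>e\<in>{e \<in> Poly_Mapping.keys p. edeg e = d}. Poly_Mapping.single e (coef p e))"

lemma coef_hcomp: "coef (hcomp d p) e = (if edeg e = d then coef p e else 0)"
  by (simp add: hcomp_def lookup_sum lookup_single when_def in_keys_iff)

lemma hcomp_homogeneous: "hcomp d p \<in> homogeneous d"
  by (rule homogeneousI) (auto simp: coef_hcomp split: if_splits)

lemma hcomp_add: "hcomp d (p + q) = hcomp d p + hcomp d q"
  by (rule poly_mapping_eqI) (simp add: coef_hcomp lookup_add)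

lemma hcomp_zero [simp]: "hcomp d 0 = 0"
  by (rule poly_mapping_eqI) (simp add: coef_hcomp)

lemma hcomp_sum: "hcomp d (\<Sum>a\<in>A. h a) = (\<Sum>a\<in>A. hcomp d (h a))"
  by (induction A rule: infinite_finite_induct) (simp_all add: hcomp_add)

lemma hcomp_of_homogeneous: "p \<in> homogeneous d' \<Longrightarrow> hcomp d p = (if d = d' then p else 0)"
  by (rule poly_mapping_eqI) (use homogeneousD[of p d'] in \<open>force simp: coef_hcomp\<close>)

lemma hcomp_mult:
  fixes p :: "('v::finite, 'k::field) mpoly"
  assumes a: "a \<in> homogeneous c"
  shows "hcomp (c + d) (a * p) = a * hcomp d p"
proof -
  have s: "hcomp (c + d) (a * Poly_Mapping.single e x) = a * hcomp d (Poly_Mapping.single e x)" for e x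
    using hcomp_of_homogeneous[OF homogeneous_mult[OF a homogeneous_single[of e x]], of "c + d"]
      hcomp_of_homogeneous[OF homogeneous_single[of e x], of d] by simp
  have "hcomp (c + d) (a * (\<Sum>e\<in>Poly_Mapping.keys p. Poly_Mapping.single e (coef p e)))
    = a * hcomp d (\<Sum>e\<in>Poly_Mapping.keys p. Poly_Mapping.single e (coef p e))"
    by (simp only: sum_distrib_left hcomp_sum s)
  then show ?thesis using mpoly_monomials[of p] by simp
qed

lemma sum_hcomp:
  assumes "finite D" "edeg ` Poly_Mapping.keys p \<subseteq> D"
  shows "(\<Sum>d\<in>D. hcomp d p) = p"
proof (rule poly_mapping_eqI)
  fix e
  have "coef p e = 0" if "edeg e \<notin> D"
  proof (rule ccontr)
    assume "coef p e \<noteq> 0"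
    then have "edeg e \<in> edeg ` Poly_Mapping.keys p" by (simp add: in_keys_iff)
    then show False using assms(2) that by blast
  qed
  then show "coef (\<Sum>d\<in>D. hcomp d p) e = coef p e"
    using assms(1) by (auto simp: lookup_sum coef_hcomp)
qed

text \<open>A numbering of the variables: the Koszul signs, the contracting homotopy and leading
  terms all depend on an order.\<close>

locale variables =
  fixes vr :: "nat \<Rightarrow> 'v::finite" and n :: nat
  assumes vr: "bij_betw vr {..<n} UNIV"
begin

definition Var :: "nat \<Rightarrow> ('v, 'k::zero_neq_one) mpoly" where
  "Var i = Poly_Mapping.single (unit_exp (vr i)) 1"

abbreviation ue :: "nat \<Rightarrow> ('v \<Rightarrow>\<^sub>0 nat)" where
  "ue i \<equiv> unit_exp (vr i)"

lemma homogeneous_Var: "Var i \<in> homogeneous 1"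
  using homogeneous_single[of "ue i" 1] by (simp add: Var_def)

lemma vr_inj: "i < n \<Longrightarrow> j < n \<Longrightarrow> vr i = vr j \<longleftrightarrow> i = j"
  using vr by (auto simp: bij_betw_def inj_on_def)

lemma lookup_ue: "i < n \<Longrightarrow> j < n \<Longrightarrow> Poly_Mapping.lookup (ue i) (vr j) = (if i = j then 1 else 0)"
  by (simp add: unit_exp_def lookup_single when_def vr_inj)

lemma exp_eq_add_ue: "0 < Poly_Mapping.lookup e v \<Longrightarrow> e = unit_exp v + (e - unit_exp v)"
  by (rule poly_mapping_eqI) (auto simp: lookup_add lookup_minus unit_exp_def lookup_single when_def)

lemma coef_Var_mult:
  "coef (Var i * p) e = (if 0 < Poly_Mapping.lookup e (vr i) then coef p (e - ue i) else 0)"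
  for p :: "('v, 'k::comm_ring_1) mpoly"
proof (cases "0 < Poly_Mapping.lookup e (vr i)")
  case True
  have "coef (Var i * p) (ue i + (e - ue i)) = coef p (e - ue i)"
    unfolding Var_def by (subst coef_single_mult_add) simp
  then show ?thesis using exp_eq_add_ue[OF True] True by simp
next
  case False
  have "e \<noteq> ue i + b" for b
    using False by (auto simp: lookup_add unit_exp_def)
  then show ?thesis using False coef_single_mult_zero[of e "ue i" 1 p] by (simp add: Var_def)
qed

text \<open>The contracting homotopy of the Koszul complex of \<open>S\<close> uses, in multidegree \<open>e + 1\<^sub>T\<close>, the first
  variable of its support.\<close>

definition msupp :: "('v \<Rightarrow>\<^sub>0 nat) \<Rightarrow> nat set \<Rightarrow> nat set" where
  "msupp e T = {i. i < n \<and> (i \<in> T \<or> 0 < Poly_Mapping.lookup e (vr i))}"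

definition htp :: "(nat set \<Rightarrow> ('v, 'k::zero) mpoly) \<Rightarrow> nat set \<Rightarrow> ('v, 'k) mpoly" where
  "htp f T = Abs_poly_mapping (\<lambda>e. if msupp e T \<noteq> {} \<and> Min (msupp e T) \<in> T
     then coef (f (T - {Min (msupp e T)})) (e + ue (Min (msupp e T))) else 0)"

lemma finite_msupp [simp]: "finite (msupp e T)"
  by (simp add: msupp_def)

lemma coef_htp:
  "coef (htp f T) e = (if msupp e T \<noteq> {} \<and> Min (msupp e T) \<in> T
     then coef (f (T - {Min (msupp e T)})) (e + ue (Min (msupp e T))) else 0)"
proof -
  let ?c = "\<lambda>e. if msupp e T \<noteq> {} \<and> Min (msupp e T) \<in> T
     then coef (f (T - {Min (msupp e T)})) (e + ue (Min (msupp e T))) else 0"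
  have "{e. ?c e \<noteq> 0} \<subseteq> (\<Union>i\<in>{..<n}. (\<lambda>e. e + ue i) -` Poly_Mapping.keys (f (T - {i})))"
  proof
    fix e assume e: "e \<in> {e. ?c e \<noteq> 0}"
    then have ne: "msupp e T \<noteq> {}" and c: "coef (f (T - {Min (msupp e T)})) (e + ue (Min (msupp e T))) \<noteq> 0"
      by (auto split: if_splits)
    have "Min (msupp e T) \<in> msupp e T" using ne by (intro Min_in) auto
    then have "Min (msupp e T) < n" by (simp add: msupp_def)
    then show "e \<in> (\<Union>i\<in>{..<n}. (\<lambda>e. e + ue i) -` Poly_Mapping.keys (f (T - {i})))"
      using c by (auto simp: in_keys_iff)
  qed
  moreover have "finite (\<Union>i\<in>{..<n}. (\<lambda>e. e + ue i) -` Poly_Mapping.keys (f (T - {i})))"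
    by (intro finite_UN_I finite_vimageI) (auto intro: injI)
  ultimately have "finite {e. ?c e \<noteq> 0}" by (rule finite_subset)
  then show ?thesis unfolding htp_def by (subst lookup_Abs_poly_mapping) simp_all
qed

lemma htp_homogeneous:
  assumes "\<And>T. f T \<in> homogeneous d"
  shows "htp f T \<in> homogeneous (d - 1)"
proof (rule homogeneousI)
  fix e assume "coef (htp f T) e \<noteq> 0"
  then obtain i where "coef (f (T - {i})) (e + ue i) \<noteq> 0" by (auto simp: coef_htp split: if_splits)
  then show "edeg e = d - 1" using homogeneousD[OF assms] by (force simp: edeg_add)
qed

lemma htp_chains:
  assumes "f \<in> chains n p UNIV"
  shows "htp f \<in> chains n (p + 1) UNIV"
proof (rule chainsI)
  fix T assume T: "\<not> (T \<subseteq> {..<n} \<and> card T = p + 1)"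
  have "coef (htp f T) e = 0" for e
  proof (cases "msupp e T \<noteq> {} \<and> Min (msupp e T) \<in> T")
    case True
    then have i: "Min (msupp e T) \<in> T" and "Min (msupp e T) \<in> msupp e T" by (auto intro: Min_in)
    then have "Min (msupp e T) < n" by (simp add: msupp_def)
    have "\<not> (T - {Min (msupp e T)} \<subseteq> {..<n} \<and> card (T - {Min (msupp e T)}) = p)"
    proof
      assume a: "T - {Min (msupp e T)} \<subseteq> {..<n} \<and> card (T - {Min (msupp e T)}) = p"
      have "finite (T - {Min (msupp e T)})" using a finite_subset by blast
      then have "finite T" by simp
      have "T \<subseteq> {..<n}" using a \<open>Min (msupp e T) < n\<close> by auto
      moreover have "card T = p + 1"
        using a card_Suc_Diff1[OF \<open>finite T\<close> i] by simp
      ultimately show False using T by simp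
    qed
    from chains_outside[OF assms this] show ?thesis by (simp add: coef_htp)
  next
    case False
    then show ?thesis unfolding coef_htp by (rule if_not_P)
  qed
  then show "htp f T = 0" by (simp add: poly_mapping_eqI)
qed simp

text \<open>Checked one multidegree at a time, with \<open>m\<close> its first variable. If
  \<open>m \<notin> T\<close>, only \<open>i = m\<close> contributes to the differential; if
  \<open>m \<in> T\<close>, the cycle condition at \<open>T - {m}\<close> expresses the coefficient
  of \<open>f T\<close>. Multidegree 0 has no first variable; it occurs only for
  \<open>p = 0\<close> and is excluded by \<open>const\<close>.\<close>

lemma koszul_homotopy:
  fixes f :: "nat set \<Rightarrow> ('v, 'k::comm_ring_1) mpoly"
  assumes f: "f \<in> chains n p UNIV" and df: "kd (\<lambda>i p. Var i * p) n f = 0"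
    and const: "p = 0 \<Longrightarrow> coef (f {}) 0 = 0"
  shows "kd (\<lambda>i p. Var i * p) n (htp f) = f"
proof
  fix T
  let ?X = "\<lambda>i p. Var i * p :: ('v, 'k) mpoly"
  have ch: "kd ?X n (htp f) \<in> chains n p UNIV"
    using kd_chains[OF htp_chains[OF f], of ?X UNIV] by simp
  have cks: "coef (ksign i T q) e = ksign i T (coef q e)" for i T e and q :: "('v, 'k) mpoly"
    by (simp add: ksign_def)
  have ckd: "coef (kd ?X n g T) e
    = (\<Sum>i\<in>{..<n} - T. ksign i T (if 0 < Poly_Mapping.lookup e (vr i) then coef (g (insert i T)) (e - ue i) else 0))"
    for g T e
    by (simp add: kd_def lookup_sum cks coef_Var_mult)
  show "kd ?X n (htp f) T = f T"
  proof (cases "T \<subseteq> {..<n} \<and> card T = p")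
    case False
    then show ?thesis using chains_outside[OF ch False] chains_outside[OF f False] by simp
  next
    case True
    show ?thesis
    proof (rule poly_mapping_eqI)
      fix e
      show "coef (kd ?X n (htp f) T) e = coef (f T) e"
      proof (cases "msupp e T = {}")
        case empty: True
        have "T = {}" using empty True by (auto simp: msupp_def)
        have e0: "Poly_Mapping.lookup e (vr i) = 0" if "i < n" for i using empty that by (auto simp: msupp_def)
        have "e = 0"
        proof (rule poly_mapping_eqI)
          fix x
          obtain i where "i < n" "x = vr i" using vr by (auto simp: bij_betw_def)
          then show "Poly_Mapping.lookup e x = Poly_Mapping.lookup 0 x" using e0 by simp
        qed
        then have "coef (f T) e = 0" using const True \<open>T = {}\<close> by simp
        moreover have "coef (kd ?X n (htp f) T) e = 0"
          unfolding ckd using e0 by (intro sum.neutral) simp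
        ultimately show ?thesis by simp
      next
        case ne: False
        define m where "m = Min (msupp e T)"
        have m: "m \<in> msupp e T" unfolding m_def using ne by (intro Min_in) auto
        have mle: "m \<le> i" if "i \<in> msupp e T" for i unfolding m_def using that by simp
        have mn: "m < n" using m by (simp add: msupp_def)
        \<comment> \<open>Moving a variable from the exponent into the index set preserves the
          multidegree, so the first variable stays the same.\<close>
        have msupp: "msupp (e - ue i) (insert i T) = msupp e T"
          if "i \<in> {..<n} - T" "0 < Poly_Mapping.lookup e (vr i)" for i
          using that by (auto simp: msupp_def lookup_minus lookup_ue split: if_splits)
        have ch: "coef (htp f (insert i T)) (e - ue i)
          = (if m \<in> insert i T then coef (f (insert i T - {m})) (e - ue i + ue m) else 0)"
          if "i \<in> {..<n} - T" "0 < Poly_Mapping.lookup e (vr i)" for i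
          unfolding coef_htp msupp[OF that] using ne by (simp add: m_def)
        have signm: "ksign m U x = x" if "U \<subseteq> T" for U and x :: 'k
        proof -
          have "{j \<in> U. j < m} = {}"
          proof -
            have "m \<le> j" if "j \<in> U" for j
              using that \<open>U \<subseteq> T\<close> True by (intro mle) (auto simp: msupp_def)
            then show ?thesis by force
          qed
          then show ?thesis by (simp only: ksign_def) simp
        qed
        show ?thesis
        proof (cases "m \<in> T")
          case mT: False
          have em: "0 < Poly_Mapping.lookup e (vr m)" using m mT by (simp add: msupp_def)
          have "coef (kd ?X n (htp f) T) e = (\<Sum>i\<in>{m}. ksign i T (coef (f T) e))"
            unfolding ckd
          proof (rule sum.mono_neutral_cong_right)
            show "\<forall>i\<in>{..<n} - T - {m}. ksign i T (if 0 < Poly_Mapping.lookup e (vr i)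
              then coef (htp f (insert i T)) (e - ue i) else 0) = 0"
              using mT by (auto simp: ch)
            fix i assume "i \<in> {m}"
            then have i: "i = m" by simp
            have "e - ue m + ue m = e" using exp_eq_add_ue[OF em] by (simp add: add.commute)
            moreover have "insert m T - {m} = T" using mT by auto
            ultimately show "ksign i T (if 0 < Poly_Mapping.lookup e (vr i)
              then coef (htp f (insert i T)) (e - ue i) else 0) = ksign i T (coef (f T) e)"
              using ch[of m] em mT mn by (simp add: i)
          qed (use mT mn in auto)
          then show ?thesis by (simp add: signm)
        next
          case mT: True
          define U where "U = T - {m}"
          have mU: "m \<notin> U" "insert m U = T" using mT by (auto simp: U_def)
          let ?t = "\<lambda>i. if 0 < Poly_Mapping.lookup e (vr i) then coef (f (insert i U)) (e + ue m - ue i) else 0"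
          \<comment> \<open>The cycle condition at \<open>U\<close> in the same multidegree: the
            term \<open>i = m\<close> is the coefficient of \<open>f T\<close>; the others are those
            of the homotopy, with opposite sign because \<open>m < i\<close> is missing from
            \<open>U\<close>.\<close>
          have "0 = coef (kd ?X n f U) (e + ue m)" using df by simp
          also have "\<dots> = (\<Sum>i\<in>insert m ({..<n} - T). ksign i U
            (if 0 < Poly_Mapping.lookup (e + ue m) (vr i) then coef (f (insert i U)) (e + ue m - ue i) else 0))"
            unfolding ckd by (rule sum.cong) (use mU mn in auto)
          also have "\<dots> = ksign m U (coef (f T) e) + (\<Sum>i\<in>{..<n} - T. ksign i U
            (if 0 < Poly_Mapping.lookup (e + ue m) (vr i) then coef (f (insert i U)) (e + ue m - ue i) else 0))"
            using mT mU mn by (subst sum.insert) (auto simp: lookup_add lookup_ue)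
          also have "(\<Sum>i\<in>{..<n} - T. ksign i U
            (if 0 < Poly_Mapping.lookup (e + ue m) (vr i) then coef (f (insert i U)) (e + ue m - ue i) else 0))
            = (\<Sum>i\<in>{..<n} - T. - ksign i T (?t i))"
          proof (rule sum.cong)
            fix i assume i: "i \<in> {..<n} - T"
            have l: "Poly_Mapping.lookup (e + ue m) (vr i) = Poly_Mapping.lookup e (vr i)"
              using i mT mn by (auto simp: lookup_add lookup_ue)
            show "ksign i U (if 0 < Poly_Mapping.lookup (e + ue m) (vr i)
              then coef (f (insert i U)) (e + ue m - ue i) else 0) = - ksign i T (?t i)"
            proof (cases "0 < Poly_Mapping.lookup e (vr i)")
              case True
              then have "m \<le> i" using i by (intro mle) (simp add: msupp_def)
              then have "m < i" using i mT by (metis DiffD2 le_neq_implies_less)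
              then have "{j \<in> T. j < i} = insert m {j \<in> U. j < i}" using mU by auto
              moreover have "finite {j \<in> U. j < i}" by simp
              ultimately have "card {j \<in> T. j < i} = Suc (card {j \<in> U. j < i})" using mU by simp
              then have "ksign i U x = - ksign i T x" for x :: 'k by (simp add: ksign_def)
              then show ?thesis unfolding l by simp
            qed (simp add: l)
          qed simp
          also have "\<dots> = - (\<Sum>i\<in>{..<n} - T. ksign i T (?t i))" by (rule sum_negf)
          finally have 1: "coef (f T) e = (\<Sum>i\<in>{..<n} - T. ksign i T (?t i))"
            by (simp add: signm U_def)
          have "coef (kd ?X n (htp f) T) e = (\<Sum>i\<in>{..<n} - T. ksign i T (?t i))"
            unfolding ckd
          proof (rule sum.cong)
            fix i assume i: "i \<in> {..<n} - T"
            have "insert i T - {m} = insert i U" using i mT by (auto simp: U_def)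
            moreover have "e - ue i + ue m = e + ue m - ue i" if "0 < Poly_Mapping.lookup e (vr i)"
              by (rule poly_mapping_eqI)
                (use that in \<open>auto simp: lookup_add lookup_minus unit_exp_def lookup_single when_def\<close>)
            ultimately show "ksign i T (if 0 < Poly_Mapping.lookup e (vr i)
              then coef (htp f (insert i T)) (e - ue i) else 0) = ksign i T (?t i)"
              using ch[OF i] mT by simp
          qed simp
          then show ?thesis using 1 by simp
        qed
      qed
    qed
  qed
qed

end

section \<open>Betti numbers as Koszul homology\<close>

lemma sum_fun_app: "(\<Sum>a\<in>A. h a) k = (\<Sum>a\<in>A. h a k)"
  by (induction A rule: infinite_finite_induct) simp_all

lemma vspace_mpoly: "vspace (\<lambda>c p. cst c * p :: ('v, 'k::field) mpoly)"
  by unfold_locales (simp_all add: cst_simps algebra_simps)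

lemma finite_exponents: "finite {e :: 'v::finite \<Rightarrow>\<^sub>0 nat. edeg e = d}"
proof (rule finite_imageD)
  show "inj_on Poly_Mapping.lookup {e :: 'v \<Rightarrow>\<^sub>0 nat. edeg e = d}"
    by (rule inj_onI) (rule poly_mapping_eqI, rule fun_cong)
  have "Poly_Mapping.lookup ` {e :: 'v \<Rightarrow>\<^sub>0 nat. edeg e = d}
    \<subseteq> {f. \<forall>x. (x \<in> UNIV \<longrightarrow> f x \<in> {..nat d}) \<and> (x \<notin> UNIV \<longrightarrow> f x = 0)}"
  proof
    fix f :: "'v \<Rightarrow> nat" assume "f \<in> Poly_Mapping.lookup ` {e :: 'v \<Rightarrow>\<^sub>0 nat. edeg e = d}"
    then have d: "int (\<Sum>x\<in>UNIV. f x) = d" unfolding edeg_def by blast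
    have "f x \<le> (\<Sum>x\<in>UNIV. f x)" for x
      by (rule member_le_sum) simp_all
    then have "f x \<le> nat d" for x unfolding d[symmetric] nat_int .
    then show "f \<in> {f. \<forall>x. (x \<in> UNIV \<longrightarrow> f x \<in> {..nat d}) \<and> (x \<notin> UNIV \<longrightarrow> f x = 0)}" by simp
  qed
  moreover have "finite {f. \<forall>x :: 'v. (x \<in> UNIV \<longrightarrow> f x \<in> {..nat d}) \<and> (x \<notin> UNIV \<longrightarrow> f x = 0)}"
    by (rule finite_set_of_finite_funs) simp_all
  ultimately show "finite (Poly_Mapping.lookup ` {e :: 'v \<Rightarrow>\<^sub>0 nat. edeg e = d})"
    by (rule finite_subset)
qed

lemma homogeneous_fin: "vspace.fin_subspace (\<lambda>c p. cst c * p) (homogeneous d :: ('v::finite, 'k::field) mpoly set)"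
proof -
  interpret P: vspace "\<lambda>c p. cst c * p :: ('v, 'k) mpoly" by (rule vspace_mpoly)
  let ?B = "(\<lambda>e. Poly_Mapping.single e 1) ` {e. edeg e = d} :: ('v, 'k) mpoly set"
  have cm: "cst c * p \<in> homogeneous d" if "p \<in> homogeneous d" for c and p :: "('v, 'k) mpoly"
    using homogeneous_mult[OF homogeneous_cst that, of c] by simp
  have "P.subspace (homogeneous d)"
    unfolding P.subspace_def by (simp add: cm)
  moreover have "homogeneous d \<subseteq> P.span ?B"
  proof
    fix p :: "('v, 'k) mpoly" assume p: "p \<in> homogeneous d"
    have "(\<Sum>e\<in>Poly_Mapping.keys p. cst (coef p e) * Poly_Mapping.single e 1) \<in> P.span ?B"
      by (intro P.span_sum P.span_scale P.span_base) (use homogeneousD[OF p] in \<open>auto simp: in_keys_iff\<close>)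
    moreover have "(\<Sum>e\<in>Poly_Mapping.keys p. cst (coef p e) * Poly_Mapping.single e 1) = p"
      using mpoly_monomials[of p] by (simp add: cst_def mult_single)
    ultimately show "p \<in> P.span ?B" by simp
  qed
  ultimately show ?thesis unfolding P.fin_subspace_def using finite_exponents by blast
qed

locale resolution = graded_free_resolution scale G F + variables vr n
  for scale :: "('v::finite, 'k::field) mpoly \<Rightarrow> 'm::ab_group_add \<Rightarrow> 'm"
    and G :: "int \<Rightarrow> 'm set" and F :: "('v, 'k, 'm) free_complex"
    and vr :: "nat \<Rightarrow> 'v" and n :: nat
begin

abbreviation "r \<equiv> fr_rank F"

abbreviation "dg \<equiv> fr_deg F"

abbreviation "dif q k l \<equiv> index_mat (fr_diff F q) (k, l)"

definition msc :: "'k \<Rightarrow> 'm \<Rightarrow> 'm" where "msc c x = scale (cst c) x"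

definition XM :: "nat \<Rightarrow> 'm \<Rightarrow> 'm" where "XM i x = scale (Var i) x"

abbreviation fsc :: "'k \<Rightarrow> (nat \<Rightarrow> ('v, 'k) mpoly) \<Rightarrow> nat \<Rightarrow> ('v, 'k) mpoly" where
  "fsc \<equiv> fun_scale (\<lambda>c p. cst c * p)"

definition XF :: "nat \<Rightarrow> (nat \<Rightarrow> ('v, 'k) mpoly) \<Rightarrow> nat \<Rightarrow> ('v, 'k) mpoly" where
  "XF i v = (\<lambda>k. Var i * v k)"

text \<open>\<open>Ev q j\<close> is the degree \<open>j\<close> part of the \<open>q\<close>-th free module.\<close>

definition Ev :: "nat \<Rightarrow> int \<Rightarrow> (nat \<Rightarrow> ('v, 'k) mpoly) set" where
  "Ev q j = {v. (\<forall>k<r q. v k \<in> homogeneous (j - dg q k)) \<and> (\<forall>k\<ge>r q. v k = 0)}"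

text \<open>The differential on functions vanishing from the rank on, which form a vector space
  under pointwise operations; \<open>Dm_vec\<close> translates to matrices and vectors.\<close>

definition Dm :: "nat \<Rightarrow> (nat \<Rightarrow> ('v, 'k) mpoly) \<Rightarrow> nat \<Rightarrow> ('v, 'k) mpoly" where
  "Dm q v = (\<lambda>k. if k < r q then \<Sum>l<r (q + 1). dif q k l * v l else 0)"

definition Nn :: "nat \<Rightarrow> int \<Rightarrow> (nat \<Rightarrow> ('v, 'k) mpoly) set" where
  "Nn q j = Dm q ` Ev (q + 1) j"

definition aug :: "(nat \<Rightarrow> ('v, 'k) mpoly) \<Rightarrow> 'm" where
  "aug v = (\<Sum>k<r 0. scale (v k) (fr_aug F k))"

definition hv :: "nat \<Rightarrow> int \<Rightarrow> (nat \<Rightarrow> ('v, 'k) mpoly) \<Rightarrow> nat \<Rightarrow> ('v, 'k) mpoly" where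
  "hv q j v = (\<lambda>k. if k < r q then hcomp (j - dg q k) (v k) else 0)"

lemma EvI: "(\<And>k. k < r q \<Longrightarrow> v k \<in> homogeneous (j - dg q k)) \<Longrightarrow> (\<And>k. k \<ge> r q \<Longrightarrow> v k = 0) \<Longrightarrow> v \<in> Ev q j"
  by (simp add: Ev_def)

lemma EvD: "v \<in> Ev q j \<Longrightarrow> k < r q \<Longrightarrow> v k \<in> homogeneous (j - dg q k)"
  "v \<in> Ev q j \<Longrightarrow> k \<ge> r q \<Longrightarrow> v k = 0"
  by (simp_all add: Ev_def)

lemma Ev_simps: "0 \<in> Ev q j" "v \<in> Ev q j \<Longrightarrow> w \<in> Ev q j \<Longrightarrow> v + w \<in> Ev q j"
  "v \<in> Ev q j \<Longrightarrow> w \<in> Ev q j \<Longrightarrow> v - w \<in> Ev q j"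
  by (simp_all add: Ev_def)

lemma dif_homogeneous: "k < r q \<Longrightarrow> l < r (q + 1) \<Longrightarrow> dif q k l \<in> homogeneous (dg (q + 1) l - dg q k)"
  by (rule diff_homogeneous)

lemma vspace_F: "vspace fsc"
  by (rule vspace_fun[OF vspace_mpoly])

lemma vspace_M: "vspace msc"
  by unfold_locales (simp_all add: msc_def cst_simps scale_right_distrib scale_left_distrib)

lemma Dm_simps: "Dm q (v + w) = Dm q v + Dm q w" "Dm q (v - w) = Dm q v - Dm q w" "Dm q 0 = 0"
  "Dm q (- v) = - Dm q v" "Dm q (fsc c v) = fsc c (Dm q v)"
  by (simp_all add: Dm_def fun_eq_iff distrib_left right_diff_distrib sum.distrib sum_subtractf
      fun_scale_def sum_distrib_left mult.left_commute sum_negf)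

lemma aug_simps: "aug (v + w) = aug v + aug w" "aug (v - w) = aug v - aug w" "aug 0 = 0"
  "aug (- v) = - aug v" "aug (fsc c v) = msc c (aug v)"
  by (simp_all add: aug_def scale_left_distrib scale_left_diff_distrib sum.distrib sum_subtractf
      fun_scale_def msc_def scale_sum_right sum_negf)

lemma XF_Dm: "Dm q (XF i v) = XF i (Dm q v)"
  by (simp add: Dm_def XF_def fun_eq_iff sum_distrib_left mult.left_commute)

lemma XF_aug: "aug (XF i v) = XM i (aug v)"
  by (simp add: aug_def XF_def XM_def scale_sum_right)

lemma Dm_Ev: "v \<in> Ev (q + 1) j \<Longrightarrow> Dm q v \<in> Ev q j"
proof (rule EvI)
  fix k assume v: "v \<in> Ev (q + 1) j" and k: "k < r q"
  have "dif q k l * v l \<in> homogeneous (j - dg q k)" if "l < r (q + 1)" for l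
    using homogeneous_mult[OF dif_homogeneous[OF k that] EvD(1)[OF v that]] by simp
  then show "Dm q v k \<in> homogeneous (j - dg q k)"
    using k unfolding Dm_def by (simp only: if_True) (rule homogeneous_sum, simp only: lessThan_iff)
qed (simp add: Dm_def)

lemma hv_Ev: "hv q j v \<in> Ev q j"
  by (rule EvI) (simp_all add: hv_def hcomp_homogeneous)

lemma hv_id: "v \<in> Ev q j \<Longrightarrow> hv q j v = v"
  by (auto simp: hv_def fun_eq_iff hcomp_of_homogeneous[OF EvD(1)] EvD(2))

lemma hv_Dm: "Dm q (hv (q + 1) j v) = hv q j (Dm q v)"
proof
  fix k
  show "Dm q (hv (q + 1) j v) k = hv q j (Dm q v) k"
  proof (cases "k < r q")
    case True
    have "dif q k l * hcomp (j - dg (q + 1) l) (v l) = hcomp (j - dg q k) (dif q k l * v l)"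
      if "l < r (q + 1)" for l
      using hcomp_mult[OF dif_homogeneous[OF True that], of "j - dg (q + 1) l" "v l"] by simp
    then show ?thesis using True by (simp add: Dm_def hv_def hcomp_sum)
  qed (simp add: Dm_def hv_def)
qed

lemma Dm_vec: "vec (r q) (Dm q v) = fr_diff F q *\<^sub>v vec (r (q + 1)) v"
proof (rule eq_vecI)
  show "dim_vec (vec (r q) (Dm q v)) = dim_vec (fr_diff F q *\<^sub>v vec (r (q + 1)) v)"
    using diff_carrier[of q] by simp
  fix k assume "k < dim_vec (fr_diff F q *\<^sub>v vec (r (q + 1)) v)"
  then have k: "k < r q" using diff_carrier[of q] by simp
  show "vec_index (vec (r q) (Dm q v)) k = vec_index (fr_diff F q *\<^sub>v vec (r (q + 1)) v) k"
    using k diff_carrier[of q] by (auto simp: Dm_def scalar_prod_def lessThan_atLeast0 intro!: sum.cong)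
qed

lemma Dm_Dm: "Dm q (Dm (q + 1) v) = 0"
proof
  fix k
  have "vec (r (q + 1)) (Dm (q + 1) v) \<in> {v \<in> carrier_vec (r (q + 1)). fr_diff F q *\<^sub>v v = 0\<^sub>v (r q)}"
    unfolding exact_Suc Dm_vec[of "q + 1"] by (intro imageI) (simp add: numeral_2_eq_2)
  then have e: "vec (r q) (Dm q (Dm (q + 1) v)) = 0\<^sub>v (r q)" unfolding Dm_vec[of q] by simp
  show "Dm q (Dm (q + 1) v) k = 0 k"
  proof (cases "k < r q")
    case True
    then show ?thesis using arg_cong[OF e, of "\<lambda>w. vec_index w k"] by simp
  qed (simp add: Dm_def)
qed

text \<open>Exactness provides some preimage. Since \<open>Dm\<close> commutes with the projection
  \<open>hv\<close> to degree \<open>j\<close>, the component of degree \<open>j\<close> of this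
  preimage is again a preimage.\<close>

lemma exact_Dm:
  assumes v: "v \<in> Ev (q + 1) j" "Dm q v = 0"
  shows "\<exists>u\<in>Ev (q + 2) j. Dm (q + 1) u = v"
proof -
  have "fr_diff F q *\<^sub>v vec (r (q + 1)) v = 0\<^sub>v (r q)"
    unfolding Dm_vec[symmetric] v(2) by (rule eq_vecI) simp_all
  then have "vec (r (q + 1)) v \<in> (*\<^sub>v) (fr_diff F (q + 1)) ` carrier_vec (r (q + 2))"
    unfolding exact_Suc[symmetric] by simp
  then obtain x where x: "x \<in> carrier_vec (r (q + 2))" "vec (r (q + 1)) v = fr_diff F (q + 1) *\<^sub>v x"
    by blast
  define u where "u = vec_index x"
  have "vec (r (q + 2)) u = x" unfolding u_def by (rule eq_vecI) (use x(1) in auto)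
  then have e: "vec (r (q + 1)) v = vec (r (q + 1)) (Dm (q + 1) u)"
    unfolding x(2) Dm_vec[of "q + 1"] by (simp add: numeral_2_eq_2)
  have "v k = Dm (q + 1) u k" for k
  proof (cases "k < r (q + 1)")
    case True
    then show ?thesis using arg_cong[OF e, of "\<lambda>w. vec_index w k"] by simp
  next
    case False then show ?thesis using EvD(2)[OF v(1), of k] by (simp add: Dm_def)
  qed
  then have "v = Dm (q + 1) u" by (rule ext)
  then have "hv (q + 1) j v = Dm (q + 1) (hv (q + 2) j u)"
    using hv_Dm[of "q + 1" j u] by (simp add: numeral_2_eq_2)
  then show ?thesis using hv_id[OF v(1)] hv_Ev by (intro bexI[of _ "hv (q + 2) j u"]) simp_all
qed

lemma aug_vec: "augmentation scale F (vec (r 0) v) = aug v"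
  by (simp add: augmentation_def aug_def)

lemma aug_G: "v \<in> Ev 0 j \<Longrightarrow> aug v \<in> G j"
proof -
  assume v: "v \<in> Ev 0 j"
  have G_add: "x + y \<in> G j" if "x \<in> G j" "y \<in> G j" for x y
    using component_diff[OF that(1) component_diff[OF component_zero that(2)]] by simp
  have s: "scale (v k) (fr_aug F k) \<in> G j" if "k < r 0" for k
    using component_scale[OF EvD(1)[OF v that] aug_homogeneous[OF that]] by simp
  have "(\<Sum>k\<in>K. scale (v k) (fr_aug F k)) \<in> G j" if "finite K" "K \<subseteq> {..<r 0}" for K
    using that by (induction rule: finite_induct) (auto simp: component_zero intro!: G_add s)
  then show ?thesis unfolding aug_def by blast
qed

lemma graded_zero:
  assumes A: "finite A" "\<And>d. d \<in> A \<Longrightarrow> y d \<in> G d" "(\<Sum>d\<in>A. y d) = 0" "d \<in> A"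
  shows "y d = 0"
proof -
  define y' where "y' d = (if d \<in> A then y d else 0)" for d
  have "(\<Sum>d | y' d \<noteq> 0. y' d) = (\<Sum>d\<in>A. y' d)"
    by (rule sum.mono_neutral_left) (use A(1) in \<open>auto simp: y'_def\<close>)
  then have s: "0 = (\<Sum>d | y' d \<noteq> 0. y' d)" using A(3) by (simp add: y'_def)
  have f: "finite {d. y' d \<noteq> 0}" by (rule finite_subset[OF _ A(1)]) (auto simp: y'_def)
  have g: "\<forall>d. y' d \<in> G d" using A(2) component_zero by (simp add: y'_def)
  have "y' = (\<lambda>_. 0)"
    using direct_sum[of 0] g f s component_zero by (elim ex1E) (metis (mono_tags, lifting) empty_Collect_eq finite.emptyI sum.empty)
  then show ?thesis using A(4) by (auto simp: y'_def fun_eq_iff split: if_splits)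
qed

text \<open>Surjectivity gives a possibly inhomogeneous preimage \<open>v\<close>. Comparing the
  degree \<open>j\<close> parts of \<open>aug v = z\<close> in the direct sum shows that the degree
  \<open>j\<close> component of \<open>v\<close> maps to \<open>z\<close>.\<close>

lemma aug_lift:
  assumes z: "z \<in> G j"
  shows "\<exists>v\<in>Ev 0 j. aug v = z"
proof -
  obtain x where x: "x \<in> carrier_vec (r 0)" "augmentation scale F x = z"
    using aug_surj by (metis UNIV_I imageE)
  define v where "v k = (if k < r 0 then vec_index x k else 0)" for k
  have "vec (r 0) v = x" by (rule eq_vecI) (use x(1) in \<open>auto simp: v_def\<close>)
  then have v: "aug v = z" using x(2) aug_vec[of v] by simp
  \<comment> \<open>All degrees in which \<open>v\<close> has a component, together with
    \<open>j\<close>.\<close>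
  define D where "D = insert j (\<Union>k<r 0. (\<lambda>d. d + dg 0 k) ` edeg ` Poly_Mapping.keys (v k))"
  have D: "finite D" by (simp add: D_def)
  have "(\<Sum>d\<in>D. hv 0 d v) k = v k" for k
  proof (cases "k < r 0")
    case True
    have "(\<Sum>d\<in>D. hv 0 d v) k = (\<Sum>d\<in>D. hcomp (d - dg 0 k) (v k))"
      using True by (simp add: sum_fun_app hv_def)
    also have "\<dots> = (\<Sum>d\<in>(\<lambda>d. d - dg 0 k) ` D. hcomp d (v k))"
      by (subst sum.reindex) (auto intro: inj_onI)
    also have "\<dots> = v k"
    proof (rule sum_hcomp)
      show "edeg ` Poly_Mapping.keys (v k) \<subseteq> (\<lambda>d. d - dg 0 k) ` D"
      proof
        fix e assume "e \<in> edeg ` Poly_Mapping.keys (v k)"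
        then have "e + dg 0 k \<in> D" using True by (auto simp: D_def)
        then show "e \<in> (\<lambda>d. d - dg 0 k) ` D" by (rule rev_image_eqI) simp
      qed
    qed (simp add: D)
    finally show ?thesis .
  qed (simp add: sum_fun_app hv_def v_def)
  then have sv: "(\<Sum>d\<in>D. hv 0 d v) = v" by (rule ext)
  have asum: "aug (\<Sum>d\<in>A. h d) = (\<Sum>d\<in>A. aug (h d))" for A :: "int set" and h
  proof -
    interpret Modules.additive aug by unfold_locales (rule aug_simps)
    show ?thesis by (rule sum)
  qed
  define y where "y d = aug (hv 0 d v) - (if d = j then z else 0)" for d
  have yG: "y d \<in> G d" for d
    unfolding y_def by (rule component_diff) (simp_all add: aug_G hv_Ev z component_zero)
  have y0: "(\<Sum>d\<in>D. y d) = 0"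
  proof -
    have "(\<Sum>d\<in>D. y d) = aug (\<Sum>d\<in>D. hv 0 d v) - (\<Sum>d\<in>D. if d = j then z else 0)"
      by (simp add: y_def sum_subtractf asum)
    also have "(\<Sum>d\<in>D. if d = j then z else 0) = z" using D by (simp add: D_def)
    finally show ?thesis using v sv by simp
  qed
  have "y j = 0" using graded_zero[of D y j, OF D yG y0] by (simp add: D_def)
  then show ?thesis by (intro bexI[of _ "hv 0 j v"]) (simp_all add: y_def hv_Ev)
qed

lemma aug_Dm: "aug (Dm 0 v) = 0"
proof -
  have "vec (r 0) (Dm 0 v) \<in> {v \<in> carrier_vec (r 0). augmentation scale F v = 0}"
    unfolding exact_0 Dm_vec by (intro imageI) simp
  then show ?thesis unfolding aug_vec[symmetric] by simp
qed

lemma exact_aug: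
  assumes v: "v \<in> Ev 0 j" "aug v = 0"
  shows "\<exists>u\<in>Ev 1 j. Dm 0 u = v"
proof -
  have "vec (r 0) v \<in> (*\<^sub>v) (fr_diff F 0) ` carrier_vec (r 1)"
    unfolding exact_0[symmetric] using v(2) by (simp add: aug_vec)
  then obtain x where x: "x \<in> carrier_vec (r 1)" "vec (r 0) v = fr_diff F 0 *\<^sub>v x"
    by blast
  define u where "u = vec_index x"
  have "vec (r 1) u = x" unfolding u_def by (rule eq_vecI) (use x(1) in auto)
  then have e: "vec (r 0) v = vec (r 0) (Dm 0 u)"
    unfolding x(2) Dm_vec[of 0] by simp
  have "v k = Dm 0 u k" for k
  proof (cases "k < r 0")
    case True
    then show ?thesis using arg_cong[OF e, of "\<lambda>w. vec_index w k"] by simp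
  next
    case False then show ?thesis using EvD(2)[OF v(1), of k] by (simp add: Dm_def)
  qed
  then have "v = Dm 0 u" by (rule ext)
  then have "hv 0 j v = Dm 0 (hv 1 j u)"
    using hv_Dm[of 0 j u] by simp
  then show ?thesis using hv_id[OF v(1)] hv_Ev[of 1 j u] by (intro bexI[of _ "hv 1 j u"]) simp_all
qed

lemma Ev_fin: "vspace.fin_subspace fsc (Ev q j)"
proof -
  interpret P: vspace "\<lambda>c p. cst c * p :: ('v, 'k) mpoly" by (rule vspace_mpoly)
  interpret FF: vspace fsc by (rule vspace_F)
  have "\<exists>B. finite B \<and> homogeneous (j - dg q k) \<subseteq> P.span B" for k
    using homogeneous_fin[of "j - dg q k", where 'k = 'k and 'v = 'v] unfolding P.fin_subspace_def by blast
  then obtain B where B: "\<And>k. finite (B k)" "\<And>k. homogeneous (j - dg q k) \<subseteq> P.span (B k)" by metis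
  let ?H = "P.span (\<Union>k<r q. B k)"
  have "P.fin_subspace ?H" by (rule P.fin_subspace_span) (simp add: B)
  from P.fun_on_fin_subspace[OF _ this, of "{..<r q}"]
  have "FF.fin_subspace (fun_on {..<r q} ?H)" by simp
  moreover have "Ev q j \<subseteq> fun_on {..<r q} ?H"
  proof
    fix v assume v: "v \<in> Ev q j"
    show "v \<in> fun_on {..<r q} ?H"
    proof (rule fun_onI)
      fix k assume k: "k \<in> {..<r q}"
      then have "v k \<in> P.span (B k)" using EvD(1)[OF v] B(2) by blast
      moreover have "P.span (B k) \<subseteq> ?H" using k by (intro P.span_mono) blast
      ultimately show "v k \<in> ?H" by blast
    qed (use EvD(2)[OF v] in simp)
  qed
  moreover have "FF.subspace (Ev q j)"
  proof -
    have "fsc c v \<in> Ev q j" if "v \<in> Ev q j" for c v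
      by (rule EvI) (use EvD[OF that] homogeneous_mult[OF homogeneous_cst, of "v _" "j - dg q _" c]
        in \<open>simp_all add: fun_scale_def\<close>)
    then show ?thesis unfolding FF.subspace_def using Ev_simps by simp
  qed
  ultimately show ?thesis using FF.fin_subspace_mono by blast
qed

lemma gops_F: "gops fsc XF n (Ev q)"
proof -
  interpret FF: vspace fsc by (rule vspace_F)
  show ?thesis
  proof unfold_locales
    show "FF.fin_subspace (Ev q d)" for d by (rule Ev_fin)
    show "XF i (x + y) = XF i x + XF i y" for i x y by (simp add: XF_def fun_eq_iff distrib_left)
    show "XF i (fsc c x) = fsc c (XF i x)" for i c x
      by (simp add: XF_def fun_eq_iff fun_scale_def mult.left_commute)
    show "XF i (XF j x) = XF j (XF i x)" for i j x by (simp add: XF_def fun_eq_iff mult.left_commute)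
    show "XF i x \<in> Ev q (d + 1)" if "x \<in> Ev q d" for i x d
    proof (rule EvI)
      fix k assume k: "k < r q"
      show "XF i x k \<in> homogeneous (d + 1 - dg q k)"
        using homogeneous_mult[OF homogeneous_Var EvD(1)[OF that k], of i] by (simp add: XF_def algebra_simps)
    qed (simp add: XF_def EvD(2)[OF that])
  qed
qed

lemma aug_linear: "Vector_Spaces.linear fsc msc aug"
proof -
  interpret FF: vspace fsc by (rule vspace_F)
  interpret MM: vspace msc by (rule vspace_M)
  show ?thesis by unfold_locales (rule aug_simps)+
qed

lemma Dm_linear: "Vector_Spaces.linear fsc fsc (Dm q)"
proof -
  interpret FF: vspace fsc by (rule vspace_F)
  show ?thesis by unfold_locales (rule Dm_simps)+
qed

lemma G_eq_aug: "G j = aug ` Ev 0 j"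
  using aug_lift aug_G by blast

lemma gops_M: "gops msc XM n G"
proof -
  interpret FF: vspace fsc by (rule vspace_F)
  interpret MM: vspace msc by (rule vspace_M)
  interpret FM: vspace_pair fsc msc ..
  show ?thesis
  proof unfold_locales
    show "MM.fin_subspace (G d)" for d
      unfolding G_eq_aug by (rule FM.fin_subspace_image[OF aug_linear Ev_fin])
    show "XM i (x + y) = XM i x + XM i y" for i x y by (simp add: XM_def scale_right_distrib)
    show "XM i (msc c x) = msc c (XM i x)" for i c x by (simp add: XM_def msc_def mult.commute)
    show "XM i (XM j x) = XM j (XM i x)" for i j x by (simp add: XM_def mult.commute)
    show "XM i x \<in> G (d + 1)" if "x \<in> G d" for i x d
      using component_scale[OF homogeneous_Var that, of i] by (simp add: XM_def add.commute)
  qed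
qed

lemma gsub_Nn: "gops.gsub fsc XF n (Ev q) (Nn q)"
proof -
  interpret FQ: gops fsc XF n "Ev q" by (rule gops_F)
  interpret FQ': gops fsc XF n "Ev (q + 1)" by (rule gops_F)
  interpret FF: vspace_pair fsc fsc ..
  show ?thesis
    unfolding FQ.gsub_def
  proof (intro conjI allI impI)
    show "FQ.subspace (Nn q d)" for d
      unfolding Nn_def by (rule FQ.fin_subspaceD[OF FF.fin_subspace_image[OF Dm_linear Ev_fin]])
    show "Nn q d \<subseteq> Ev q d" for d unfolding Nn_def using Dm_Ev by blast
    show "XF i x \<in> Nn q (d + 1)" if "i < n" "x \<in> Nn q d" for d i x
      using that FQ'.X_G[OF that(1)] unfolding Nn_def by (auto simp: XF_Dm[symmetric])
  qed
qed

lemma Nn_iff: "v \<in> Ev (q + 1) j \<Longrightarrow> v \<in> Nn (q + 1) j \<longleftrightarrow> Dm q v = 0"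
  using exact_Dm[of v q j] Dm_Dm[of q] by (auto simp: Nn_def numeral_2_eq_2)

lemma Nn_0_iff: "v \<in> Ev 0 j \<Longrightarrow> v \<in> Nn 0 j \<longleftrightarrow> aug v = 0"
  using exact_aug[of v j] aug_Dm by (auto simp: Nn_def)

lemma kd_Dm: "kd XF n (\<lambda>T. Dm q (f T)) = (\<lambda>T. Dm q (kd XF n f T))"
  by (rule kd_map[where \<phi> = "Dm q" and f = f and X = XF and X' = XF]) (simp_all only: Dm_simps XF_Dm)

lemma kd_aug: "kd XM n (\<lambda>T. aug (f T)) = (\<lambda>T. aug (kd XF n f T))"
  by (rule kd_map[where \<phi> = aug and f = f and X = XF and X' = XM]) (simp_all only: aug_simps XF_aug)

lemma kd_XF: "kd XF n f T k = kd (\<lambda>i p. Var i * p) n (\<lambda>T. f T k) T"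
proof -
  have "ksign i T (v :: nat \<Rightarrow> ('v, 'k) mpoly) k = ksign i T (v k)" for i T v by (simp add: ksign_def)
  then show ?thesis by (simp add: kd_def sum_fun_app XF_def)
qed

text \<open>The Koszul complex of a free module splits into copies of that of the polynomial ring,
  so the homotopy applies coordinatewise; only constants in homological degree 0 are not
  boundaries.\<close>

lemma koszul_exact:
  assumes f: "f \<in> chains n p (Ev q e)" and df: "kd XF n f = 0"
    and const: "p = 0 \<Longrightarrow> (\<And>k. coef (f {} k) 0 = 0)"
  shows "\<exists>g\<in>chains n (p + 1) (Ev q (e - 1)). kd XF n g = f"
proof -
  define g where "g T k = htp (\<lambda>T. f T k) T" for T k
  have fk: "(\<lambda>T. f T k) \<in> chains n p UNIV" for k
    by (rule chainsI) (simp_all add: chains_outside[OF f])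
  have fh: "f T k \<in> homogeneous (e - dg q k)" if "k < r q" for T k
    by (rule EvD(1)[OF chains_in[OF f Ev_simps(1)] that])
  have dfk: "kd (\<lambda>i p. Var i * p) n (\<lambda>T. f T k) = 0" for k
    by (rule ext) (simp add: kd_XF[symmetric] df)
  have "kd XF n g = f"
  proof (intro ext)
    fix T k
    have "kd XF n g T k = kd (\<lambda>i p. Var i * p) n (htp (\<lambda>T. f T k)) T"
      unfolding kd_XF g_def ..
    also have "\<dots> = f T k"
      using fun_cong[OF koszul_homotopy[OF fk[of k] dfk const], of T] by simp
    finally show "kd XF n g T k = f T k" .
  qed
  moreover have "g \<in> chains n (p + 1) (Ev q (e - 1))"
  proof (rule chainsI)
    fix T
    show "g T \<in> Ev q (e - 1)"
    proof (rule EvI)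
      fix k assume "k < r q"
      show "g T k \<in> homogeneous (e - 1 - dg q k)"
        using htp_homogeneous[of "\<lambda>T. f T k" "e - dg q k" T] fh[OF \<open>k < r q\<close>] by (simp add: g_def algebra_simps)
    next
      fix k assume "k \<ge> r q"
      then have "f T k = 0" for T by (rule EvD(2)[OF chains_in[OF f Ev_simps(1)]])
      then show "g T k = 0" by (simp add: g_def poly_mapping_eqI coef_htp)
    qed
    assume T: "\<not> (T \<subseteq> {..<n} \<and> card T = p + 1)"
    show "g T = 0"
      using chains_outside[OF htp_chains[OF fk] T] by (simp add: g_def fun_eq_iff)
  qed
  ultimately show ?thesis by blast
qed

end

section \<open>Dimension shifting along the resolution\<close>

context resolution
begin

text \<open>
  \<open>khF q\<close> is the Koszul homology of the cokernel of the differential with index \<open>q\<close>. Shifting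
  dimensions along the resolution reduces \<open>khM i\<close> to \<open>khF (i - 1) 1\<close>, which is computed on the residue
  complex.
\<close>

definition khM :: "nat \<Rightarrow> int \<Rightarrow> int" where
  "khM p j = gops.kh msc XM n G (\<lambda>_. {0}) p j"

definition khF :: "nat \<Rightarrow> nat \<Rightarrow> int \<Rightarrow> int" where
  "khF q p j = gops.kh fsc XF n (Ev q) (Nn q) p j"

lemma aug_chain_lift: "z \<in> chains n p (G e) \<Longrightarrow> \<exists>v\<in>chains n p (Ev 0 e). (\<lambda>T. aug (v T)) = z"
  by (rule chains_lift[where \<phi> = aug], assumption, erule aug_lift, rule aug_simps(3))

text \<open>By exactness \<open>aug\<close> identifies \<open>Ev 0\<close> modulo
  \<open>Nn 0\<close> with the module in each degree; chains correspond by lifting along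
  \<open>aug\<close>.\<close>

lemma khM_eq_khF: "khM p j = khF 0 p j"
proof -
  interpret M: gops msc XM n G by (rule gops_M)
  interpret F0: gops fsc XF n "Ev 0" by (rule gops_F)
  show ?thesis
    unfolding khM_def khF_def M.kh_def F0.kh_def
  proof (rule subquotient_dim_eq[where R = "\<lambda>z v. (\<lambda>T. aug (v T)) = z"])
    show "vspace (fun_scale msc :: 'k \<Rightarrow> (nat set \<Rightarrow> 'm) \<Rightarrow> nat set \<Rightarrow> 'm)"
      by (rule vspace_fun[OF vspace_M])
    show "vspace (fun_scale fsc :: 'k \<Rightarrow> (nat set \<Rightarrow> nat \<Rightarrow> ('v, 'k) mpoly) \<Rightarrow> nat set \<Rightarrow> nat \<Rightarrow> ('v, 'k) mpoly)"
      by (rule vspace_fun[OF vspace_F])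
    show "M.fs.fin_subspace (M.cyc (\<lambda>_. {0}) p j)" by (rule M.cyc_fin[OF M.gsub_zero])
    show "F0.fs.fin_subspace (F0.cyc (Nn 0) p j)" by (rule F0.cyc_fin[OF gsub_Nn])
    show "M.fs.subspace (M.bnd (\<lambda>_. {0}) p j)" by (rule M.bnd_subspace[OF M.gsub_zero])
    show "M.bnd (\<lambda>_. {0}) p j \<subseteq> M.cyc (\<lambda>_. {0}) p j" by (rule M.bnd_cyc[OF M.gsub_zero])
    show "F0.fs.subspace (F0.bnd (Nn 0) p j)" by (rule F0.bnd_subspace[OF gsub_Nn])
    show "F0.bnd (Nn 0) p j \<subseteq> F0.cyc (Nn 0) p j" by (rule F0.bnd_cyc[OF gsub_Nn])
    show "(\<lambda>T. aug (0 T)) = 0" by (simp add: aug_simps fun_eq_iff)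
    show "(\<lambda>T. aug ((v + v') T)) = z + z'" if "(\<lambda>T. aug (v T)) = z" "(\<lambda>T. aug (v' T)) = z'" for z v z' v'
      unfolding that[symmetric] by (simp add: aug_simps fun_eq_iff)
    show "(\<lambda>T. aug (fun_scale fsc c v T)) = fun_scale msc c z" if "(\<lambda>T. aug (v T)) = z" for c z v
      unfolding that[symmetric] by (simp add: aug_simps fun_eq_iff fun_scale_def[of fsc] fun_scale_def[of msc])
  next
    fix z assume "z \<in> M.cyc (\<lambda>_. {0}) p j"
    then have z: "z \<in> chains n p (G (j - int p))" "kd XM n z = 0"
      by (auto simp: M.cyc_def dest: chains_trivial)
    obtain v where v: "v \<in> chains n p (Ev 0 (j - int p))" "(\<lambda>T. aug (v T)) = z"
      using aug_chain_lift[OF z(1)] by blast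
    have dv: "kd XF n v \<in> chains n (p - 1) (Ev 0 (j - int p + 1))" by (rule F0.kd_in_G[OF v(1)])
    have "aug (kd XF n v T) = 0" for T
      using fun_cong[OF kd_aug[of v], of T] unfolding v(2) z(2) by simp
    then have "kd XF n v T \<in> Nn 0 (j - int p + 1)" for T
      by (simp add: Nn_0_iff[OF chains_in[OF dv Ev_simps(1)]])
    then have "kd XF n v \<in> chains n (p - 1) (Nn 0 (j - int p + 1))" by (rule chains_cong_in[OF dv])
    then show "\<exists>v\<in>F0.cyc (Nn 0) p j. (\<lambda>T. aug (v T)) = z" using v by (auto simp: F0.cyc_def)
  next
    fix v assume "v \<in> F0.cyc (Nn 0) p j"
    then have v: "v \<in> chains n p (Ev 0 (j - int p))" "kd XF n v \<in> chains n (p - 1) (Nn 0 (j - int p + 1))"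
      by (auto simp: F0.cyc_def)
    have 0: "0 \<in> Nn 0 (j - int p + 1)" by (rule F0.gsub_simps(1)[OF gsub_Nn])
    have ax: "aug x = 0" if "x \<in> Nn 0 e" for x e using that by (auto simp: Nn_def aug_Dm)
    have "aug (kd XF n v T) = 0" for T by (rule ax[OF chains_in[OF v(2) 0]])
    then have "kd XM n (\<lambda>T. aug (v T)) = 0"
      unfolding kd_aug by (simp add: fun_eq_iff)
    moreover have "(\<lambda>T. aug (v T)) \<in> chains n p (G (j - int p))"
      by (rule chains_map[OF v(1)]) (simp_all only: aug_G aug_simps)
    ultimately show "\<exists>z\<in>M.cyc (\<lambda>_. {0}) p j. (\<lambda>T. aug (v T)) = z"
      using chains_zero[of "{0}" n "p - 1"] by (simp add: M.cyc_def)
  next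
    fix z v assume z: "z \<in> M.cyc (\<lambda>_. {0}) p j" and v: "v \<in> F0.cyc (Nn 0) p j" and R: "(\<lambda>T. aug (v T)) = z"
    have zG: "z \<in> chains n p (G (j - int p))" and vE: "v \<in> chains n p (Ev 0 (j - int p))"
      using z v by (auto simp: M.cyc_def F0.cyc_def)
    show "z \<in> M.bnd (\<lambda>_. {0}) p j \<longleftrightarrow> v \<in> F0.bnd (Nn 0) p j"
    proof
      assume "z \<in> M.bnd (\<lambda>_. {0}) p j"
      then obtain g where g: "g \<in> chains n (p + 1) (G (j - int p - 1))" "z - kd XM n g \<in> chains n p {0}"
        by (rule M.bndE)
      have zg: "z = kd XM n g" using chains_trivial[OF g(2)] by simp
      obtain h where h: "h \<in> chains n (p + 1) (Ev 0 (j - int p - 1))" "(\<lambda>T. aug (h T)) = g"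
        using aug_chain_lift[OF g(1)] by blast
      have dh: "kd XF n h \<in> chains n p (Ev 0 (j - int p))" using F0.kd_in_G[OF h(1)] by simp
      have w: "v - kd XF n h \<in> chains n p (Ev 0 (j - int p))"
        by (rule F0.fs.subspace_diff[OF F0.chains_subspace[OF F0.G_sub] vE dh])
      have "aug ((v - kd XF n h) T) = 0" for T
        using fun_cong[OF R, of T] fun_cong[OF kd_aug[of h], of T] fun_cong[OF zg, of T]
        unfolding h(2) by (simp add: aug_simps)
      then have "(v - kd XF n h) T \<in> Nn 0 (j - int p)" for T
        by (simp only: Nn_0_iff[OF chains_in[OF w Ev_simps(1)]])
      then have "v - kd XF n h \<in> chains n p (Nn 0 (j - int p))" by (rule chains_cong_in[OF w])
      then show "v \<in> F0.bnd (Nn 0) p j" by (rule F0.bndI[OF vE h(1)])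
    next
      assume "v \<in> F0.bnd (Nn 0) p j"
      then obtain h where h: "h \<in> chains n (p + 1) (Ev 0 (j - int p - 1))"
        "v - kd XF n h \<in> chains n p (Nn 0 (j - int p))" by (rule F0.bndE)
      have hG: "(\<lambda>T. aug (h T)) \<in> chains n (p + 1) (G (j - int p - 1))"
        by (rule chains_map[OF h(1)]) (simp_all only: aug_G aug_simps)
      have 0: "0 \<in> Nn 0 (j - int p)" by (rule F0.gsub_simps(1)[OF gsub_Nn])
      have ax: "aug x = 0" if "x \<in> Nn 0 e" for x e using that by (auto simp: Nn_def aug_Dm)
      have "z T - kd XM n (\<lambda>T. aug (h T)) T = 0" for T
        using ax[OF chains_in[OF h(2) 0, of T]] fun_cong[OF R, of T] fun_cong[OF kd_aug[of h], of T]
        by (simp add: aug_simps)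
      then have "z - kd XM n (\<lambda>T. aug (h T)) = 0" by (simp add: fun_eq_iff)
      then have "z - kd XM n (\<lambda>T. aug (h T)) \<in> chains n p {0}" using chains_zero[of "{0}" n p] by simp
      then show "z \<in> M.bnd (\<lambda>_. {0}) p j" by (rule M.bndI[OF zG hG])
    qed
  qed
qed

lemma Nn_map:
  assumes "f \<in> chains n p (Ev (q + 1) e)" "\<And>T. Dm q (f T) = 0"
  shows "f \<in> chains n p (Nn (q + 1) e)"
  by (rule chains_cong_in[OF assms(1)]) (simp only: Nn_iff[OF chains_in[OF assms(1) Ev_simps(1)]] assms(2))

lemma Nn_lift: "f \<in> chains n p (Nn q e) \<Longrightarrow> \<exists>g\<in>chains n p (Ev (q + 1) e). (\<lambda>T. Dm q (g T)) = f"
  by (rule chains_lift[where \<phi> = "Dm q"], assumption, unfold Nn_def, blast, rule Dm_simps(3))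

lemma Dm_Nn: "x \<in> Nn (q + 1) e \<Longrightarrow> Dm q x = 0"
  using Dm_Dm by (auto simp: Nn_def)

lemma Nn_0: "0 \<in> Nn q e"
proof -
  interpret FQ: gops fsc XF n "Ev q" by (rule gops_F)
  show ?thesis by (rule FQ.gsub_simps(1)[OF gsub_Nn])
qed

lemma Dm_chains: "g \<in> chains n p (Ev (q + 1) e) \<Longrightarrow> (\<lambda>T. Dm q (g T)) \<in> chains n p (Nn q e)"
  by (rule chains_map[where \<phi> = "Dm q"], assumption, unfold Nn_def, erule imageI, rule Dm_simps(3))

lemma Nn_Ev: "Nn q e \<subseteq> Ev q e"
  unfolding Nn_def using Dm_Ev by blast

text \<open>The connecting isomorphism. The image of \<open>Dm q\<close> is the cokernel of the next
  differential, and the free module in between has no Koszul homology in degrees \<open>p\<close>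
  and \<open>p - 1\<close>, both positive. The relation \<open>kd XF n f = Dm q g\<close> is the
  snake-lemma correspondence.\<close>

lemma khF_shift:
  assumes p: "p \<ge> 2"
  shows "khF q p j = khF (q + 1) (p - 1) j"
proof -
  interpret A: gops fsc XF n "Ev q" by (rule gops_F)
  interpret B: gops fsc XF n "Ev (q + 1)" by (rule gops_F)
  have p1: "j - int (p - 1) = j - int p + 1" using p by simp
  show ?thesis
    unfolding khF_def A.kh_def B.kh_def
  proof (rule subquotient_dim_eq[where R = "\<lambda>f g. kd XF n f = (\<lambda>T. Dm q (g T))"])
    show "vspace (fun_scale fsc :: 'k \<Rightarrow> (nat set \<Rightarrow> nat \<Rightarrow> ('v, 'k) mpoly) \<Rightarrow> nat set \<Rightarrow> nat \<Rightarrow> ('v, 'k) mpoly)"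
      by (rule vspace_fun[OF vspace_F])
    then show "vspace (fun_scale fsc :: 'k \<Rightarrow> (nat set \<Rightarrow> nat \<Rightarrow> ('v, 'k) mpoly) \<Rightarrow> nat set \<Rightarrow> nat \<Rightarrow> ('v, 'k) mpoly)" .
    show "A.fs.fin_subspace (A.cyc (Nn q) p j)" by (rule A.cyc_fin[OF gsub_Nn])
    show "A.fs.fin_subspace (B.cyc (Nn (q + 1)) (p - 1) j)" by (rule B.cyc_fin[OF gsub_Nn])
    show "A.fs.subspace (A.bnd (Nn q) p j)" by (rule A.bnd_subspace[OF gsub_Nn])
    show "A.bnd (Nn q) p j \<subseteq> A.cyc (Nn q) p j" by (rule A.bnd_cyc[OF gsub_Nn])
    show "A.fs.subspace (B.bnd (Nn (q + 1)) (p - 1) j)" by (rule B.bnd_subspace[OF gsub_Nn])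
    show "B.bnd (Nn (q + 1)) (p - 1) j \<subseteq> B.cyc (Nn (q + 1)) (p - 1) j" by (rule B.bnd_cyc[OF gsub_Nn])
    show "kd XF n 0 = (\<lambda>T. Dm q (0 T))" by (simp add: Dm_simps fun_eq_iff)
    show "kd XF n (f + f') = (\<lambda>T. Dm q ((g + g') T))"
      if "kd XF n f = (\<lambda>T. Dm q (g T))" "kd XF n f' = (\<lambda>T. Dm q (g' T))" for f g f' g'
      unfolding A.kd_simps that by (simp add: Dm_simps fun_eq_iff)
    show "kd XF n (fun_scale fsc c f) = (\<lambda>T. Dm q (fun_scale fsc c g T))" if "kd XF n f = (\<lambda>T. Dm q (g T))" for c f g
      unfolding A.kd_simps that unfolding fun_scale_def[of fsc] Dm_simps ..
  next
    fix f assume "f \<in> A.cyc (Nn q) p j"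
    then have f: "f \<in> chains n p (Ev q (j - int p))" "kd XF n f \<in> chains n (p - 1) (Nn q (j - int p + 1))"
      by (auto simp: A.cyc_def)
    obtain g where g: "g \<in> chains n (p - 1) (Ev (q + 1) (j - int p + 1))" "(\<lambda>T. Dm q (g T)) = kd XF n f"
      using Nn_lift[OF f(2)] by blast
    have "kd XF n g \<in> chains n (p - 1 - 1) (Nn (q + 1) (j - int p + 1 + 1))"
    proof (rule Nn_map[OF B.kd_in_G[OF g(1)]])
      show "Dm q (kd XF n g T) = 0" for T
        using fun_cong[OF kd_Dm[of q g], of T] unfolding g(2) by simp
    qed
    then have "g \<in> B.cyc (Nn (q + 1)) (p - 1) j" using g(1) unfolding B.cyc_def p1 by simp
    then show "\<exists>g\<in>B.cyc (Nn (q + 1)) (p - 1) j. kd XF n f = (\<lambda>T. Dm q (g T))"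
      using g(2) by (intro bexI[of _ g]) simp_all
  next
    fix g assume "g \<in> B.cyc (Nn (q + 1)) (p - 1) j"
    then have g: "g \<in> chains n (p - 1) (Ev (q + 1) (j - int p + 1))"
      "kd XF n g \<in> chains n (p - 1 - 1) (Nn (q + 1) (j - int p + 1 + 1))"
      unfolding B.cyc_def p1 by auto
    have Dg: "(\<lambda>T. Dm q (g T)) \<in> chains n (p - 1) (Nn q (j - int p + 1))" by (rule Dm_chains[OF g(1)])
    have dDg: "kd XF n (\<lambda>T. Dm q (g T)) = 0"
      unfolding kd_Dm using Dm_Nn[OF chains_in[OF g(2) Nn_0]] by (simp add: fun_eq_iff)
    have "\<exists>f\<in>chains n (p - 1 + 1) (Ev q (j - int p + 1 - 1)). kd XF n f = (\<lambda>T. Dm q (g T))"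
      by (rule koszul_exact[OF chains_mono[OF Dg Nn_Ev] dDg]) (use p in simp)
    then obtain f where f: "f \<in> chains n p (Ev q (j - int p))" "kd XF n f = (\<lambda>T. Dm q (g T))"
      using p by auto
    then show "\<exists>f\<in>A.cyc (Nn q) p j. kd XF n f = (\<lambda>T. Dm q (g T))"
      using Dg by (intro bexI[of _ f]) (simp_all add: A.cyc_def)
  next
    fix f g assume f': "f \<in> A.cyc (Nn q) p j" and g': "g \<in> B.cyc (Nn (q + 1)) (p - 1) j"
      and R: "kd XF n f = (\<lambda>T. Dm q (g T))"
    have f: "f \<in> chains n p (Ev q (j - int p))" and g: "g \<in> chains n (p - 1) (Ev (q + 1) (j - int p + 1))"
      using f' g' unfolding A.cyc_def B.cyc_def p1 by auto
    show "f \<in> A.bnd (Nn q) p j \<longleftrightarrow> g \<in> B.bnd (Nn (q + 1)) (p - 1) j"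
    proof
      assume "f \<in> A.bnd (Nn q) p j"
      then obtain h where h: "h \<in> chains n (p + 1) (Ev q (j - int p - 1))"
        "f - kd XF n h \<in> chains n p (Nn q (j - int p))" by (rule A.bndE)
      obtain u where u: "u \<in> chains n p (Ev (q + 1) (j - int p))" "(\<lambda>T. Dm q (u T)) = f - kd XF n h"
        using Nn_lift[OF h(2)] by blast
      have "kd XF n (\<lambda>T. Dm q (u T)) = kd XF n f" unfolding u(2) by (simp only: A.kd_simps A.dd diff_zero)
      then have e: "Dm q (g T) = Dm q (kd XF n u T)" for T
        unfolding R kd_Dm by (rule fun_cong[symmetric])
      have w: "g - kd XF n u \<in> chains n (p - 1) (Ev (q + 1) (j - int p + 1))"
        by (rule A.fs.subspace_diff[OF B.chains_subspace[OF B.G_sub] g B.kd_in_G[OF u(1)]])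
      have w': "g - kd XF n u \<in> chains n (p - 1) (Nn (q + 1) (j - int p + 1))"
        by (rule Nn_map[OF w]) (simp add: Dm_simps e)
      have u': "u \<in> chains n (p - 1 + 1) (Ev (q + 1) (j - int p + 1 - 1))"
        using u(1) p by simp
      show "g \<in> B.bnd (Nn (q + 1)) (p - 1) j"
        by (rule B.bndI[where p = "p - 1" and j = j and N = "Nn (q + 1)" and f = g and g = u, unfolded p1, OF g u' w'])
    next
      assume "g \<in> B.bnd (Nn (q + 1)) (p - 1) j"
      then obtain u where u: "u \<in> chains n (p - 1 + 1) (Ev (q + 1) (j - int (p - 1) - 1))"
        "g - kd XF n u \<in> chains n (p - 1) (Nn (q + 1) (j - int (p - 1)))" by (rule B.bndE)
      have u1: "u \<in> chains n p (Ev (q + 1) (j - int p))" using u(1) p by (simp add: p1)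
      have "Dm q ((g - kd XF n u) T) = 0" for T by (rule Dm_Nn[OF chains_in[OF u(2) Nn_0]])
      then have "Dm q (g T) = Dm q (kd XF n u T)" for T by (simp add: Dm_simps)
      then have "kd XF n f = kd XF n (\<lambda>T. Dm q (u T))" unfolding R kd_Dm by simp
      then have d0: "kd XF n (f - (\<lambda>T. Dm q (u T))) = 0" by (simp only: A.kd_simps diff_self)
      have Du: "(\<lambda>T. Dm q (u T)) \<in> chains n p (Nn q (j - int p))" by (rule Dm_chains[OF u1])
      have w: "f - (\<lambda>T. Dm q (u T)) \<in> chains n p (Ev q (j - int p))"
        by (rule A.fs.subspace_diff[OF A.chains_subspace[OF A.G_sub] f chains_mono[OF Du Nn_Ev]])
      have "\<exists>h\<in>chains n (p + 1) (Ev q (j - int p - 1)). kd XF n h = f - (\<lambda>T. Dm q (u T))"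
        by (rule koszul_exact[OF w d0]) (use p in simp)
      then obtain h where h: "h \<in> chains n (p + 1) (Ev q (j - int p - 1))" "kd XF n h = f - (\<lambda>T. Dm q (u T))"
        by blast
      have "f - kd XF n h = (\<lambda>T. Dm q (u T))" unfolding h(2) by simp
      then show "f \<in> A.bnd (Nn q) p j" using Du by (intro A.bndI[OF f h(1)]) simp
    qed
  qed
qed

section \<open>Comparison with the residue complex\<close>

definition res :: "(nat \<Rightarrow> ('v, 'k) mpoly) \<Rightarrow> nat \<Rightarrow> 'k" where
  "res v = (\<lambda>k. coef (v k) 0)"

definition lft :: "(nat \<Rightarrow> 'k) \<Rightarrow> nat \<Rightarrow> ('v, 'k) mpoly" where
  "lft w = (\<lambda>k. cst (w k))"

definition RD :: "nat \<Rightarrow> (nat \<Rightarrow> 'k) \<Rightarrow> nat \<Rightarrow> 'k" where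
  "RD q w = (\<lambda>k. if k < r q then \<Sum>l<r (q + 1). coef (dif q k l) 0 * w l else 0)"

definition RC :: "nat \<Rightarrow> int \<Rightarrow> (nat \<Rightarrow> 'k) set" where
  "RC i j = {w. \<forall>k. w k \<noteq> 0 \<longrightarrow> k < r i \<and> dg i k = j}"

definition TZ :: "nat \<Rightarrow> int \<Rightarrow> (nat \<Rightarrow> 'k) set" where
  "TZ i j = {w \<in> RC i j. i \<noteq> 0 \<longrightarrow> RD (i - 1) w = 0}"

definition TB :: "nat \<Rightarrow> int \<Rightarrow> (nat \<Rightarrow> 'k) set" where
  "TB i j = RD i ` RC (i + 1) j"

definition kt :: "nat \<Rightarrow> int \<Rightarrow> int" where
  "kt i j = int (vector_space.dim (fun_scale (*)) (TZ i j)) - int (vector_space.dim (fun_scale (*)) (TB i j))"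

lemma res_simps: "res (v + w) = res v + res w" "res (v - w) = res v - res w" "res 0 = 0"
  "res (fsc c v) = fun_scale (*) c (res v)"
  by (simp_all add: res_def fun_eq_iff lookup_add lookup_minus fun_scale_def coef_cst_mult)

lemma res_lft [simp]: "res (lft w) = w"
  by (simp add: res_def lft_def cst_def)

lemma res_Dm: "res (Dm q v) = RD q (res v)"
  by (simp add: res_def Dm_def RD_def fun_eq_iff lookup_sum coef_mult_zero)

lemma RD_simps: "RD q (v + w) = RD q v + RD q w" "RD q 0 = 0" "RD q (fun_scale (*) c v) = fun_scale (*) c (RD q v)"
  by (simp_all add: RD_def fun_eq_iff distrib_left sum.distrib fun_scale_def sum_distrib_left mult.left_commute)

lemma res_RC: "v \<in> Ev i j \<Longrightarrow> res v \<in> RC i j"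
  unfolding RC_def
proof (intro CollectI allI impI)
  fix k assume v: "v \<in> Ev i j" and "res v k \<noteq> 0"
  then have ne: "coef (v k) 0 \<noteq> 0" by (simp add: res_def)
  have k: "k < r i" using EvD(2)[OF v, of k] ne by (cases "k < r i") auto
  then show "k < r i \<and> dg i k = j" using homogeneousD[OF EvD(1)[OF v k] ne] by simp
qed

lemma lft_Ev: "w \<in> RC i j \<Longrightarrow> lft w \<in> Ev i j"
proof (rule EvI)
  fix k assume w: "w \<in> RC i j"
  show "lft w k \<in> homogeneous (j - dg i k)" if "k < r i"
    using w homogeneous_cst[of "w k"] by (cases "w k = 0") (auto simp: lft_def RC_def cst_simps)
  show "lft w k = 0" if "k \<ge> r i"
    using w that by (cases "w k = 0") (auto simp: lft_def RC_def cst_simps)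
qed

lemma RD_RC: "w \<in> RC (q + 1) j \<Longrightarrow> RD q w \<in> RC q j"
  using res_RC[OF Dm_Ev[OF lft_Ev]] by (simp add: res_Dm)

lemma vspace_R: "vspace (fun_scale (*) :: 'k \<Rightarrow> (nat \<Rightarrow> 'k) \<Rightarrow> nat \<Rightarrow> 'k)"
  by (rule vspace_fun[OF vspace_times])

lemma RC_fin: "vspace.fin_subspace (fun_scale (*)) (RC i j)"
proof -
  interpret t: vspace "(*) :: 'k \<Rightarrow> 'k \<Rightarrow> 'k" by (rule vspace_times)
  have "RC i j = fun_on {k. k < r i \<and> dg i k = j} UNIV"
    unfolding RC_def fun_on_def by auto
  moreover have "finite {k. k < r i \<and> dg i k = j}" by (rule finite_subset[of _ "{..<r i}"]) auto
  ultimately show ?thesis using t.fun_on_fin_subspace[OF _ fin_subspace_UNIV_times(1)] by metis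
qed

lemma TZ_fin: "vspace.fin_subspace (fun_scale (*)) (TZ i j)"
proof -
  interpret R: vspace "fun_scale (*) :: 'k \<Rightarrow> (nat \<Rightarrow> 'k) \<Rightarrow> nat \<Rightarrow> 'k" by (rule vspace_R)
  note sub = R.fin_subspaceD[OF RC_fin[of i j]]
  have z: "fun_scale (*) c 0 = (0 :: nat \<Rightarrow> 'k)" for c by (simp add: fun_scale_def fun_eq_iff)
  have "R.subspace (TZ i j)"
    unfolding R.subspace_def TZ_def
    by (simp add: R.subspace_0[OF sub] R.subspace_add[OF sub] R.subspace_scale[OF sub] RD_simps z)
  then show ?thesis by (rule R.fin_subspace_mono[OF RC_fin[of i j]]) (auto simp: TZ_def)
qed

lemma TB_subspace: "module.subspace (fun_scale (*)) (TB i j)"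
proof -
  interpret R: vspace_pair "fun_scale (*) :: 'k \<Rightarrow> (nat \<Rightarrow> 'k) \<Rightarrow> nat \<Rightarrow> 'k" "fun_scale (*) :: 'k \<Rightarrow> (nat \<Rightarrow> 'k) \<Rightarrow> nat \<Rightarrow> 'k"
    by (intro vspace_pair.intro vspace_R)
  have "Vector_Spaces.linear (fun_scale (*)) (fun_scale (*)) (RD i)"
    by unfold_locales (rule RD_simps)+
  from R.fin_subspace_image[OF this RC_fin] show ?thesis unfolding TB_def by (rule R.vs1.fin_subspaceD)
qed

lemma TB_TZ: "TB i j \<subseteq> TZ i j"
proof
  fix w assume "w \<in> TB i j"
  then obtain u where u: "u \<in> RC (i + 1) j" "w = RD i u" by (auto simp: TB_def)
  have "RD (i - 1) w = 0" if i: "i \<noteq> 0"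
  proof -
    obtain q where q: "i = q + 1" using i by (metis Suc_eq_plus1 not0_implies_Suc)
    have "RD q (RD (q + 1) (res (lft u))) = 0"
      unfolding res_Dm[symmetric] Dm_Dm by (rule res_simps)
    then show ?thesis by (simp add: u(2) q)
  qed
  then show "w \<in> TZ i j" using RD_RC[OF u(1)] by (simp add: TZ_def u(2))
qed

text \<open>Every term of a Koszul boundary is a multiple of a variable.\<close>

lemma res_kd: "res (kd XF n f T) = 0"
proof
  fix k
  have "coef (ksign i T q) 0 = ksign i T (coef q 0)" for i and q :: "('v, 'k) mpoly" by (simp add: ksign_def)
  then show "res (kd XF n f T) k = 0 k"
    unfolding res_def kd_XF by (simp add: kd_def lookup_sum coef_Var_mult)
qed

definition chain0 :: "'x::zero \<Rightarrow> nat set \<Rightarrow> 'x" where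
  "chain0 x T = (if T = {} then x else 0)"

lemma chain0_in: "x \<in> H \<Longrightarrow> chain0 x \<in> chains n 0 H"
  by (rule chainsI) (auto simp: chain0_def finite_subset)

lemma chain0_eq: "f \<in> chains n 0 H \<Longrightarrow> f = chain0 (f {})"
proof
  fix T assume f: "f \<in> chains n 0 H"
  have "\<not> (T \<subseteq> {..<n} \<and> card T = 0)" if "T \<noteq> {}"
    using that finite_subset[of T "{..<n}"] by auto
  then show "f T = chain0 (f {}) T" using chains_outside[OF f, of T] by (auto simp: chain0_def)
qed

lemma kd_chain0: "f \<in> chains n 0 (Ev q e) \<Longrightarrow> kd XF n f = 0"
  by (erule kd_chain_zero) (simp add: XF_def fun_eq_iff)

text \<open>Coordinates without constant term lie in the ideal of the variables, which is what
  Koszul boundaries in degree 0 produce.\<close>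

lemma koszul_exact_0:
  assumes v: "v \<in> Ev q e" "res v = 0"
  shows "\<exists>g\<in>chains n 1 (Ev q (e - 1)). kd XF n g {} = v"
proof -
  have c: "chain0 v \<in> chains n 0 (Ev q e)" by (rule chain0_in[OF v(1)])
  have co: "coef (chain0 v {} k) 0 = 0" for k using fun_cong[OF v(2), of k] by (simp add: chain0_def res_def)
  have "\<exists>g\<in>chains n (0 + 1) (Ev q (e - 1)). kd XF n g = chain0 v"
    by (rule koszul_exact[OF c kd_chain0[OF c] co])
  then obtain g where "g \<in> chains n (0 + 1) (Ev q (e - 1))" "kd XF n g = chain0 v" by blast
  then show ?thesis by (intro bexI[of _ g]) (simp_all add: chain0_def)
qed

text \<open>A 1-cycle \<open>f\<close> of the cokernel has \<open>kd XF n f {} = Dm q g\<close>, and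
  \<open>res g\<close> is the associated Tor cycle. The choice of \<open>g\<close> is free up to the
  image of \<open>Dm (q + 1)\<close>, whose residues are Tor boundaries.\<close>

lemma khF_one: "khF q 1 j = kt (q + 1) j"
proof -
  interpret A: gops fsc XF n "Ev q" by (rule gops_F)
  interpret B: gops fsc XF n "Ev (q + 1)" by (rule gops_F)
  have j1: "j - int 1 + 1 = j" "j - int 1 = j - 1" "j - int 1 - 1 = j - 2" by simp_all
  have cyc: "f \<in> A.cyc (Nn q) 1 j \<longleftrightarrow> f \<in> chains n 1 (Ev q (j - 1)) \<and> kd XF n f \<in> chains n 0 (Nn q j)" for f
    unfolding A.cyc_def j1 by simp
  show ?thesis
    unfolding khF_def A.kh_def kt_def
  proof (rule subquotient_dim_eq[where R = "\<lambda>f w. \<exists>g\<in>Ev (q + 1) j. kd XF n f {} = Dm q g \<and> res g = w"])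
    show "vspace (fun_scale fsc :: 'k \<Rightarrow> (nat set \<Rightarrow> nat \<Rightarrow> ('v, 'k) mpoly) \<Rightarrow> nat set \<Rightarrow> nat \<Rightarrow> ('v, 'k) mpoly)"
      by (rule vspace_fun[OF vspace_F])
    show "vspace (fun_scale (*) :: 'k \<Rightarrow> (nat \<Rightarrow> 'k) \<Rightarrow> nat \<Rightarrow> 'k)" by (rule vspace_R)
    show "A.fs.fin_subspace (A.cyc (Nn q) 1 j)" by (rule A.cyc_fin[OF gsub_Nn])
    show "A.fs.subspace (A.bnd (Nn q) 1 j)" by (rule A.bnd_subspace[OF gsub_Nn])
    show "A.bnd (Nn q) 1 j \<subseteq> A.cyc (Nn q) 1 j" by (rule A.bnd_cyc[OF gsub_Nn])
    show "vspace.fin_subspace (fun_scale (*)) (TZ (q + 1) j)" by (rule TZ_fin)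
    show "module.subspace (fun_scale (*)) (TB (q + 1) j)" by (rule TB_subspace)
    show "TB (q + 1) j \<subseteq> TZ (q + 1) j" by (rule TB_TZ)
    show "\<exists>g\<in>Ev (q + 1) j. kd XF n 0 {} = Dm q g \<and> res g = 0"
      by (rule bexI[of _ 0]) (simp_all only: A.kd_simps zero_fun_apply Dm_simps res_simps Ev_simps simp_thms)
  next
    fix f w f' w'
    assume "\<exists>g\<in>Ev (q + 1) j. kd XF n f {} = Dm q g \<and> res g = w"
      "\<exists>g\<in>Ev (q + 1) j. kd XF n f' {} = Dm q g \<and> res g = w'"
    then obtain g g' where "g \<in> Ev (q + 1) j" "kd XF n f {} = Dm q g" "res g = w"
      "g' \<in> Ev (q + 1) j" "kd XF n f' {} = Dm q g'" "res g' = w'" by blast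
    then show "\<exists>g\<in>Ev (q + 1) j. kd XF n (f + f') {} = Dm q g \<and> res g = w + w'"
      by (intro bexI[of _ "g + g'"]) (simp_all only: A.kd_simps plus_fun_apply Dm_simps res_simps Ev_simps simp_thms)
  next
    fix c f w
    assume "\<exists>g\<in>Ev (q + 1) j. kd XF n f {} = Dm q g \<and> res g = w"
    then obtain g where g: "g \<in> Ev (q + 1) j" "kd XF n f {} = Dm q g" "res g = w" by blast
    have "kd XF n (fun_scale fsc c f) {} = fsc c (kd XF n f {})"
      unfolding A.kd_simps unfolding fun_scale_def[of fsc] ..
    then show "\<exists>g\<in>Ev (q + 1) j. kd XF n (fun_scale fsc c f) {} = Dm q g \<and> res g = fun_scale (*) c w"
      using g B.G_simps(5)[OF g(1), of c] by (intro bexI[of _ "fsc c g"]) (simp_all only: Dm_simps res_simps simp_thms)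
  next
    fix f assume "f \<in> A.cyc (Nn q) 1 j"
    then have f: "f \<in> chains n 1 (Ev q (j - 1))" "kd XF n f \<in> chains n 0 (Nn q j)" unfolding cyc by auto
    have "kd XF n f {} \<in> Nn q j" by (rule chains_in[OF f(2) Nn_0])
    then obtain g where g: "g \<in> Ev (q + 1) j" "kd XF n f {} = Dm q g" unfolding Nn_def by blast
    have "RD q (res g) = 0" unfolding res_Dm[symmetric] g(2)[symmetric] by (rule res_kd)
    then have "res g \<in> TZ (q + 1) j" using res_RC[OF g(1)] by (simp add: TZ_def)
    then show "\<exists>w\<in>TZ (q + 1) j. \<exists>g\<in>Ev (q + 1) j. kd XF n f {} = Dm q g \<and> res g = w" using g by blast
  next
    fix w assume "w \<in> TZ (q + 1) j"
    then have w: "w \<in> RC (q + 1) j" "RD q w = 0" by (auto simp: TZ_def)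
    have g: "lft w \<in> Ev (q + 1) j" by (rule lft_Ev[OF w(1)])
    have "res (Dm q (lft w)) = 0" using w(2) by (simp add: res_Dm)
    then obtain f where f: "f \<in> chains n 1 (Ev q (j - 1))" "kd XF n f {} = Dm q (lft w)"
      using koszul_exact_0[OF Dm_Ev[OF g]] by blast
    have df: "kd XF n f \<in> chains n 0 (Ev q j)" using A.kd_in_G[OF f(1)] by simp
    have "kd XF n f = chain0 (Dm q (lft w))" using chain0_eq[OF df] f(2) by simp
    moreover have "Dm q (lft w) \<in> Nn q j" using g by (simp add: Nn_def)
    ultimately have "kd XF n f \<in> chains n 0 (Nn q j)" using chain0_in by simp
    then have "f \<in> A.cyc (Nn q) 1 j" unfolding cyc using f(1) by blast
    then show "\<exists>f\<in>A.cyc (Nn q) 1 j. \<exists>g\<in>Ev (q + 1) j. kd XF n f {} = Dm q g \<and> res g = w"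
      using f(2) g res_lft by blast
  next
    fix f w assume f': "f \<in> A.cyc (Nn q) 1 j" and w': "w \<in> TZ (q + 1) j"
      and "\<exists>g\<in>Ev (q + 1) j. kd XF n f {} = Dm q g \<and> res g = w"
    then obtain g where g: "g \<in> Ev (q + 1) j" "kd XF n f {} = Dm q g" "res g = w" by blast
    have f: "f \<in> chains n 1 (Ev q (j - 1))" using f' unfolding cyc by blast
    show "f \<in> A.bnd (Nn q) 1 j \<longleftrightarrow> w \<in> TB (q + 1) j"
    proof
      assume "f \<in> A.bnd (Nn q) 1 j"
      then obtain h where h: "h \<in> chains n (1 + 1) (Ev q (j - int 1 - 1))"
        "f - kd XF n h \<in> chains n 1 (Nn q (j - int 1))" by (rule A.bndE)
      obtain u where u: "u \<in> chains n 1 (Ev (q + 1) (j - 1))" "(\<lambda>T. Dm q (u T)) = f - kd XF n h"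
        using Nn_lift[OF h(2)] unfolding j1 by blast
      have "kd XF n (\<lambda>T. Dm q (u T)) = kd XF n f" unfolding u(2) by (simp only: A.kd_simps A.dd diff_zero)
      then have e: "Dm q (kd XF n u {}) = Dm q g"
        unfolding kd_Dm using g(2) by (metis (no_types))
      have du: "kd XF n u \<in> chains n 0 (Ev (q + 1) j)" using B.kd_in_G[OF u(1)] by simp
      \<comment> \<open>Subtracting a Koszul boundary does not change the residue but makes the
        element a cycle of the resolution, so it comes from the next free module.\<close>
      have "g - kd XF n u {} \<in> Ev (q + 1) j"
        by (rule Ev_simps(3)[OF g(1) chains_in[OF du Ev_simps(1)]])
      moreover have "Dm q (g - kd XF n u {}) = 0" by (simp only: Dm_simps e diff_self)
      ultimately obtain u' where u': "u' \<in> Ev (q + 2) j" "Dm (q + 1) u' = g - kd XF n u {}"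
        using exact_Dm by blast
      have "w = res (Dm (q + 1) u')" unfolding u'(2) res_simps res_kd g(3) by simp
      also have "\<dots> = RD (q + 1) (res u')" by (rule res_Dm)
      finally show "w \<in> TB (q + 1) j" using res_RC[OF u'(1)] by (simp add: TB_def numeral_2_eq_2)
    next
      assume "w \<in> TB (q + 1) j"
      then obtain w' where w': "w' \<in> RC (q + 2) j" "w = RD (q + 1) w'" by (auto simp: TB_def numeral_2_eq_2)
      define u' where "u' = lft w'"
      have u': "u' \<in> Ev (q + 2) j" unfolding u'_def by (rule lft_Ev[OF w'(1)])
      have "Dm (q + 1) u' \<in> Ev (q + 1) j" using Dm_Ev[of u' "q + 1" j] u' by (simp add: numeral_2_eq_2)
      then have gE: "g - Dm (q + 1) u' \<in> Ev (q + 1) j" by (rule Ev_simps(3)[OF g(1)])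
      have "res (g - Dm (q + 1) u') = 0"
        unfolding res_simps res_Dm g(3) w'(2) u'_def res_lft by simp
      then obtain u where u: "u \<in> chains n 1 (Ev (q + 1) (j - 1))" "kd XF n u {} = g - Dm (q + 1) u'"
        using koszul_exact_0[OF gE] by blast
      have Du: "(\<lambda>T. Dm q (u T)) \<in> chains n 1 (Nn q (j - 1))" by (rule Dm_chains[OF u(1)])
      have w1: "f - (\<lambda>T. Dm q (u T)) \<in> chains n 1 (Ev q (j - 1))"
        by (rule A.fs.subspace_diff[OF A.chains_subspace[OF A.G_sub] f chains_mono[OF Du Nn_Ev]])
      have "kd XF n (f - (\<lambda>T. Dm q (u T))) {} = Dm q g - Dm q (kd XF n u {})"
        unfolding A.kd_simps kd_Dm by (simp add: g(2))
      also have "\<dots> = 0" unfolding u(2) Dm_simps Dm_Dm by simp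
      finally have z: "kd XF n (f - (\<lambda>T. Dm q (u T))) {} = 0" .
      have "kd XF n (f - (\<lambda>T. Dm q (u T))) \<in> chains n (1 - 1) (Ev q (j - 1 + 1))" by (rule A.kd_in_G[OF w1])
      then have "kd XF n (f - (\<lambda>T. Dm q (u T))) \<in> chains n 0 (Ev q j)" by simp
      from chain0_eq[OF this] have d0: "kd XF n (f - (\<lambda>T. Dm q (u T))) = 0"
        unfolding z by (simp add: chain0_def fun_eq_iff)
      have "\<exists>h\<in>chains n (1 + 1) (Ev q (j - 1 - 1)). kd XF n h = f - (\<lambda>T. Dm q (u T))"
        by (rule koszul_exact[OF w1 d0]) simp
      then obtain h where h: "h \<in> chains n (1 + 1) (Ev q (j - 1 - 1))" "kd XF n h = f - (\<lambda>T. Dm q (u T))"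
        by blast
      have "f - kd XF n h = (\<lambda>T. Dm q (u T))" unfolding h(2) by simp
      then show "f \<in> A.bnd (Nn q) 1 j"
        by (intro A.bndI[where g = h]) (use f h(1) Du in \<open>simp_all only: j1(2)\<close>)
    qed
  qed
qed

lemma khF_zero: "khF 0 0 j = kt 0 j"
proof -
  interpret A: gops fsc XF n "Ev 0" by (rule gops_F)
  have j1: "j - int 0 = j" by simp
  have cyc: "f \<in> A.cyc (Nn 0) 0 j \<longleftrightarrow> f \<in> chains n 0 (Ev 0 j)" for f
    unfolding A.cyc_def j1 using chains_zero[OF Nn_0, of n 0 0 "j + 1"] by (auto simp: kd_chain0)
  show ?thesis
    unfolding khF_def A.kh_def kt_def
  proof (rule subquotient_dim_eq[where R = "\<lambda>f w. res (f {}) = w"])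
    show "vspace (fun_scale fsc :: 'k \<Rightarrow> (nat set \<Rightarrow> nat \<Rightarrow> ('v, 'k) mpoly) \<Rightarrow> nat set \<Rightarrow> nat \<Rightarrow> ('v, 'k) mpoly)"
      by (rule vspace_fun[OF vspace_F])
    show "vspace (fun_scale (*) :: 'k \<Rightarrow> (nat \<Rightarrow> 'k) \<Rightarrow> nat \<Rightarrow> 'k)" by (rule vspace_R)
    show "A.fs.fin_subspace (A.cyc (Nn 0) 0 j)" by (rule A.cyc_fin[OF gsub_Nn])
    show "A.fs.subspace (A.bnd (Nn 0) 0 j)" by (rule A.bnd_subspace[OF gsub_Nn])
    show "A.bnd (Nn 0) 0 j \<subseteq> A.cyc (Nn 0) 0 j" by (rule A.bnd_cyc[OF gsub_Nn])
    show "vspace.fin_subspace (fun_scale (*)) (TZ 0 j)" by (rule TZ_fin)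
    show "module.subspace (fun_scale (*)) (TB 0 j)" by (rule TB_subspace)
    show "TB 0 j \<subseteq> TZ 0 j" by (rule TB_TZ)
    show "res (0 {}) = 0" by (simp only: zero_fun_apply res_simps)
    show "res ((f + f') {}) = w + w'" if "res (f {}) = w" "res (f' {}) = w'" for f w f' w'
      using that by (simp only: plus_fun_apply res_simps)
    show "res (fun_scale fsc c f {}) = fun_scale (*) c w" if "res (f {}) = w" for c f w
      unfolding fun_scale_def[of fsc] res_simps that ..
  next
    fix f assume "f \<in> A.cyc (Nn 0) 0 j"
    then have "f {} \<in> Ev 0 j" unfolding cyc using chains_in[OF _ Ev_simps(1)] by blast
    then show "\<exists>w\<in>TZ 0 j. res (f {}) = w" using res_RC by (simp add: TZ_def)
  next
    fix w assume "w \<in> TZ 0 j"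
    then have "w \<in> RC 0 j" by (simp add: TZ_def)
    then have "chain0 (lft w) \<in> A.cyc (Nn 0) 0 j" unfolding cyc by (intro chain0_in lft_Ev)
    moreover have "res (chain0 (lft w) {}) = w" by (simp add: chain0_def)
    ultimately show "\<exists>f\<in>A.cyc (Nn 0) 0 j. res (f {}) = w" by blast
  next
    fix f w assume "f \<in> A.cyc (Nn 0) 0 j" and R: "res (f {}) = w"
    then have f: "f \<in> chains n 0 (Ev 0 j)" unfolding cyc by blast
    have fE: "f {} \<in> Ev 0 j" by (rule chains_in[OF f Ev_simps(1)])
    show "f \<in> A.bnd (Nn 0) 0 j \<longleftrightarrow> w \<in> TB 0 j"
    proof
      assume "f \<in> A.bnd (Nn 0) 0 j"
      then obtain h where "f - kd XF n h \<in> chains n 0 (Nn 0 (j - int 0))" by (rule A.bndE)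
      from chains_in[OF this Nn_0, of "{}"] obtain u where u: "u \<in> Ev 1 j" "f {} - kd XF n h {} = Dm 0 u"
        by (auto simp: Nn_def)
      have "res (f {}) - res (kd XF n h {}) = RD 0 (res u)"
        using arg_cong[OF u(2), of res] by (simp only: res_simps res_Dm)
      then have "w = RD 0 (res u)" unfolding res_kd R by simp
      then show "w \<in> TB 0 j" using res_RC[OF u(1)] by (simp add: TB_def)
    next
      assume "w \<in> TB 0 j"
      then obtain w' where w': "w' \<in> RC 1 j" "w = RD 0 w'" by (auto simp: TB_def)
      have u: "lft w' \<in> Ev 1 j" by (rule lft_Ev[OF w'(1)])
      have Du: "Dm 0 (lft w') \<in> Ev 0 j" using Dm_Ev[of _ 0] u by simp
      have "res (f {} - Dm 0 (lft w')) = 0" unfolding res_simps res_Dm R w'(2) res_lft by simp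
      then obtain h where h: "h \<in> chains n 1 (Ev 0 (j - 1))" "kd XF n h {} = f {} - Dm 0 (lft w')"
        using koszul_exact_0[OF Ev_simps(3)[OF fE Du]] by blast
      have "f - kd XF n h \<in> chains n 0 (Ev 0 j)"
        using A.fs.subspace_diff[OF A.chains_subspace[OF A.G_sub] f] A.kd_in_G[OF h(1)] by simp
      from chain0_eq[OF this] have "f - kd XF n h = chain0 (Dm 0 (lft w'))" by (simp add: h(2))
      moreover have "Dm 0 (lft w') \<in> Nn 0 j" using u by (simp add: Nn_def)
      ultimately have "f - kd XF n h \<in> chains n 0 (Nn 0 j)" using chain0_in by simp
      then show "f \<in> A.bnd (Nn 0) 0 j" by (intro A.bndI[where g = h]) (use f h(1) in simp_all)
    qed
  qed
qed

text \<open>The symmetry of Tor: the left side resolves the residue field by the Koszul complex, the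
  right side resolves the module by \<open>F\<close>.\<close>

theorem koszul_homology_eq_tor: "khM i j = kt i j"
proof (cases "i = 0")
  case True then show ?thesis using khM_eq_khF khF_zero by simp
next
  case False
  have "khF 0 i j = khF q (i - q) j" if "q < i" for q
    using that
  proof (induction q)
    case (Suc q)
    then have "khF q (i - q) j = khF (q + 1) (i - q - 1) j" by (intro khF_shift) simp
    then show ?case using Suc by simp
  qed simp
  from this[of "i - 1"] show ?thesis using False khM_eq_khF khF_one[of "i - 1" j] by simp
qed

end

section \<open>The Betti numbers of a 2-linear resolution\<close>

text \<open>Bridge between the two notions of dimension. The matrix whose columns are a basis of
  \<open>U\<close> defines an injective map on \<open>d\<close>-dimensional coordinate space whose
  image is the set of vectors in question.\<close>

lemma subspace_dim_vec:
  fixes U :: "(nat \<Rightarrow> 'k::field) set"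
  assumes U: "vspace.fin_subspace (fun_scale (*)) U" and supp: "\<And>w k. w \<in> U \<Longrightarrow> k \<ge> r \<Longrightarrow> w k = 0"
  shows "subspace_dim r (vec r ` U) = vector_space.dim (fun_scale (*)) U"
proof -
  interpret R: vspace "fun_scale (*) :: 'k \<Rightarrow> (nat \<Rightarrow> 'k) \<Rightarrow> nat \<Rightarrow> 'k" by (rule vspace_fun[OF vspace_times])
  obtain C where C: "C \<subseteq> U" "finite C" "R.independent C" "R.span C = U" "card C = R.dim U"
    by (rule R.fin_subspace_basis[OF U]) blast
  define d where "d = R.dim U"
  obtain f where f: "bij_betw f {0..<d} C" using ex_bij_betw_nat_finite[OF C(2)] unfolding C(5) d_def by blast
  define L where "L x = (\<Sum>i<d. fun_scale (*) (x i) (f i))" for x :: "nat \<Rightarrow> 'k"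
  have Lk: "L x k = (\<Sum>i<d. x i * f i k)" for x k by (simp add: L_def sum_fun_app fun_scale_def)
  have LU: "L x \<in> U" for x
    unfolding L_def
    by (intro R.subspace_sum[OF R.fin_subspaceD[OF U]] R.subspace_scale[OF R.fin_subspaceD[OF U]])
      (use f C(1) in \<open>auto simp: bij_betw_def lessThan_atLeast0\<close>)
  have Lsurj: "\<exists>x. w = L x" if "w \<in> U" for w
  proof -
    have "w \<in> range (\<lambda>u. \<Sum>c\<in>C. fun_scale (*) (u c) c)" using that R.span_finite[OF C(2)] C(4) by simp
    then obtain u where "w = (\<Sum>c\<in>C. fun_scale (*) (u c) c)" by blast
    also have "\<dots> = L (\<lambda>i. u (f i))"
      unfolding L_def lessThan_atLeast0 by (rule sum.reindex_bij_betw[OF f, symmetric])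
    finally show ?thesis by blast
  qed
  have Linj: "x i = 0" if "L x = 0" "i < d" for x i
  proof -
    define u where "u c = x (the_inv_into {0..<d} f c)" for c
    have uf: "u (f i) = x i" if "i < d" for i
      using f that by (simp add: u_def bij_betw_def the_inv_into_f_f)
    have "(\<Sum>c\<in>C. fun_scale (*) (u c) c) = (\<Sum>i\<in>{0..<d}. fun_scale (*) (u (f i)) (f i))"
      by (rule sum.reindex_bij_betw[OF f, symmetric])
    also have "\<dots> = L x" unfolding L_def lessThan_atLeast0 by (intro sum.cong) (auto simp: uf)
    finally have "(\<Sum>c\<in>C. fun_scale (*) (u c) c) = 0" using that(1) by simp
    moreover have "f i \<in> C" using f that(2) by (auto simp: bij_betw_def)
    ultimately have "u (f i) = 0" using R.independentD[OF C(3,2) order_refl] by blast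
    then show ?thesis using uf[OF that(2)] by simp
  qed
  define A where "A = mat r d (\<lambda>(k, i). f i k)"
  have A: "A \<in> carrier_mat r d" by (simp add: A_def)
  have AL: "A *\<^sub>v x = vec r (L (vec_index x))" if "x \<in> carrier_vec d" for x
    by (rule eq_vecI) (use that in \<open>auto simp: A_def Lk scalar_prod_def lessThan_atLeast0 mult.commute intro!: sum.cong\<close>)
  let ?V = "module_vec TYPE('k) d" and ?W = "module_vec TYPE('k) r"
  interpret LM: linear_map "class_ring :: 'k ring" ?V ?W "\<lambda>x. A *\<^sub>v x"
  proof (intro linear_map.intro vec_vs mod_hom.intro vec_module mod_hom_axioms.intro)
    show "(\<lambda>x. A *\<^sub>v x) \<in> LinearCombinations.module_hom class_ring ?V ?W"
      using A unfolding LinearCombinations.module_hom_def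
      by (auto simp: module_vec_simps mult_add_distrib_mat_vec mult_mat_vec)
  qed
  have inj: "inj_on (\<lambda>x. A *\<^sub>v x) (carrier ?V)"
  proof (rule inj_onI)
    fix x y assume x: "x \<in> carrier ?V" and y: "y \<in> carrier ?V" and e: "A *\<^sub>v x = A *\<^sub>v y"
    have xc: "x \<in> carrier_vec d" "y \<in> carrier_vec d" using x y by (simp_all add: module_vec_simps)
    have "L (vec_index x) k = L (vec_index y) k" for k
    proof (cases "k < r")
      case True
      then show ?thesis using arg_cong[OF e, of "\<lambda>v. vec_index v k"] by (simp add: AL xc)
    qed (simp add: supp[OF LU])
    then have "L (\<lambda>i. vec_index x i - vec_index y i) = 0"
      by (simp add: fun_eq_iff Lk left_diff_distrib sum_subtractf)
    from Linj[OF this] show "x = y" by (intro eq_vecI) (use xc in auto)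
  qed
  have im: "LM.imT = vec r ` U"
  proof -
    have "LM.imT = (\<lambda>x. A *\<^sub>v x) ` carrier_vec d" by (simp add: LM.im_def module_vec_simps)
    also have "\<dots> = vec r ` U"
    proof (intro Set.set_eqI iffI)
      fix v assume "v \<in> (\<lambda>x. A *\<^sub>v x) ` carrier_vec d"
      then obtain x where "x \<in> carrier_vec d" "v = A *\<^sub>v x" by blast
      then show "v \<in> vec r ` U" using AL LU by auto
    next
      fix v assume "v \<in> vec r ` U"
      then obtain x where "v = vec r (L x)" using Lsurj by blast
      also have "L x = L (vec_index (vec d x))" by (simp add: L_def)
      finally have "v = A *\<^sub>v vec d x" by (simp add: AL)
      then show "v \<in> (\<lambda>x. A *\<^sub>v x) ` carrier_vec d" by auto
    qed
    finally show ?thesis .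
  qed
  interpret VV: vec_space "TYPE('k)" d .
  have "vectorspace.dim class_ring (?W\<lparr>carrier := LM.imT\<rparr>) + vectorspace.dim class_ring (?V\<lparr>carrier := LM.kerT\<rparr>)
    = vectorspace.dim class_ring ?V"
    by (rule LM.rank_nullity_main(1)) (rule VV.fin_dim)
  moreover have "vectorspace.dim class_ring (?V\<lparr>carrier := LM.kerT\<rparr>) = 0"
    by (rule LM.inj_imp_dim_ker0[OF inj])
  moreover have "vectorspace.dim class_ring ?V = d" by (rule VV.dim_is_n)
  ultimately have "vectorspace.dim class_ring (?W\<lparr>carrier := LM.imT\<rparr>) = d" by linarith
  then have "vectorspace.dim class_ring (?W\<lparr>carrier := vec r ` U\<rparr>) = d" unfolding im .
  then show ?thesis by (simp only: subspace_dim_def d_def)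
qed

lemma homogeneous_neg: "d < 0 \<Longrightarrow> homogeneous d = ({0} :: ('v::finite, 'k::field) mpoly set)"
proof -
  assume d: "d < 0"
  have "p = 0" if "p \<in> homogeneous d" for p :: "('v, 'k) mpoly"
  proof (rule poly_mapping_eqI)
    fix e :: "'v \<Rightarrow>\<^sub>0 nat"
    have "edeg e \<ge> 0" by (simp only: edeg_def of_nat_0_le_iff)
    then show "coef p e = coef 0 e" using homogeneousD[OF that, of e] d by fastforce
  qed
  then show ?thesis by auto
qed

section \<open>Betti numbers in terms of Koszul homology\<close>

context resolution
begin

lemma residue_component_eq: "residue_component F i j = vec (r i) ` RC i j"
proof (intro Set.set_eqI iffI)
  fix v assume v: "v \<in> residue_component F i j"
  define w where "w k = (if k < r i then vec_index v k else 0)" for k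
  have "v = vec (r i) w" by (rule eq_vecI) (use v in \<open>auto simp: w_def residue_component_def\<close>)
  moreover have "w \<in> RC i j" using v by (auto simp: w_def residue_component_def RC_def)
  ultimately show "v \<in> vec (r i) ` RC i j" by blast
next
  fix v assume "v \<in> vec (r i) ` RC i j"
  then show "v \<in> residue_component F i j" by (auto simp: residue_component_def RC_def)
qed

lemma residue_diff_vec: "residue_diff F q *\<^sub>v vec (r (q + 1)) w = vec (r q) (RD q w)"
  by (rule eq_vecI)
    (use diff_carrier[of q] in \<open>auto simp: residue_diff_def RD_def scalar_prod_def lessThan_atLeast0 intro!: sum.cong\<close>)

lemma tor_cycles_eq: "tor_cycles F i j = vec (r i) ` TZ i j"
proof -
  have "residue_diff F (i - 1) *\<^sub>v vec (r i) w = 0\<^sub>v (r (i - 1)) \<longleftrightarrow> RD (i - 1) w = 0" if i: "i \<noteq> 0" for w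
  proof -
    have e: "residue_diff F (i - 1) *\<^sub>v vec (r i) w = vec (r (i - 1)) (RD (i - 1) w)"
      using residue_diff_vec[of "i - 1" w] i by simp
    show ?thesis
    proof
      assume z: "residue_diff F (i - 1) *\<^sub>v vec (r i) w = 0\<^sub>v (r (i - 1))"
      have "RD (i - 1) w k = 0" for k
      proof (cases "k < r (i - 1)")
        case True
        then show ?thesis using arg_cong[OF z[unfolded e], of "\<lambda>v. vec_index v k"] by simp
      qed (simp add: RD_def)
      then show "RD (i - 1) w = 0" by (simp add: fun_eq_iff)
    next
      assume "RD (i - 1) w = 0"
      then show "residue_diff F (i - 1) *\<^sub>v vec (r i) w = 0\<^sub>v (r (i - 1))" unfolding e by (intro eq_vecI) simp_all
    qed
  qed
  then show ?thesis unfolding tor_cycles_def TZ_def residue_component_eq by auto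
qed

lemma tor_boundaries_eq: "tor_boundaries F i j = vec (r i) ` TB i j"
  unfolding tor_boundaries_def TB_def residue_component_eq image_image residue_diff_vec ..

lemma betti_eq: "int (betti F i j) = khM i j"
proof -
  interpret R: vspace "fun_scale (*) :: 'k \<Rightarrow> (nat \<Rightarrow> 'k) \<Rightarrow> nat \<Rightarrow> 'k" by (rule vspace_R)
  have supp: "w k = 0" if "w \<in> TZ i j" "k \<ge> r i" for w k using that by (auto simp: TZ_def RC_def)
  have "subspace_dim (r i) (tor_cycles F i j) = R.dim (TZ i j)"
    unfolding tor_cycles_eq by (rule subspace_dim_vec[of "TZ i j" "r i"]) (rule TZ_fin, rule supp)
  moreover have "subspace_dim (r i) (tor_boundaries F i j) = R.dim (TB i j)"
    unfolding tor_boundaries_eq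
    by (rule subspace_dim_vec[of "TB i j" "r i"], rule R.fin_subspace_mono[OF TZ_fin TB_subspace TB_TZ])
      (use supp TB_TZ in blast)
  moreover have "R.dim (TB i j) \<le> R.dim (TZ i j)" by (rule R.dim_mono_fin[OF TZ_fin TB_subspace TB_TZ])
  ultimately show ?thesis unfolding koszul_homology_eq_tor kt_def betti_def by simp
qed

lemma G_bounded_below: "\<exists>j0\<le>0. \<forall>j<j0. G j = {0}"
proof (intro exI[of _ "Min (insert 0 (dg 0 ` {..<r 0}))"] conjI allI impI)
  fix j assume j: "j < Min (insert 0 (dg 0 ` {..<r 0}))"
  have "v = 0" if v: "v \<in> Ev 0 j" for v
  proof
    fix k
    show "v k = 0 k"
    proof (cases "k < r 0")
      case True
      then have neg: "j - dg 0 k < 0" using j by simp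
      show ?thesis using EvD(1)[OF v True] unfolding homogeneous_neg[OF neg] by simp
    qed (simp add: EvD(2)[OF v])
  qed
  then have "Ev 0 j = {0}" using Ev_simps(1) by blast
  then show "G j = {0}" unfolding G_eq_aug by (simp add: aug_simps)
qed simp

end

locale two_linear_resolution = resolution scale G F vr n
  for scale :: "('v::finite, 'k::field) mpoly \<Rightarrow> 'm::ab_group_add \<Rightarrow> 'm"
    and G :: "int \<Rightarrow> 'm set" and F :: "('v, 'k, 'm) free_complex"
    and vr :: "nat \<Rightarrow> 'v" and n :: nat +
  assumes two_linear: "two_linear (betti F)"
begin

sublocale M: gops msc XM n G by (rule gops_M)

lemma khM_zero: "i = 0 \<and> j \<noteq> 0 \<or> 1 \<le> i \<and> j \<noteq> int i + 1 \<Longrightarrow> M.cyc (\<lambda>_. {0}) i j \<subseteq> M.bnd (\<lambda>_. {0}) i j"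
  using two_linear betti_eq[of i j] unfolding two_linear_def M.kh_zero_iff[OF M.gsub_zero, symmetric] khM_def
  by auto

lemma bnd_zeroE:
  assumes "f \<in> M.bnd (\<lambda>_. {0}) p j"
  obtains g where "g \<in> chains n (p + 1) (G (j - int p - 1))" "f = kd XM n g"
proof -
  obtain g where g: "g \<in> chains n (p + 1) (G (j - int p - 1))" "f - kd XM n g \<in> chains n p {0}"
    using assms by (rule M.bndE)
  from chains_trivial[OF g(2)] have "f = kd XM n g" by simp
  with g(1) show ?thesis by (rule that)
qed

lemma cyc_zeroI: "f \<in> chains n p (G (j - int p)) \<Longrightarrow> kd XM n f = 0 \<Longrightarrow> f \<in> M.cyc (\<lambda>_. {0}) p j"
  unfolding M.cyc_def using chains_zero[of "{0}" n "p - 1"] by simp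

text \<open>Since the Betti number with indices 0 and \<open>j\<close> vanishes, \<open>z\<close> is
  a boundary of a Koszul 1-chain.\<close>

lemma generated:
  assumes j: "j \<noteq> 0" and z: "z \<in> G j"
  shows "\<exists>u. (\<forall>i<n. u i \<in> G (j - 1)) \<and> z = (\<Sum>i<n. XM i (u i))"
proof -
  have c: "chain0 z \<in> chains n 0 (G j)" by (rule chain0_in[OF z])
  have "kd XM n (chain0 z) = 0" by (rule kd_chain_zero[of "chain0 z" n "G j" XM, OF c M.X_simps(1)])
  then have "chain0 z \<in> M.cyc (\<lambda>_. {0}) 0 j" using c by (intro cyc_zeroI) simp_all
  then have "chain0 z \<in> M.bnd (\<lambda>_. {0}) 0 j" using khM_zero[of 0 j] j by blast
  then obtain g where g: "g \<in> chains n (0 + 1) (G (j - int 0 - 1))" "chain0 z = kd XM n g" by (rule bnd_zeroE)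
  have "z = kd XM n g {}" using fun_cong[OF g(2), of "{}"] by (simp add: chain0_def)
  also have "\<dots> = (\<Sum>i<n. XM i (g {i}))" by (simp add: kd_def ksign_def)
  finally have "z = (\<Sum>i<n. XM i (g {i}))" .
  moreover have "\<forall>i<n. g {i} \<in> G (j - 1)" using chains_in[OF g(1) M.G_simps(1)] by simp
  ultimately show ?thesis by (intro exI[of _ "\<lambda>i. g {i}"] conjI)
qed

text \<open>In negative degrees every element is generated from one degree below. As the grading is
  bounded below, induction on the distance to the bound gives zero.\<close>

lemma G_neg: "j < 0 \<Longrightarrow> G j = {0}"
proof -
  obtain j0 where j0: "j0 \<le> 0" "\<And>j. j < j0 \<Longrightarrow> G j = {0}" using G_bounded_below by blast
  have "G j = {0}" if "j < 0" "nat (j - j0) < k" for j k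
    using that
  proof (induction k arbitrary: j)
    case (Suc k)
    show ?case
    proof (cases "j < j0")
      case False
      then have "G (j - 1) = {0}"
        using Suc.IH[of "j - 1"] Suc.prems j0(2)[of "j - 1"] by (cases "j - 1 < j0") auto
      then have "z = 0" if "z \<in> G j" for z using generated[OF _ that] Suc.prems(1) by auto
      then show ?thesis using M.G_simps(1) by blast
    qed (rule j0(2))
  qed simp
  then show "j < 0 \<Longrightarrow> G j = {0}" by blast
qed

lemma betti_0_0: "betti F 0 0 = M.dim (G 0)"
proof -
  have cyc: "M.cyc (\<lambda>_. {0}) 0 0 = chains n 0 (G 0)"
  proof
    show "M.cyc (\<lambda>_. {0}) 0 0 \<subseteq> chains n 0 (G 0)" by (auto simp: M.cyc_def)
    show "chains n 0 (G 0) \<subseteq> M.cyc (\<lambda>_. {0}) 0 0"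
      by (rule subsetI, rule cyc_zeroI) (simp, erule kd_chain_zero, rule M.X_simps(1))
  qed
  have "M.bnd (\<lambda>_. {0}) 0 0 = {0}"
  proof -
    have "f = 0" if fb: "f \<in> M.bnd (\<lambda>_. {0}) 0 0" for f
    proof -
      obtain g where g: "g \<in> chains n (0 + 1) (G (0 - int 0 - 1))" "f = kd XM n g" by (rule bnd_zeroE[OF fb])
      have "G (0 - int 0 - 1) = {0}" by (rule G_neg) simp
      then have "g = 0" using g(1) chains_trivial by metis
      then show ?thesis using g(2) by simp
    qed
    moreover have "0 \<in> M.bnd (\<lambda>_. {0}) 0 0" by (rule M.fs.subspace_0[OF M.bnd_subspace[OF M.gsub_zero]])
    ultimately show ?thesis by blast
  qed
  then have "khM 0 0 = int (M.dim (G 0))"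
    unfolding khM_def M.kh_def cyc M.dim_chains[OF M.G_fin] by simp
  then show ?thesis using betti_eq[of 0 0] by simp
qed

text \<open>A linear relation is a Koszul 1-cycle of total degree 1. The Betti number there is zero,
  so it is a boundary, and boundaries come from \<open>G (- 1) = {0}\<close>.\<close>

lemma no_linear:
  assumes w: "\<And>i. i < n \<Longrightarrow> w i \<in> G 0" and sum: "(\<Sum>i<n. XM i (w i)) = 0" and i: "i < n"
  shows "w i = 0"
proof -
  define f where "f T = (if \<exists>i<n. T = {i} then w (THE i. T = {i}) else 0)" for T :: "nat set"
  have fi: "f {i} = w i" if "i < n" for i using that by (auto simp: f_def)
  have f: "f \<in> chains n 1 (G 0)"
  proof (rule chainsI)
    fix T :: "nat set" assume "T \<subseteq> {..<n}" "card T = 1"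
    then obtain i where "T = {i}" "i < n" by (auto simp: card_1_singleton_iff)
    then show "f T \<in> G 0" using fi w by simp
  next
    fix T :: "nat set" assume "\<not> (T \<subseteq> {..<n} \<and> card T = 1)"
    then have "\<not> (\<exists>i<n. T = {i})" by auto
    then show "f T = 0" unfolding f_def by (rule if_not_P)
  qed
  have df: "kd XM n f \<in> chains n 0 (G 1)" using M.kd_in_G[OF f] by simp
  have "kd XM n f {} = (\<Sum>i<n. XM i (w i))" by (simp add: kd_def ksign_def fi)
  then have "kd XM n f = 0" using chain0_eq[OF df] sum by (simp add: chain0_def fun_eq_iff)
  then have "f \<in> M.cyc (\<lambda>_. {0}) 1 1" using f by (intro cyc_zeroI) simp_all
  then have "f \<in> M.bnd (\<lambda>_. {0}) 1 1" using khM_zero[of 1 1] by auto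
  then obtain g where g: "g \<in> chains n (1 + 1) (G (1 - int 1 - 1))" "f = kd XM n g" by (rule bnd_zeroE)
  have "G (1 - int 1 - 1) = {0}" by (rule G_neg) simp
  then have "g = 0" using g(1) chains_trivial by metis
  then show ?thesis using g(2) fi[OF i] by simp
qed

lemma resolved: "resolved_ops msc XM n G"
proof unfold_locales
  show "G e = {0}" if "e < 0" for e by (rule G_neg[OF that])
  show "\<exists>u. (\<forall>i<n. u i \<in> G e) \<and> z = (\<Sum>i<n. XM i (u i))" if "e \<ge> 0" "z \<in> G (e + 1)" for e z
    using generated[OF _ that(2)] that(1) by simp
  show "w i = 0" if "\<And>i. i < n \<Longrightarrow> w i \<in> G 0" "(\<Sum>i<n. XM i (w i)) = 0" "i < n" for w i
    using that by (rule no_linear)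
  show "M.reg (\<lambda>_. {0})"
    unfolding M.reg_def
  proof (intro allI impI)
    fix p :: nat and j :: int assume j: "int p + 2 \<le> j"
    show "M.cyc (\<lambda>_. {0}) p j \<subseteq> M.bnd (\<lambda>_. {0}) p j" by (rule khM_zero) (use j in \<open>cases "p = 0"; simp\<close>)
  qed
qed

sublocale resolved_ops msc XM n G by (rule resolved)

end

lemma fps_one_minus_X_power: "fps_nth ((1 - fps_X) ^ n) k = (-1) ^ k * int (n choose k)"
proof (induction n arbitrary: k)
  case 0 then show ?case by (cases k) auto
next
  case (Suc n)
  have "fps_nth ((1 - fps_X :: int fps) ^ Suc n) k = fps_nth ((1 - fps_X) ^ n * (1 - fps_X)) k"
    by (simp add: mult.commute)
  then show ?case using Suc by (cases k) (simp_all add: right_diff_distrib algebra_simps)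
qed

lemma fps_mult_one_minus_X_power:
  assumes h: "\<And>e. e < 0 \<Longrightarrow> h e = 0"
  shows "fps_nth (Abs_fps (\<lambda>e. h (int e)) * (1 - fps_X) ^ n) j = (\<Sum>p\<le>n. (-1) ^ p * (int (n choose p) * h (int j - int p)))"
proof -
  have "fps_nth (Abs_fps (\<lambda>e. h (int e)) * (1 - fps_X) ^ n) j
    = (\<Sum>p\<le>j. fps_nth ((1 - fps_X) ^ n) p * h (int (j - p)))"
    by (subst mult.commute) (simp add: fps_mult_nth atLeast0AtMost)
  also have "\<dots> = (\<Sum>p\<le>j. (-1) ^ p * (int (n choose p) * h (int j - int p)))"
    by (rule sum.cong) (auto simp: fps_one_minus_X_power of_nat_diff mult.assoc)
  \<comment> \<open>The two ranges are compared through a common larger one: \<open>h\<close>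
    vanishes for \<open>p > j\<close> and the binomial coefficient for \<open>p > n\<close>.\<close>
  also have "\<dots> = (\<Sum>p\<le>n + j. (-1) ^ p * (int (n choose p) * h (int j - int p)))"
    by (rule sum.mono_neutral_left) (auto simp: h)
  also have "\<dots> = (\<Sum>p\<le>n. (-1) ^ p * (int (n choose p) * h (int j - int p)))"
    by (rule sum.mono_neutral_right) (auto simp: binomial_eq_0)
  finally show ?thesis .
qed

section \<open>Betti numbers from the Hilbert series\<close>

context two_linear_resolution
begin

definition hs :: "int fps" where
  "hs = Abs_fps (\<lambda>e. int (M.dim (G (int e))))"

lemma dim_G_neg: "e < 0 \<Longrightarrow> M.dim (G e) = 0"
  by (simp add: G_neg)

lemma betti_above: "n < i \<Longrightarrow> betti F i j = 0"
proof -
  assume i: "n < i"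
  have "M.cyc (\<lambda>_. {0}) i j \<subseteq> M.bnd (\<lambda>_. {0}) i j"
  proof
    fix f assume "f \<in> M.cyc (\<lambda>_. {0}) i j"
    then have "f = 0" using chains_above[OF i] by (auto simp: M.cyc_def)
    then show "f \<in> M.bnd (\<lambda>_. {0}) i j"
      using M.fs.subspace_0[OF M.bnd_subspace[OF M.gsub_zero]] by simp
  qed
  then show ?thesis using betti_eq[of i j] unfolding khM_def M.kh_zero_iff[OF M.gsub_zero, symmetric] by simp
qed

text \<open>In internal degree \<open>i + 1\<close> linearity leaves only one homological degree in
  the Euler characteristic.\<close>

lemma euler_betti:
  assumes i: "1 \<le> i" "i \<le> n"
  shows "(-1) ^ i * int (betti F i (int i + 1)) = fps_nth (hs * (1 - fps_X) ^ n) (i + 1)"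
proof -
  have z: "betti F p (int i + 1) = 0" if "p \<noteq> i" for p
    using two_linear that i(1) unfolding two_linear_def by (cases "p = 0") auto
  have "(\<Sum>p\<le>n. (-1) ^ p * M.kh (\<lambda>_. {0}) p (int i + 1)) = (\<Sum>p\<le>n. (-1) ^ p * int (betti F p (int i + 1)))"
    by (simp add: betti_eq khM_def)
  also have "\<dots> = (\<Sum>p\<in>{i}. (-1) ^ p * int (betti F p (int i + 1)))"
    by (rule sum.mono_neutral_right) (use i z in auto)
  finally have "(-1) ^ i * int (betti F i (int i + 1))
    = (\<Sum>p\<le>n. (-1) ^ p * int ((n choose p) * M.dim (G (int i + 1 - int p))))"
    using M.euler_characteristic[of "int i + 1"] by simp
  also have "\<dots> = fps_nth (hs * (1 - fps_X) ^ n) (i + 1)"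
    unfolding hs_def using fps_mult_one_minus_X_power[of "\<lambda>e. int (M.dim (G e))" n "i + 1"] dim_G_neg
    by (simp add: algebra_simps)
  finally show ?thesis .
qed

theorem betti_formula:
  "\<exists>b :: nat \<Rightarrow> int. (\<forall>l<n. b l \<ge> 0) \<and> (\<forall>l. Suc l < n \<longrightarrow> int (l + 1) * b (Suc l) \<le> int (l + 2) * b l) \<and>
    (0 < n \<longrightarrow> b 0 \<le> int (betti F 0 0)) \<and>
    hs * (1 - fps_X) ^ n = fps_const (int (betti F 0 0)) - (\<Sum>l<n. fps_const (b l) * fps_X ^ 2 * (1 - fps_X) ^ l) \<and>
    (\<forall>i\<ge>1. int (betti F i (int i + 1)) = (\<Sum>l<n. b l * int (l choose (i - 1))))"
proof -
  obtain b :: "nat \<Rightarrow> int" where b: "\<forall>l<n. b l \<ge> 0" "\<forall>l. Suc l < n \<longrightarrow> int (l + 1) * b (Suc l) \<le> int (l + 2) * b l"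
    "0 < n \<longrightarrow> b 0 \<le> int (betti F 0 0)"
    "hs * (1 - fps_X) ^ n = fps_const (int (betti F 0 0)) - (\<Sum>l<n. fps_const (b l) * fps_X ^ 2 * (1 - fps_X) ^ l)"
    using hilbert_series unfolding hs_def betti_0_0 by blast
  have "int (betti F i (int i + 1)) = (\<Sum>l<n. b l * int (l choose (i - 1)))" if i: "i \<ge> 1" for i
  proof (cases "i \<le> n")
    case True
    obtain k where k: "i = Suc k" using i by (cases i) auto
    \<comment> \<open>With \<open>i = k + 1\<close> this is the coefficient at \<open>k + 2\<close>;
      the factor \<open>fps_X ^ 2\<close> shifts it to the coefficient at \<open>k\<close> of the
      powers of \<open>1 - fps_X\<close>.\<close>
    have "(-1) ^ i * int (betti F i (int i + 1)) = - (\<Sum>l<n. fps_nth (fps_const (b l) * fps_X ^ 2 * (1 - fps_X) ^ l) (k + 2))"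
      by (subst euler_betti[OF i True], subst b(4)) (simp add: k fps_sum_nth)
    also have "\<dots> = - (\<Sum>l<n. b l * ((-1) ^ k * int (l choose k)))"
      by (simp only: mult.assoc fps_mult_left_const_nth fps_X_power_mult_nth fps_one_minus_X_power) simp
    also have "\<dots> = (-1) ^ i * (\<Sum>l<n. b l * int (l choose k))"
      by (simp add: k sum_distrib_left sum_negf mult.left_commute)
    finally show ?thesis by (simp add: k)
  next
    case False
    then have "(\<Sum>l<n. b l * int (l choose (i - 1))) = 0"
      by (intro sum.neutral) (auto simp: binomial_eq_0)
    then show ?thesis using betti_above False by simp
  qed
  then show ?thesis using b by blast
qed

end

section \<open>Torsion modules\<close>

lemma fps_nth_mult_one_minus_X: "fps_nth ((f :: int fps) * (1 - fps_X)) (Suc j) = fps_nth f (Suc j) - fps_nth f j"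
  by (simp add: right_diff_distrib)

text \<open>Dividing by \<open>1 - fps_X\<close> forms partial sums; negative integers are at most
  -1, so the sums eventually become negative too.\<close>

lemma fps_eventually_negative:
  fixes f :: "int fps"
  assumes "\<forall>j\<ge>N. fps_nth (f * (1 - fps_X) ^ k) j < 0"
  shows "\<exists>N. \<forall>j\<ge>N. fps_nth f j < 0"
  using assms
proof (induction k arbitrary: f N)
  case (Suc k)
  have "\<forall>j\<ge>N. fps_nth ((f * (1 - fps_X)) * (1 - fps_X) ^ k) j < 0"
    using Suc.prems by (simp add: mult.assoc)
  from Suc.IH[OF this] obtain N' where N': "\<And>j. j \<ge> N' \<Longrightarrow> fps_nth (f * (1 - fps_X)) j < 0" by blast
  have "fps_nth f (N' + j) \<le> fps_nth f N' - int j" for j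
  proof (induction j)
    case (Suc j)
    then show ?case using N'[of "Suc (N' + j)"] unfolding fps_nth_mult_one_minus_X by simp
  qed simp
  then have "fps_nth f j < 0" if "j \<ge> N' + nat (fps_nth f N') + 1" for j
    using that by (smt (verit) le_add_diff_inverse add_leD1 int_nat_eq of_nat_add of_nat_le_iff of_nat_1)
  then show ?case by blast
qed auto

text \<open>After multiplying \<open>f\<close> by one factor fewer, the coefficients are the partial
  sums of those of \<open>q\<close>, hence eventually equal to \<open>poly q 1\<close>. A negative
  value would propagate to \<open>f\<close>.\<close>

lemma fps_of_poly_pole:
  fixes f :: "int fps"
  assumes f: "\<And>j. fps_nth f j \<ge> 0" and q: "f * (1 - fps_X) ^ n = fps_of_poly q" and n: "0 < n"
  shows "poly q 1 \<ge> 0"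
proof (rule ccontr)
  assume neg: "\<not> poly q 1 \<ge> 0"
  obtain k where k: "n = Suc k" using n by (cases n) auto
  define g where "g = f * (1 - fps_X) ^ k"
  have "g * (1 - fps_X) = fps_of_poly q" using q by (simp add: g_def k mult_ac)
  then have gq: "fps_nth (g * (1 - fps_X)) j = coeff q j" for j by simp
  have part: "(\<Sum>i\<le>j. coeff q i) = fps_nth g j" for j
  proof (induction j)
    case 0
    show ?case using gq[of 0] by (simp add: right_diff_distrib)
  next
    case (Suc j)
    then show ?case using gq[of "Suc j"] unfolding fps_nth_mult_one_minus_X by simp
  qed
  have "fps_nth g j = poly q 1" if "j \<ge> degree q" for j
  proof -
    have "(\<Sum>i\<le>j. coeff q i) = (\<Sum>i\<le>degree q. coeff q i)"
      by (rule sum.mono_neutral_right) (use that in \<open>auto simp: coeff_eq_0\<close>)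
    then show ?thesis by (simp add: part[symmetric] poly_altdef)
  qed
  then have "\<forall>j\<ge>degree q. fps_nth (f * (1 - fps_X) ^ k) j < 0" using neg by (simp add: g_def)
  from fps_eventually_negative[OF this] obtain N where "\<forall>j\<ge>N. fps_nth f j < 0" by blast
  then show False using f[of N] by fastforce
qed

context variables
begin

text \<open>Exponents indexed by numbers carry a linear order compatible with addition, hence leading terms.\<close>

definition nat_exp :: "('v \<Rightarrow>\<^sub>0 nat) \<Rightarrow> (nat \<Rightarrow>\<^sub>0 nat)" where
  "nat_exp e = Abs_poly_mapping (\<lambda>i. if i < n then Poly_Mapping.lookup e (vr i) else 0)"

lemma lookup_nat_exp: "Poly_Mapping.lookup (nat_exp e) i = (if i < n then Poly_Mapping.lookup e (vr i) else 0)"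
proof -
  have "finite {i. (if i < n then Poly_Mapping.lookup e (vr i) else 0) \<noteq> 0}"
    by (rule finite_subset[of _ "{..<n}"]) auto
  then show ?thesis unfolding nat_exp_def by (subst lookup_Abs_poly_mapping) simp_all
qed

lemma nat_exp_add: "nat_exp (a + b) = nat_exp a + nat_exp b"
  by (rule poly_mapping_eqI) (simp add: lookup_nat_exp lookup_add)

lemma nat_exp_inj: "nat_exp a = nat_exp b \<Longrightarrow> a = b"
proof (rule poly_mapping_eqI)
  fix x assume e: "nat_exp a = nat_exp b"
  obtain i where "i < n" "x = vr i" using vr by (auto simp: bij_betw_def)
  then show "Poly_Mapping.lookup a x = Poly_Mapping.lookup b x"
    using arg_cong[OF e, of "\<lambda>p. Poly_Mapping.lookup p i"] by (simp add: lookup_nat_exp)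
qed

lemma leading_exponent:
  assumes "p \<noteq> 0"
  obtains a where "coef p a \<noteq> 0" "\<And>x. coef p x \<noteq> 0 \<Longrightarrow> nat_exp x \<le> nat_exp a"
proof -
  have "Max (nat_exp ` Poly_Mapping.keys p) \<in> nat_exp ` Poly_Mapping.keys p"
    using assms by (intro Max_in) auto
  then obtain a where a: "a \<in> Poly_Mapping.keys p" "nat_exp a = Max (nat_exp ` Poly_Mapping.keys p)" by auto
  show ?thesis
  proof (rule that)
    show "coef p a \<noteq> 0" using a(1) by (simp add: in_keys_iff)
    show "nat_exp x \<le> nat_exp a" if "coef p x \<noteq> 0" for x
      unfolding a(2) by (rule Max_ge) (use that in \<open>auto simp: in_keys_iff\<close>)
  qed
qed

text \<open>At the sum of the two leading exponents the coefficient is the product of the leading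
  coefficients: in another decomposition \<open>a + b = x + y\<close>, a smaller \<open>x\<close>
  forces \<open>y\<close> above the leading exponent of \<open>q\<close>.\<close>

lemma mpoly_no_zero_divisors:
  fixes p q :: "('v, 'k::field) mpoly"
  assumes p: "p \<noteq> 0" and q: "q \<noteq> 0"
  shows "p * q \<noteq> 0"
proof -
  obtain a where a: "coef p a \<noteq> 0" "\<And>x. coef p x \<noteq> 0 \<Longrightarrow> nat_exp x \<le> nat_exp a"
    by (rule leading_exponent[OF p]) blast
  obtain b where b: "coef q b \<noteq> 0" "\<And>x. coef q x \<noteq> 0 \<Longrightarrow> nat_exp x \<le> nat_exp b"
    by (rule leading_exponent[OF q]) blast
  have z: "coef (Poly_Mapping.single x (coef p x) * q) (a + b) = 0" if x: "x \<in> Poly_Mapping.keys p - {a}" for x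
  proof (cases "\<exists>y. a + b = x + y")
    case True
    then obtain y where y: "a + b = x + y" by blast
    have "coef q y = 0"
    proof (rule ccontr)
      assume "coef q y \<noteq> 0"
      then have "nat_exp y \<le> nat_exp b" by (rule b(2))
      moreover have "nat_exp x < nat_exp a"
        using a(2)[of x] x nat_exp_inj[of x a] by (auto simp: in_keys_iff order.strict_iff_order)
      ultimately have "nat_exp x + nat_exp y < nat_exp a + nat_exp b" by (rule add_less_le_mono[rotated])
      then show False unfolding nat_exp_add[symmetric] y by simp
    qed
    then show ?thesis unfolding y coef_single_mult_add by simp
  next
    case False
    then show ?thesis by (intro coef_single_mult_zero) blast
  qed
  have "coef (p * q) (a + b) = coef ((\<Sum>x\<in>Poly_Mapping.keys p. Poly_Mapping.single x (coef p x)) * q) (a + b)"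
    using mpoly_monomials[of p] by simp
  also have "\<dots> = (\<Sum>x\<in>Poly_Mapping.keys p. coef (Poly_Mapping.single x (coef p x) * q) (a + b))"
    by (simp only: sum_distrib_right lookup_sum)
  also have "\<dots> = (\<Sum>x\<in>{a}. coef (Poly_Mapping.single x (coef p x) * q) (a + b))"
    by (rule sum.mono_neutral_right) (use a(1) z in \<open>auto simp: in_keys_iff\<close>)
  also have "\<dots> = coef p a * coef q b" by (simp add: coef_single_mult_add)
  finally show ?thesis using a(1) b(1) by auto
qed

abbreviation psc :: "'k::field \<Rightarrow> ('v, 'k) mpoly \<Rightarrow> ('v, 'k) mpoly" where
  "psc \<equiv> \<lambda>c p. cst c * p"

lemma gops_S: "gops psc (\<lambda>i p :: ('v, 'k::field) mpoly. Var i * p) n homogeneous"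
proof -
  interpret P: vspace "psc :: 'k \<Rightarrow> ('v, 'k) mpoly \<Rightarrow> ('v, 'k) mpoly" by (rule vspace_mpoly)
  show ?thesis
  proof unfold_locales
    show "P.fin_subspace (homogeneous d)" for d by (rule homogeneous_fin)
    show "Var i * p \<in> homogeneous (d + 1)" if "p \<in> homogeneous d" for i d and p :: "('v, 'k) mpoly"
      using homogeneous_mult[OF homogeneous_Var that, of i] by (simp add: add.commute)
  qed (simp_all add: algebra_simps)
qed

definition dimS :: "'k::field itself \<Rightarrow> int \<Rightarrow> int" where
  "dimS _ d = int (vector_space.dim psc (homogeneous d :: ('v, 'k) mpoly set))"

end

lemma homogeneous_0: "homogeneous 0 = range (cst :: 'k::field \<Rightarrow> ('v::finite, 'k) mpoly)"
proof
  show "homogeneous 0 \<subseteq> range (cst :: 'k \<Rightarrow> ('v, 'k) mpoly)"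
  proof
    fix p :: "('v, 'k) mpoly" assume p: "p \<in> homogeneous 0"
    have "p = cst (coef p 0)"
    proof (rule poly_mapping_eqI)
      fix e :: "'v \<Rightarrow>\<^sub>0 nat"
      have "e = 0" if "edeg e = 0"
      proof -
        have "(\<Sum>x\<in>UNIV. Poly_Mapping.lookup e x) = 0" using that unfolding edeg_def of_nat_eq_0_iff .
        then show ?thesis by (intro poly_mapping_eqI) simp
      qed
      then show "coef p e = coef (cst (coef p 0)) e"
        using homogeneousD[OF p, of e] by (auto simp: cst_def lookup_single when_def)
    qed
    then show "p \<in> range cst" by (rule range_eqI)
  qed
qed (use homogeneous_cst in blast)

context variables
begin

lemma dimS_negative: "d < 0 \<Longrightarrow> dimS TYPE('k::field) d = 0"
proof -
  interpret P: vspace "psc :: 'k \<Rightarrow> ('v, 'k) mpoly \<Rightarrow> ('v, 'k) mpoly" by (rule vspace_mpoly)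
  show "d < 0 \<Longrightarrow> dimS TYPE('k) d = 0" by (simp add: dimS_def homogeneous_neg)
qed

lemma dimS_0: "dimS TYPE('k::field) 0 = 1"
proof -
  interpret P: vspace "psc :: 'k \<Rightarrow> ('v, 'k) mpoly \<Rightarrow> ('v, 'k) mpoly" by (rule vspace_mpoly)
  have "P.span {1} = homogeneous 0" unfolding homogeneous_0 P.span_singleton by simp
  moreover have "P.independent {1}" by (simp add: P.independent_insert P.independent_empty)
  ultimately show ?thesis unfolding dimS_def using P.dim_span_eq_card_independent[of "{1}"] by simp
qed

text \<open>The Koszul complex of the polynomial ring resolves the field, so its Euler
  characteristic is 1 in degree 0 and zero elsewhere.\<close>

lemma hilbert_series_S: "Abs_fps (\<lambda>e. dimS TYPE('k::field) (int e)) * (1 - fps_X) ^ n = 1"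
proof -
  interpret S: gops psc "\<lambda>i p :: ('v, 'k) mpoly. Var i * p" n homogeneous by (rule gops_S)
  let ?X = "\<lambda>i p :: ('v, 'k) mpoly. Var i * p"
  have kh: "S.kh (\<lambda>_. {0}) p j = (if p = 0 \<and> j = 0 then 1 else 0)" for p j
  proof (cases "p = 0 \<and> j = 0")
    case True
    have "f = 0" if f: "f \<in> S.bnd (\<lambda>_. {0}) 0 0" for f
    proof -
      obtain g where g: "g \<in> chains n (0 + 1) (homogeneous (0 - int 0 - 1))" "f - kd ?X n g \<in> chains n 0 {0}"
        by (rule S.bndE[OF f])
      have h: "homogeneous (0 - int 0 - 1) = ({0} :: ('v, 'k) mpoly set)" by (rule homogeneous_neg) simp
      have "g = 0" using g(1) unfolding h by (rule chains_trivial)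
      then show ?thesis using chains_trivial[OF g(2)] by simp
    qed
    then have b: "S.bnd (\<lambda>_. {0}) 0 0 = {0}"
      using S.fs.subspace_0[OF S.bnd_subspace[OF S.gsub_zero]] by blast
    have "S.cyc (\<lambda>_. {0}) 0 0 = chains n 0 (homogeneous 0)"
    proof
      show "chains n 0 (homogeneous 0) \<subseteq> S.cyc (\<lambda>_. {0}) 0 0"
      proof
        fix f :: "nat set \<Rightarrow> ('v, 'k) mpoly" assume f: "f \<in> chains n 0 (homogeneous 0)"
        have "kd ?X n f = 0" by (rule kd_chain_zero[OF f]) simp
        then show "f \<in> S.cyc (\<lambda>_. {0}) 0 0" using f chains_zero[of "{0}" n 0] by (simp add: S.cyc_def)
      qed
    qed (auto simp: S.cyc_def)
    then show ?thesis
      using True dimS_0[where ?'k = 'k] unfolding S.kh_def dimS_def by (simp add: b S.dim_chains[OF S.G_fin])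
  next
    case False
    have "S.cyc (\<lambda>_. {0}) p j \<subseteq> S.bnd (\<lambda>_. {0}) p j"
    proof
      fix f assume "f \<in> S.cyc (\<lambda>_. {0}) p j"
      then have f: "f \<in> chains n p (homogeneous (j - int p))" "kd ?X n f = 0"
        by (auto simp: S.cyc_def dest: chains_trivial)
      have fU: "f \<in> chains n p UNIV" by (rule chains_mono[OF f(1)]) simp
      have fT: "f T \<in> homogeneous (j - int p)" for T by (rule chains_in[OF f(1)]) simp
      have c0: "coef (f {}) 0 = 0" if "p = 0"
        using homogeneousD[OF fT, of "{}" 0] that False by fastforce
      have "kd ?X n (htp f) = f" by (rule koszul_homotopy[OF fU f(2) c0])
      moreover have "htp f \<in> chains n (p + 1) (homogeneous (j - int p - 1))"
        by (rule chains_cong_in[OF htp_chains[OF fU]]) (rule htp_homogeneous[OF fT])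
      ultimately show "f \<in> S.bnd (\<lambda>_. {0}) p j"
        using f(1) chains_zero[of "{0}" n p] by (intro S.bndI[of _ _ _ "htp f"]) simp_all
    qed
    then show ?thesis using False S.kh_zero_iff[OF S.gsub_zero, of p j] by simp
  qed
  show ?thesis
  proof (rule fps_ext)
    fix j
    have "fps_nth (Abs_fps (\<lambda>e. dimS TYPE('k) (int e)) * (1 - fps_X) ^ n) j
      = (\<Sum>p\<le>n. (-1) ^ p * (int (n choose p) * dimS TYPE('k) (int j - int p)))"
      by (rule fps_mult_one_minus_X_power) (rule dimS_negative)
    also have "\<dots> = (\<Sum>p\<le>n. (-1) ^ p * S.kh (\<lambda>_. {0}) p (int j))"
      unfolding S.euler_characteristic by (simp add: dimS_def)
    also have "\<dots> = (\<Sum>p\<le>n. if p = 0 then (if j = 0 then 1 else 0) else 0)"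
      by (rule sum.cong) (simp_all add: kh)
    also have "\<dots> = fps_nth 1 j" by simp
    finally show "fps_nth (Abs_fps (\<lambda>e. dimS TYPE('k) (int e)) * (1 - fps_X) ^ n) j = fps_nth 1 j" .
  qed
qed

end

section \<open>Torsion modules as quotients of free modules\<close>

context two_linear_resolution
begin

text \<open>On \<open>x\<close> of degree 0 the components of an annihilator \<open>p\<close> give
  values in different degrees, so each component annihilates \<open>x\<close> by itself.\<close>

lemma homogeneous_annihilator:
  assumes "nonzero_annihilator scale"
  obtains p D where "p \<in> homogeneous D" "p \<noteq> 0" "D \<ge> 0" "\<And>x. x \<in> G 0 \<Longrightarrow> scale p x = 0"
proof -
  obtain p where p: "p \<noteq> 0" "\<And>x. scale p x = 0" using assms unfolding nonzero_annihilator_def by blast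
  obtain e where e: "coef p e \<noteq> 0" using p(1) poly_mapping_eqI[of p 0] by force
  have "hcomp (edeg e) p \<noteq> 0" using e coef_hcomp[of "edeg e" p e] by auto
  moreover have "edeg e \<ge> 0" by (simp only: edeg_def of_nat_0_le_iff)
  moreover have "scale (hcomp (edeg e) p) x = 0" if x: "x \<in> G 0" for x
  proof (rule graded_zero[of "edeg ` Poly_Mapping.keys p" "\<lambda>d. scale (hcomp d p) x"])
    show "scale (hcomp d p) x \<in> G d" for d using component_scale[OF hcomp_homogeneous x, of d p] by simp
    have "(\<Sum>d\<in>edeg ` Poly_Mapping.keys p. scale (hcomp d p) x) = scale (\<Sum>d\<in>edeg ` Poly_Mapping.keys p. hcomp d p) x"
      by (rule scale_sum_left[symmetric])
    also have "\<dots> = 0" by (subst sum_hcomp) (simp_all add: p(2))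
    finally show "(\<Sum>d\<in>edeg ` Poly_Mapping.keys p. scale (hcomp d p) x) = 0" .
    show "edeg e \<in> edeg ` Poly_Mapping.keys p" using e by (simp add: in_keys_iff)
  qed simp
  ultimately show ?thesis using that[of "hcomp (edeg e) p" "edeg e"] hcomp_homogeneous by blast
qed

text \<open>A basis \<open>C\<close> of \<open>G 0\<close> generates the module, which is thus a
  quotient of a free module of rank \<open>betti F 0 0\<close>. The kernel contains all multiples of
  \<open>p\<close>, a copy of that free module shifted by \<open>D\<close>.\<close>

lemma dim_torsion:
  assumes p: "p \<in> homogeneous D" "p \<noteq> 0" and ann: "\<And>x. x \<in> G 0 \<Longrightarrow> scale p x = 0"
  shows "int (M.dim (G (int e))) + int (betti F 0 0) * dimS TYPE('k) (int e - D) \<le> int (betti F 0 0) * dimS TYPE('k) (int e)"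
proof -
  interpret P: vspace "psc :: 'k \<Rightarrow> ('v, 'k) mpoly \<Rightarrow> ('v, 'k) mpoly" by (rule vspace_mpoly)
  interpret U: vspace "fun_scale psc :: 'k \<Rightarrow> ('m \<Rightarrow> ('v, 'k) mpoly) \<Rightarrow> 'm \<Rightarrow> ('v, 'k) mpoly"
    by (rule vspace_fun) (rule vspace_mpoly)
  interpret UM: vspace_pair "fun_scale psc :: 'k \<Rightarrow> ('m \<Rightarrow> ('v, 'k) mpoly) \<Rightarrow> 'm \<Rightarrow> ('v, 'k) mpoly" msc ..
  interpret UU: vspace_pair "fun_scale psc :: 'k \<Rightarrow> ('m \<Rightarrow> ('v, 'k) mpoly) \<Rightarrow> 'm \<Rightarrow> ('v, 'k) mpoly"
    "fun_scale psc :: 'k \<Rightarrow> ('m \<Rightarrow> ('v, 'k) mpoly) \<Rightarrow> 'm \<Rightarrow> ('v, 'k) mpoly" ..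
  obtain C where C: "C \<subseteq> G 0" "finite C" "M.independent C" "M.span C = G 0" "card C = M.dim (G 0)"
    by (rule M.fin_subspace_basis[OF M.G_fin]) blast
  define \<phi> where "\<phi> u = (\<Sum>c\<in>C. scale (u c) c)" for u
  define \<mu> where "\<mu> u = (\<lambda>c. p * u c)" for u :: "'m \<Rightarrow> ('v, 'k) mpoly"
  let ?V = "\<lambda>d. fun_on C (homogeneous d :: ('v, 'k) mpoly set)"
  have Vfin: "U.fin_subspace (?V d)" for d by (rule P.fun_on_fin_subspace[OF C(2) homogeneous_fin])
  have dimV: "int (U.dim (?V d)) = int (betti F 0 0) * dimS TYPE('k) d" for d
    by (simp add: P.dim_fun_on[OF C(2) homogeneous_fin] C(5) betti_0_0 dimS_def)
  have \<phi>_linear: "Vector_Spaces.linear (fun_scale psc) msc \<phi>"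
    by unfold_locales
      (simp_all add: \<phi>_def scale_left_distrib sum.distrib fun_scale_def msc_def scale_sum_right)
  have \<mu>_linear: "Vector_Spaces.linear (fun_scale psc) (fun_scale psc) \<mu>"
    by unfold_locales (simp_all add: \<mu>_def fun_scale_def fun_eq_iff algebra_simps)
  have surj: "\<exists>u\<in>?V (int e). z = \<phi> u" if "z \<in> G (int e)" for z e
    using that
  proof (induction e arbitrary: z)
    case 0
    then have "z \<in> range (\<lambda>u. \<Sum>c\<in>C. msc (u c) c)" using M.span_finite[OF C(2)] C(4) by simp
    then obtain u where u: "z = (\<Sum>c\<in>C. msc (u c) c)" by blast
    define u' :: "'m \<Rightarrow> ('v, 'k) mpoly" where "u' c = (if c \<in> C then cst (u c) else 0)" for c
    have "u' \<in> ?V (int 0)" by (rule fun_onI) (simp_all add: u'_def homogeneous_cst)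
    moreover have "z = \<phi> u'" unfolding \<phi>_def u msc_def by (rule sum.cong) (simp_all add: u'_def)
    ultimately show ?case by blast
  next
    case (Suc e)
    obtain w where w: "\<And>i. i < n \<Longrightarrow> w i \<in> G (int (Suc e) - 1)" "z = (\<Sum>i<n. XM i (w i))"
      using generated[OF _ Suc.prems] by auto
    have "\<forall>i. \<exists>u. i < n \<longrightarrow> u \<in> ?V (int e) \<and> w i = \<phi> u"
      using Suc.IH w(1) by (simp add: Bex_def)
    then obtain u where u: "\<And>i. i < n \<Longrightarrow> u i \<in> ?V (int e)" "\<And>i. i < n \<Longrightarrow> w i = \<phi> (u i)" by metis
    define v where "v c = (\<Sum>i<n. Var i * u i c)" for c
    have "v \<in> ?V (int (Suc e))"
    proof (rule fun_onI)
      fix c assume c: "c \<in> C"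
      have "Var i * u i c \<in> homogeneous (1 + int e)" if "i < n" for i
        by (rule homogeneous_mult[OF homogeneous_Var fun_on_in[OF u(1)[OF that] c]])
      then have "v c \<in> homogeneous (1 + int e)" unfolding v_def by (intro homogeneous_sum) simp
      then show "v c \<in> homogeneous (int (Suc e))" by simp
    next
      fix c assume c: "c \<notin> C"
      show "v c = 0" unfolding v_def using fun_on_out[OF u(1) c] by simp
    qed
    moreover have "z = \<phi> v"
    proof -
      have "z = (\<Sum>i<n. \<Sum>c\<in>C. scale (Var i * u i c) c)"
        unfolding w(2) by (rule sum.cong) (simp_all add: u(2) \<phi>_def XM_def scale_sum_right)
      also have "\<dots> = (\<Sum>c\<in>C. \<Sum>i<n. scale (Var i * u i c) c)" by (rule sum.swap)
      also have "\<dots> = \<phi> v" by (simp add: \<phi>_def v_def scale_sum_left)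
      finally show ?thesis .
    qed
    ultimately show ?case by blast
  qed
  let ?K = "{u \<in> ?V (int e). \<phi> u = 0}"
  have "\<mu> ` ?V (int e - D) \<subseteq> ?K"
  proof
    fix v assume "v \<in> \<mu> ` ?V (int e - D)"
    then obtain u where u: "u \<in> ?V (int e - D)" "v = \<mu> u" by blast
    have "v \<in> ?V (int e)"
    proof (rule fun_onI)
      show "v c \<in> homogeneous (int e)" if "c \<in> C" for c
        using homogeneous_mult[OF p(1) fun_on_in[OF u(1) that]] by (simp add: u(2) \<mu>_def)
      show "v c = 0" if "c \<notin> C" for c using fun_on_out[OF u(1) that] by (simp add: u(2) \<mu>_def)
    qed
    moreover have "scale (p * u c) c = 0" if "c \<in> C" for c
    proof -
      have "scale (p * u c) c = scale (u c) (scale p c)" by (simp add: mult.commute)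
      then show ?thesis unfolding ann[OF subsetD[OF C(1) that]] scale_zero_right .
    qed
    then have "\<phi> v = 0" unfolding \<phi>_def u(2) \<mu>_def by (intro sum.neutral) simp
    ultimately show "v \<in> ?K" by blast
  qed
  moreover have Kfin: "U.fin_subspace ?K"
  proof (rule U.fin_subspace_mono[OF Vfin])
    interpret L: Vector_Spaces.linear "fun_scale psc" msc \<phi> by (rule \<phi>_linear)
    show "U.subspace ?K"
      using U.fin_subspaceD[OF Vfin, of "int e"] unfolding U.subspace_def by (simp add: L.zero L.add L.scale)
  qed blast
  moreover have "U.fin_subspace (\<mu> ` ?V (int e - D))" by (rule UU.fin_subspace_image[OF \<mu>_linear Vfin])
  ultimately have "U.dim (\<mu> ` ?V (int e - D)) \<le> U.dim ?K"
    using U.dim_mono_fin[OF Kfin] U.fin_subspaceD by blast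
  moreover have "U.dim (\<mu> ` ?V (int e - D)) = U.dim (?V (int e - D))"
  proof (rule UU.dim_image_inj[OF \<mu>_linear Vfin])
    fix u :: "'m \<Rightarrow> ('v, 'k) mpoly" assume "\<mu> u = 0"
    then have "p * u c = 0" for c by (simp add: \<mu>_def fun_eq_iff)
    then have "u c = 0" for c using mpoly_no_zero_divisors[OF p(2), of "u c"] by blast
    then show "u = 0" by (simp add: fun_eq_iff)
  qed
  moreover have "U.dim (?V (int e)) = U.dim ?K + M.dim (\<phi> ` ?V (int e))"
    by (rule UM.rank_nullity[OF \<phi>_linear Vfin])
  moreover have "M.dim (G (int e)) \<le> M.dim (\<phi> ` ?V (int e))"
    by (rule M.dim_mono_fin[OF UM.fin_subspace_image[OF \<phi>_linear Vfin] M.G_sub]) (use surj in blast)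
  ultimately have "int (M.dim (G (int e))) + int (U.dim (?V (int e - D))) \<le> int (U.dim (?V (int e)))" by linarith
  then show ?thesis unfolding dimV .
qed

lemma torsion_bound:
  fixes b :: "nat \<Rightarrow> int"
  assumes tors: "nonzero_annihilator scale" and n: "0 < n"
    and b: "hs * (1 - fps_X) ^ n = fps_const (int (betti F 0 0)) - (\<Sum>l<n. fps_const (b l) * fps_X ^ 2 * (1 - fps_X) ^ l)"
  shows "int (betti F 0 0) \<le> b 0"
proof -
  obtain p D where p: "p \<in> homogeneous D" "p \<noteq> 0" "D \<ge> 0" "\<And>x. x \<in> G 0 \<Longrightarrow> scale p x = 0"
    by (rule homogeneous_annihilator[OF tors]) blast
  define m where "m = int (betti F 0 0)"
  define S where "S = Abs_fps (\<lambda>e. dimS TYPE('k) (int e))"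
  define f where "f = fps_const m * S - fps_const m * fps_X ^ nat D * S - hs"
  \<comment> \<open>The numerator of \<open>f\<close> over \<open>(1 - t) ^ n\<close>. The constant
    terms \<open>m\<close> of the free module and of the module cancel, and at \<open>t = 1\<close>
    the shift \<open>t ^ D\<close> disappears, so that \<open>poly q 1 = b 0 - m\<close>.\<close>
  define q where "q = (\<Sum>l<n. [:b l:] * monom 1 2 * [:1, -1:] ^ l) - [:m:] * monom 1 (nat D)"
  have "fps_nth f e \<ge> 0" for e
  proof -
    have "fps_nth (fps_X ^ nat D * S) e = dimS TYPE('k) (int e - D)"
      using p(3) dimS_negative[where ?'k = 'k, of "int e - D"]
      by (auto simp: fps_X_power_mult_nth S_def of_nat_diff)
    then have "fps_nth f e = m * dimS TYPE('k) (int e) - m * dimS TYPE('k) (int e - D) - int (M.dim (G (int e)))"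
      by (simp add: f_def mult.assoc hs_def) (simp add: S_def)
    then show ?thesis using dim_torsion[OF p(1,2,4), of e] by (simp add: m_def)
  qed
  moreover have "f * (1 - fps_X) ^ n = fps_of_poly q"
  proof -
    have S: "S * (1 - fps_X) ^ n = 1" unfolding S_def by (rule hilbert_series_S)
    have "f * (1 - fps_X) ^ n = fps_const m * (S * (1 - fps_X) ^ n) - fps_const m * fps_X ^ nat D * (S * (1 - fps_X) ^ n)
      - hs * (1 - fps_X) ^ n"
      by (simp add: f_def algebra_simps)
    also have "\<dots> = (\<Sum>l<n. fps_const (b l) * fps_X ^ 2 * (1 - fps_X) ^ l) - fps_const m * fps_X ^ nat D"
      unfolding S b m_def by simp
    also have "\<dots> = fps_of_poly q"
    proof -
      have "fps_of_poly [:1, -1:] = (1 - fps_X :: int fps)"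
        by (simp add: fps_of_poly_pCons)
      then show ?thesis
        unfolding q_def by (simp only: fps_of_poly_diff fps_of_poly_sum fps_of_poly_mult fps_of_poly_power
            fps_of_poly_monom fps_of_poly_const fps_const_1_eq_1 mult_1)
    qed
    finally show ?thesis .
  qed
  ultimately have "poly q 1 \<ge> 0" using n by (rule fps_of_poly_pole)
  moreover have "poly q 1 = b 0 - m"
  proof -
    have "poly q 1 = (\<Sum>l<n. b l * 0 ^ l) - m" by (simp add: q_def poly_sum poly_monom)
    also have "(\<Sum>l<n. b l * 0 ^ l) = (\<Sum>l\<in>{0}. b l * 0 ^ l)"
      by (rule sum.mono_neutral_right) (use n in auto)
    finally show ?thesis by simp
  qed
  ultimately show ?thesis by (simp add: m_def)
qed

end

section \<open>The coefficients of the pure diagrams\<close>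

lemma Omega_mat_entry:
  "Omega_mat n \<in> carrier_mat n n" "i < n \<Longrightarrow> j < n \<Longrightarrow> index_mat (Omega_mat n) (i, j) = of_nat ((j + 1) * ((i + 2) choose (j + 2)))"
  by (simp_all add: Omega_mat_def)

text \<open>The matrix is lower triangular, and with indices from 0 its diagonal entries are
  \<open>i + 1\<close>.\<close>

lemma Omega_mat_inverse:
  obtains B where "mat_inverse (Omega_mat n) = Some B" "B \<in> carrier_mat n n"
    "Omega_mat n * B = 1\<^sub>m n" "B * Omega_mat n = 1\<^sub>m n"
proof -
  have "det (Omega_mat n) = prod_list (diag_mat (Omega_mat n))"
    by (rule det_lower_triangular[OF _ Omega_mat_entry(1)]) (simp add: Omega_mat_entry binomial_eq_0)
  also have "\<dots> \<noteq> 0"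
  proof -
    have "index_mat (Omega_mat n) (i, i) \<noteq> 0" if "i < n" for i
      using that by (simp add: Omega_mat_entry del: of_nat_mult)
    then show ?thesis using Omega_mat_entry(1)[of n] by (auto simp: diag_mat_def prod_list_zero_iff)
  qed
  finally have unit: "Omega_mat n \<in> Units (ring_mat TYPE(rat) n ())"
    by (rule det_non_zero_imp_unit[OF Omega_mat_entry(1)])
  have "mat_inverse (Omega_mat n) \<noteq> None"
  proof
    assume "mat_inverse (Omega_mat n) = None"
    from mat_inverse(1)[OF Omega_mat_entry(1) this] unit show False by (rule notE)
  qed
  then obtain B where B: "mat_inverse (Omega_mat n) = Some B" by (rule exE[OF iffD1[OF not_None_eq]])
  from mat_inverse(2)[OF Omega_mat_entry(1) B] show ?thesis by (intro that[OF B]) simp_all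
qed

lemma invertible_Omega_mat: "invertible_mat (Omega_mat n)"
proof -
  obtain B where B: "B \<in> carrier_mat n n" "Omega_mat n * B = 1\<^sub>m n" "B * Omega_mat n = 1\<^sub>m n"
    by (rule Omega_mat_inverse)
  then show ?thesis using Omega_mat_entry(1)[of n] unfolding invertible_mat_def inverts_mat_def by auto
qed

lemma diagram_coeffs_eqI:
  assumes c: "c \<in> carrier_vec n"
    and eq: "\<And>j. j < n \<Longrightarrow> (\<Sum>l<n. vec_index c l * of_nat ((j + 1) * ((l + 2) choose (j + 2)))) = of_nat (\<beta> (j + 1) (int j + 2))"
  shows "diagram_coeffs n \<beta> = c"
proof -
  obtain B where B: "mat_inverse (Omega_mat n) = Some B" "B \<in> carrier_mat n n" "Omega_mat n * B = 1\<^sub>m n"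
    by (rule Omega_mat_inverse)
  have cm: "mat_of_row c \<in> carrier_mat 1 n" using c by (auto simp: mat_of_row_def)
  have "mat_of_row c * Omega_mat n = mat_of_row (omega_vec n \<beta>)"
  proof (rule eq_matI)
    fix i j assume "i < dim_row (mat_of_row (omega_vec n \<beta>))" "j < dim_col (mat_of_row (omega_vec n \<beta>))"
    then have ij: "i = 0" "j < n" by (simp_all add: omega_vec_def mat_of_row_def)
    have "index_mat (mat_of_row c * Omega_mat n) (i, j) = row (mat_of_row c) i \<bullet> col (Omega_mat n) j"
      using ij cm Omega_mat_entry(1)[of n] by (intro index_mult_mat) auto
    also have "\<dots> = (\<Sum>l<n. vec_index c l * of_nat ((j + 1) * ((l + 2) choose (j + 2))))"
      unfolding scalar_prod_def lessThan_atLeast0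
      by (rule sum.cong) (use ij c in \<open>simp_all add: Omega_mat_def mat_of_row_def del: of_nat_mult mult_Suc binomial_Suc_Suc\<close>)
    also have "\<dots> = index_mat (mat_of_row (omega_vec n \<beta>)) (i, j)"
      using ij eq[OF ij(2)] by (simp add: omega_vec_def mat_of_row_def add.commute del: of_nat_mult)
    finally show "index_mat (mat_of_row c * Omega_mat n) (i, j) = index_mat (mat_of_row (omega_vec n \<beta>)) (i, j)" .
  qed (use cm Omega_mat_entry(1)[of n] in \<open>auto simp: omega_vec_def mat_of_row_def\<close>)
  then have "mat_of_row (omega_vec n \<beta>) * B = mat_of_row c * (Omega_mat n * B)"
    using assoc_mult_mat[OF cm Omega_mat_entry(1) B(2)] by simp
  also have "\<dots> = mat_of_row c" unfolding B(3) by (rule right_mult_one_mat[OF cm])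
  finally show ?thesis unfolding diagram_coeffs_def B(1) by simp
qed

text \<open>The origin of the entries of \<open>Omega_mat\<close>: by absorption the summand is
  \<open>(j + 1) * ((i + 1) choose (j + 1))\<close>, and these add up by the hockey-stick
  identity.\<close>

lemma sum_Suc_times_binomial: "(\<Sum>i<Suc l. (i + 1) * (i choose j)) = (j + 1) * ((l + 2) choose (j + 2))"
proof (induction l)
  case 0
  then show ?case by (cases j) simp_all
next
  case (Suc l)
  have "Suc (Suc l) * (Suc l choose j) = (Suc (Suc l) choose Suc j) * Suc j" by (rule Suc_times_binomial_eq)
  then show ?case using Suc by (simp add: algebra_simps)
qed

lemma summation_by_parts:
  fixes A g :: "nat \<Rightarrow> rat"
  shows "(\<Sum>l<n. (A l - A (Suc l)) * (\<Sum>i<Suc l. g i)) = (\<Sum>l<n. A l * g l) - A n * (\<Sum>i<n. g i)"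
  by (induction n) (simp_all add: algebra_simps)

lemma pure_diagram_decomposition:
  fixes b :: "nat \<Rightarrow> int"
  assumes nonneg: "\<And>l. l < n \<Longrightarrow> b l \<ge> 0"
    and decr: "\<And>l. Suc l < n \<Longrightarrow> int (l + 1) * b (Suc l) \<le> int (l + 2) * b l"
    and \<beta>: "\<And>i. i \<ge> 1 \<Longrightarrow> int (\<beta> i (int i + 1)) = (\<Sum>l<n. b l * int (l choose (i - 1)))"
    and lin: "two_linear \<beta>" and n: "0 < n"
  defines "c \<equiv> diagram_coeffs n \<beta>"
  shows "\<And>l. l < n \<Longrightarrow> vec_index c l \<ge> 0" "(\<Sum>l<n. vec_index c l) = of_int (b 0)"
    "\<And>i j. (i, j) \<noteq> (0, 0) \<Longrightarrow> of_nat (\<beta> i j) = (\<Sum>l<n. vec_index c l * pure_diagram (Suc l) i j)"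
proof -
  \<comment> \<open>The sequence whose differences are the coefficients. The value 0 at
    \<open>n\<close> removes the boundary term in the summation by parts and makes the last
    coefficient \<open>A (n - 1)\<close>.\<close>
  define A where "A l = (if l < n then of_int (b l) / of_nat (l + 1) else 0 :: rat)" for l
  have key: "(\<Sum>l<n. (A l - A (Suc l)) * of_nat ((j + 1) * ((l + 2) choose (j + 2))))
    = of_nat (\<beta> (j + 1) (int j + 2))" for j
  proof -
    have "(\<Sum>l<n. (A l - A (Suc l)) * of_nat ((j + 1) * ((l + 2) choose (j + 2))))
      = (\<Sum>l<n. (A l - A (Suc l)) * (\<Sum>i<Suc l. of_nat ((i + 1) * (i choose j))))"
      by (simp only: sum_Suc_times_binomial[symmetric] of_nat_sum)
    also have "\<dots> = (\<Sum>l<n. A l * of_nat ((l + 1) * (l choose j)))"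
      unfolding summation_by_parts by (simp add: A_def)
    also have "\<dots> = (\<Sum>l<n. of_int (b l * int (l choose j)))"
      by (rule sum.cong) (simp_all add: A_def field_simps)
    also have "\<dots> = of_int (int (\<beta> (j + 1) (int (j + 1) + 1)))"
      by (subst \<beta>) simp_all
    finally show ?thesis by (simp add: add.commute)
  qed
  have "c = vec n (\<lambda>l. A l - A (Suc l))"
    unfolding c_def
  proof (rule diagram_coeffs_eqI)
    fix j
    have "(\<Sum>l<n. vec_index (vec n (\<lambda>l. A l - A (Suc l))) l * of_nat ((j + 1) * ((l + 2) choose (j + 2))))
      = (\<Sum>l<n. (A l - A (Suc l)) * of_nat ((j + 1) * ((l + 2) choose (j + 2))))"
      by (rule sum.cong) simp_all
    then show "(\<Sum>l<n. vec_index (vec n (\<lambda>l. A l - A (Suc l))) l * of_nat ((j + 1) * ((l + 2) choose (j + 2))))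
      = of_nat (\<beta> (j + 1) (int j + 2))"
      by (simp only: key)
  qed simp
  then have c: "vec_index c l = A l - A (Suc l)" if "l < n" for l using that by simp
  show "vec_index c l \<ge> 0" if l: "l < n" for l
  proof (cases "Suc l < n")
    case True
    have "of_int (int (l + 1) * b (Suc l)) \<le> (of_int (int (l + 2) * b l) :: rat)"
      using decr[OF True] by (simp only: of_int_le_iff)
    then show ?thesis using l True by (simp add: c A_def field_simps)
  next
    case False
    then show ?thesis using l nonneg[OF l] by (simp add: c A_def)
  qed
  have "(\<Sum>l<n. vec_index c l) = (\<Sum>l<n. A l - A (Suc l))" by (rule sum.cong) (simp_all add: c)
  also have "\<dots> = A 0 - A n" by (rule sum_lessThan_telescope')
  finally show "(\<Sum>l<n. vec_index c l) = of_int (b 0)" using n by (simp add: A_def)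
  show "of_nat (\<beta> i j) = (\<Sum>l<n. vec_index c l * pure_diagram (Suc l) i j)" if ij: "(i, j) \<noteq> (0, 0)" for i j
  proof (cases "i \<ge> 1 \<and> j = int i + 1")
    case True
    then obtain k where k: "i = k + 1" using le_Suc_ex[of 1 i] by auto
    have j: "j = int k + 2" using True k by simp
    \<comment> \<open>The entry of \<open>Omega_mat\<close> in row \<open>l\<close> and column
      \<open>k\<close>; past the length of the pure diagram the binomial coefficient
      vanishes.\<close>
    have "pure_diagram (Suc l) i j = of_nat ((k + 1) * ((l + 2) choose (k + 2)))" for l
      by (cases "k \<le> l") (simp_all add: pure_diagram_def k j binomial_eq_0)
    then have "(\<Sum>l<n. vec_index c l * pure_diagram (Suc l) i j)
      = (\<Sum>l<n. (A l - A (Suc l)) * of_nat ((k + 1) * ((l + 2) choose (k + 2))))"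
      by (intro sum.cong) (simp_all add: c)
    then show ?thesis unfolding key k j by simp
  next
    case False
    then have "\<beta> i j = 0" using lin ij unfolding two_linear_def by (cases "i = 0") auto
    moreover have "pure_diagram l i j = 0" for l using False ij by (auto simp: pure_diagram_def)
    ultimately show ?thesis by simp
  qed
qed

theorem mainTheorem3:
  fixes scale :: "('v::finite, 'k::field) mpoly \<Rightarrow> 'm::ab_group_add \<Rightarrow> 'm"
    and G :: "int \<Rightarrow> 'm set"
    and F :: "('v, 'k, 'm) free_complex"
    and \<beta> :: "nat \<Rightarrow> int \<Rightarrow> nat"
    and n m :: nat
    and c :: "rat vec"
  assumes "n = card (UNIV :: 'v set)"
    and "graded_module scale G"
    and "\<exists>B. finite B \<and> Modules.module.span scale B = UNIV"
    and "graded_free_resolution scale G F"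
    and "\<beta> = betti F"
    and "two_linear \<beta>"
    and "\<beta> 0 0 = m"
    and "c = diagram_coeffs n \<beta>"
  shows "invertible_mat (Omega_mat n)
    \<and> (\<forall>l\<in>{1..n}. c $ (l - 1) \<ge> 0)
    \<and> (nonzero_annihilator scale \<longrightarrow> (\<Sum>l=1..n. c $ (l - 1)) = of_nat m)
    \<and> (\<forall>i j. (i, j) \<noteq> (0, 0) \<or> nonzero_annihilator scale \<longrightarrow>
          of_nat (\<beta> i j) = (\<Sum>l=1..n. c $ (l - 1) * pure_diagram l i j))"
proof -
  \<comment> \<open>Types are inhabited, so there is at least one variable and \<open>b 0\<close>
    exists.\<close>
  have n: "0 < n" unfolding assms(1) by (simp add: card_gt_0_iff)
  obtain vr :: "nat \<Rightarrow> 'v" where vr: "bij_betw vr {..<n} UNIV"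
    using ex_bij_betw_nat_finite[of "UNIV :: 'v set"] unfolding assms(1) lessThan_atLeast0 by auto
  interpret T: two_linear_resolution scale G F vr n
    using assms(4-6) vr
    unfolding two_linear_resolution_def two_linear_resolution_axioms_def resolution_def variables_def by simp
  obtain b :: "nat \<Rightarrow> int" where b: "\<And>l. l < n \<Longrightarrow> b l \<ge> 0"
    "\<And>l. Suc l < n \<Longrightarrow> int (l + 1) * b (Suc l) \<le> int (l + 2) * b l" "b 0 \<le> int (betti F 0 0)"
    "T.hs * (1 - fps_X) ^ n = fps_const (int (betti F 0 0)) - (\<Sum>l<n. fps_const (b l) * fps_X ^ 2 * (1 - fps_X) ^ l)"
    "\<And>i. i \<ge> 1 \<Longrightarrow> int (\<beta> i (int i + 1)) = (\<Sum>l<n. b l * int (l choose (i - 1)))"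
    using T.betti_formula n unfolding assms(5) by blast
  note D = pure_diagram_decomposition[OF b(1) b(2) b(5) assms(6) n, folded assms(8)]
  have shift: "(\<Sum>l=1..n. c $ (l - 1) * h l) = (\<Sum>l<n. c $ l * h (Suc l))" for h :: "nat \<Rightarrow> rat"
    using sum.shift_bounds_Suc_ivl[of "\<lambda>l. c $ (l - 1) * h l" 0 n]
    by (simp add: atLeastLessThanSuc_atLeastAtMost lessThan_atLeast0)
  have sum_c: "(\<Sum>l=1..n. c $ (l - 1)) = of_nat m" if "nonzero_annihilator scale"
  proof -
    \<comment> \<open>One inequality comes from the sections and holds in general; only the other
      one uses torsion.\<close>
    have "b 0 = int m" using T.torsion_bound[OF that n b(4)] b(3) assms(5,7) by simp
    then show ?thesis using shift[of "\<lambda>_. 1"] D(2) by simp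
  qed
  have "of_nat (\<beta> i j) = (\<Sum>l=1..n. c $ (l - 1) * pure_diagram l i j)"
    if "(i, j) \<noteq> (0, 0) \<or> nonzero_annihilator scale" for i j
  proof (cases "(i, j) = (0, 0)")
    case True
    then show ?thesis using sum_c that assms(7) by (simp add: pure_diagram_def)
  next
    case False
    show ?thesis unfolding shift by (rule D(3)) (use False in simp_all)
  qed
  moreover have "c $ (l - 1) \<ge> 0" if "l \<in> {1..n}" for l
    using that by (intro D(1)) auto
  ultimately show ?thesis using invertible_Omega_mat sum_c by blast
qed

end
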